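(* Let $\mathcal{U}=(U_\alpha)_{\alpha>0}$ be a sub-Markovian resolvent of kernels on a Lusin measurable space $(E,\mathcal{B})$, let $m$ be a $\sigma$-finite $\mathcal{U}$-sub-invariant measure, and let $1<p<\infty$. Consider the following conditions. (i) $\mathcal{U}$ is $m$-irreducible and $m$-recurrent. (ii) If $u\in L^p(E,m)$ and $\alpha U_\alpha u=u$ ($m$-a.e., for all $\alpha>0$), then $u$ is ($m$-a.e.) constant. (iii) For all $u\in L^p(E,m)$ we have $\lim_{\alpha\to0}\|\alpha U_\alpha u-c_u\|_p=0$, where $c_u$ is the constant defined by $c_u:=\frac{1}{m(E)}\int u\,dm$ if $m(E)<\infty$ and $c_u:=0$ if $m(E)=+\infty$. Then (i) $\Rightarrow$ (iii) $\Rightarrow$ (ii). If $m(E)=\infty$ then (ii) $\Leftrightarrow$ (iii). If $m(E)<\infty$ then (i) $\Leftrightarrow$ (iii). If in addition $\mathcal{U}$ is $m$-recurrent, then (i), (ii) and (iii) are equivalent.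
   Context: A sub-Markovian resolvent of kernels satisfies the resolvent equation and $\alpha U_\alpha1\le1$; $p\mathcal{B}$ denotes the positive $\mathcal{B}$-measurable functions on $E$. The measure $m$ is sub-invariant if $m\circ\alpha U_\alpha\le m$ for all $\alpha>0$; then each $\alpha U_\alpha$ is a contraction on $L^p(E,m)$, whose norm is denoted $\|\cdot\|_p$. The initial kernel is $U:=\sup_{\alpha}U_\alpha=\sup_n U_{1/n}$. $\mathcal{U}$ is $m$-recurrent if for every $f\in p\mathcal{B}\cap L^1(E,m)$ we have $m(\{x\in E:0<Uf(x)<\infty\})=0$. A set $A\in\mathcal{B}$ is $\mathcal{U}$-absorbing (with respect to $m$) if $U(1_{E\setminus A})=0$ $m$-a.e. on $A$. $\mathcal{U}$ is $m$-irreducible if every $\mathcal{U}$-absorbing $A$ satisfies $m(A)=0$ or $m(E\setminus A)=0$.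
   Formalization: It is additionally assumed that U1 is not m-a.e. zero unless m = 0; without this the claim fails: on a one-point space of unit mass with all U_α = 0, condition (i) holds, but αU_α1 = 0 does not converge to c_1 = 1, so (iii) fails. *)

theory Defs
  imports "HOL-Analysis.Analysis"
begin

text \<open>
  Lusin measurable space: isomorphic, as a measurable space, to a Borel subset of a compact
  metrizable space. A compact metrizable space has at most the cardinality of the continuum, so
  its underlying set may be taken to be a set of reals. The topology \<open>X\<close> on it is arbitrary
  and unrelated to the usual topology of the reals.
\<close>

definition borel_sigma :: "'b topology \<Rightarrow> 'b measure" where
  "borel_sigma X = sigma (topspace X) {V. openin X V}"

definition lusin_measurable_space :: "'a measure \<Rightarrow> bool" where
  "lusin_measurable_space M \<longleftrightarrow>
     (\<exists>(X :: real topology) H f g.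
        compact_space X \<and> metrizable_space X \<and> H \<in> sets (borel_sigma X) \<and>
        f \<in> measurable M (restrict_space (borel_sigma X) H) \<and>
        g \<in> measurable (restrict_space (borel_sigma X) H) M \<and>
        (\<forall>x\<in>space M. g (f x) = x) \<and> (\<forall>y\<in>H. f (g y) = y))"

definition kernel :: "'a measure \<Rightarrow> ('a \<Rightarrow> 'a measure) \<Rightarrow> bool" where
  "kernel M K \<longleftrightarrow>
     (\<forall>x\<in>space M. sets (K x) = sets M) \<and>
     (\<forall>A\<in>sets M. (\<lambda>x. emeasure (K x) A) \<in> borel_measurable M)"

text \<open>
  The resolvent equation \<open>U\<^sub>\<alpha> - U\<^sub>\<beta> = (\<beta> - \<alpha>) U\<^sub>\<alpha> U\<^sub>\<beta>\<close> is an identity between signed kernels. It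
  may be written with real-valued measures, because \<open>\<alpha> U\<^sub>\<alpha> 1 \<le> 1\<close> makes every \<open>U\<^sub>\<alpha>\<close> finite.
\<close>

definition sub_markovian_resolvent :: "'a measure \<Rightarrow> (real \<Rightarrow> 'a \<Rightarrow> 'a measure) \<Rightarrow> bool" where
  "sub_markovian_resolvent M U \<longleftrightarrow>
     (\<forall>\<alpha>>0. kernel M (U \<alpha>)) \<and>
     (\<forall>\<alpha>>0. \<forall>x\<in>space M. ennreal \<alpha> * emeasure (U \<alpha> x) (space M) \<le> 1) \<and>
     (\<forall>\<alpha>>0. \<forall>\<beta>>0. \<forall>x\<in>space M. \<forall>A\<in>sets M.
        measure (U \<alpha> x) A - measure (U \<beta> x) A
          = (\<beta> - \<alpha>) * (\<integral>y. measure (U \<beta> y) A \<partial>U \<alpha> x))"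

text \<open>In what follows the measure \<open>m\<close> also carries the measurable space \<open>(E, \<B>)\<close>.\<close>

definition sub_invariant :: "'a measure \<Rightarrow> (real \<Rightarrow> 'a \<Rightarrow> 'a measure) \<Rightarrow> bool" where
  "sub_invariant m U \<longleftrightarrow>
     (\<forall>\<alpha>>0. \<forall>A\<in>sets m. (\<integral>\<^sup>+x. ennreal \<alpha> * emeasure (U \<alpha> x) A \<partial>m) \<le> emeasure m A)"

text \<open>
  The initial kernel as an operator on \<open>[0, \<infinity>]\<close>-valued functions. The resolvent equation makes
  \<open>\<alpha> \<mapsto> U\<^sub>\<alpha> f\<close> decreasing, so the supremum is also the one over \<open>\<alpha> = 1/n\<close>.
\<close>

definition initial_kernel ::
    "(real \<Rightarrow> 'a \<Rightarrow> 'a measure) \<Rightarrow> ('a \<Rightarrow> ennreal) \<Rightarrow> 'a \<Rightarrow> ennreal" where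
  "initial_kernel U f x = (SUP \<alpha>\<in>{0<..}. \<integral>\<^sup>+y. f y \<partial>U \<alpha> x)"

definition m_recurrent :: "'a measure \<Rightarrow> (real \<Rightarrow> 'a \<Rightarrow> 'a measure) \<Rightarrow> bool" where
  "m_recurrent m U \<longleftrightarrow>
     (\<forall>f. f \<in> borel_measurable m \<and> (\<integral>\<^sup>+x. f x \<partial>m) < \<infinity> \<longrightarrow>
        {x \<in> space m. 0 < initial_kernel U f x \<and> initial_kernel U f x < \<infinity>} \<in> null_sets m)"

definition absorbing :: "'a measure \<Rightarrow> (real \<Rightarrow> 'a \<Rightarrow> 'a measure) \<Rightarrow> 'a set \<Rightarrow> bool" where
  "absorbing m U A \<longleftrightarrow>
     A \<in> sets m \<and> (AE x in m. x \<in> A \<longrightarrow> initial_kernel U (indicator (space m - A)) x = 0)"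

definition m_irreducible :: "'a measure \<Rightarrow> (real \<Rightarrow> 'a \<Rightarrow> 'a measure) \<Rightarrow> bool" where
  "m_irreducible m U \<longleftrightarrow>
     (\<forall>A. absorbing m U A \<longrightarrow> emeasure m A = 0 \<or> emeasure m (space m - A) = 0)"

definition Lp :: "'a measure \<Rightarrow> real \<Rightarrow> ('a \<Rightarrow> real) set" where
  "Lp m p = {u \<in> borel_measurable m. integrable m (\<lambda>x. \<bar>u x\<bar> powr p)}"

definition Lp_norm :: "'a measure \<Rightarrow> real \<Rightarrow> ('a \<Rightarrow> real) \<Rightarrow> real" where
  "Lp_norm m p u = (\<integral>x. \<bar>u x\<bar> powr p \<partial>m) powr (1 / p)"

text \<open>
  The operator \<open>\<alpha> U\<^sub>\<alpha>\<close> on real-valued functions. For \<open>u \<in> L\<^sup>p(E, m)\<close> the integral converges for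
  \<open>m\<close>-almost every \<open>x\<close>, and takes the value 0 on the exceptional null set.
\<close>

definition resolvent_op :: "(real \<Rightarrow> 'a \<Rightarrow> 'a measure) \<Rightarrow> real \<Rightarrow> ('a \<Rightarrow> real) \<Rightarrow> 'a \<Rightarrow> real" where
  "resolvent_op U \<alpha> u x = \<alpha> * (\<integral>y. u y \<partial>U \<alpha> x)"

definition mean_const :: "'a measure \<Rightarrow> ('a \<Rightarrow> real) \<Rightarrow> real" where
  "mean_const m u =
     (if emeasure m (space m) < \<infinity> then (1 / measure m (space m)) * (\<integral>x. u x \<partial>m) else 0)"

definition invariant_constant :: "'a measure \<Rightarrow> real \<Rightarrow> (real \<Rightarrow> 'a \<Rightarrow> 'a measure) \<Rightarrow> bool" where
  "invariant_constant m p U \<longleftrightarrow>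
     (\<forall>u\<in>Lp m p. (\<forall>\<alpha>>0. AE x in m. resolvent_op U \<alpha> u x = u x) \<longrightarrow>
        (\<exists>c. AE x in m. u x = c))"

definition Lp_ergodic :: "'a measure \<Rightarrow> real \<Rightarrow> (real \<Rightarrow> 'a \<Rightarrow> 'a measure) \<Rightarrow> bool" where
  "Lp_ergodic m p U \<longleftrightarrow>
     (\<forall>u\<in>Lp m p.
        ((\<lambda>\<alpha>. Lp_norm m p (\<lambda>x. resolvent_op U \<alpha> u x - mean_const m u)) \<longlongrightarrow> 0) (at_right 0))"

text \<open>
  The resolvent does not vanish \<open>m\<close>-almost everywhere (unless \<open>m = 0\<close>). This follows from, e.g.,
  strong continuity of the resolvent on \<open>L\<^sup>p(E, m)\<close>. The algebraic axioms of a resolvent alone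
  admit \<open>U\<^sub>\<alpha> = 0\<close> for all \<open>\<alpha>\<close>, which on a one-point space with \<open>m\<close> the unit mass is irreducible
  and recurrent, whereas \<open>\<alpha> U\<^sub>\<alpha> 1 = 0\<close> does not converge to \<open>1\<close>.
\<close>

definition nonvanishing :: "'a measure \<Rightarrow> (real \<Rightarrow> 'a \<Rightarrow> 'a measure) \<Rightarrow> bool" where
  "nonvanishing m U \<longleftrightarrow>
     ((AE x in m. initial_kernel U (\<lambda>_. 1) x = 0) \<longrightarrow> emeasure m (space m) = 0)"

end

(*
On bounded integrable u, the resolvent equation makes T_c u (with T_a = a U_a) a convex combination
of T_c (T_b u) and T_b u for c < b, so the L^2 norm of T_a u decreases as a tends to 0; moreover
midpoints of T_a u and T_b u have norm at least the infimum of these norms, since applying T_c to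
them gives almost T_c u for small c. By the parallelogram law T_a u is Cauchy in L^2, and its limit
is invariant. If invariant functions are constant, the limit is 0 when m is infinite, and it is the
mean of u when m is finite and T_a 1 = 1; interpolation between L^1, L^2 and L^infinity and
truncation then give convergence in L^p.

If u is invariant, then (u - c)^+ <= T_a (u - c)^+ for c >= 0, with equality by contractivity in L^p,
so {u <= c} is absorbing and irreducibility makes u constant. For finite m and w = 1 - T_a 1 the
potential U w is at most 2/a, so recurrence forces U w = 0; hence T_a 1 is invariant and independent
of a, and if it is a constant, that constant is idempotent. Conversely, for finite m, convergence of
T_a u to a positive mean gives U u = infinity a.e., whence recurrence and irreducibility.
*)
theory Submission
  imports Defs
begin

section \<open>Integral inequalities\<close>

text \<open>Norm minimisation yields a Cauchy family through the parallelogram law, so the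
  convergence proof passes through p = 2 whatever the given exponent is. It runs on bounded
  integrable functions: boundedness makes every integral against \<open>U \<alpha> x\<close> exist,
  so that linearity and the resolvent equation hold at every point and not merely almost everywhere,
  while integrability turns a pointwise error of order \<delta> into an error of order \<delta> of
  squared norms. Such functions are dense in L^p, and the approximation error is uniform in \<alpha>
  because each \<open>T \<alpha>\<close> is a contraction. The second obstacle is the value of the
  limit. Sub-invariance is only an inequality, so mass may be lost, and on a finite space the limit
  is recognised as the mean only once \<open>T \<alpha> (\<lambda>_. 1)\<close> is known to be 1
  a.e. The integral is then preserved: contractivity in L^1 is applied to u + M and to -u + M, with
  M a bound of |u|. The hypothesis \<open>nonvanishing\<close> excludes the value 0 of the
  idempotent constant.\<close>

lemma powr_tangent_le:
  fixes s t p :: real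
  assumes "1 \<le> p" "0 \<le> t" "0 < s"
  shows "s powr p + p * s powr (p - 1) * (t - s) \<le> t powr p"
proof -
  have s: "s powr (p - 1) * s = s powr p"
    using assms(3) powr_add[of s "p - 1" 1] by simp
  show ?thesis
  proof (cases "t = 0")
    case True
    have "s powr p + p * s powr (p - 1) * (t - s) = s powr p - p * (s powr (p - 1) * s)"
      using True by simp
    also have "\<dots> \<le> 0"
      unfolding s using mult_right_mono[OF assms(1), of "s powr p"] by simp
    finally show ?thesis
      by (rule order_trans) simp
  next
    case False
    \<comment> \<open>Weighted AM-GM for \<open>t powr p\<close> and \<open>s powr p\<close>,
      multiplied by p and rearranged, is the tangent inequality. It asks for positive numbers, hence
      the separate case t = 0.\<close>
    have "(t powr p) powr (1 / p) * (s powr p) powr (1 - 1 / p)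
        \<le> (1 / p) * t powr p + (1 - 1 / p) * s powr p"
      using assms False by (intro Youngs_inequality_0) auto
    moreover have "(t powr p) powr (1 / p) = t" "(s powr p) powr (1 - 1 / p) = s powr (p - 1)"
      using assms False by (simp_all add: powr_powr right_diff_distrib)
    ultimately have "t * s powr (p - 1) \<le> (1 / p) * t powr p + (1 - 1 / p) * s powr p"
      by simp
    then have "p * (t * s powr (p - 1)) \<le> p * ((1 / p) * t powr p + (1 - 1 / p) * s powr p)"
      using assms by (intro mult_left_mono) auto
    also have "\<dots> = t powr p + p * s powr p - s powr p"
      using assms by (simp add: field_simps)
    finally have 1: "p * (t * s powr (p - 1)) \<le> t powr p + p * s powr p - s powr p" .
    have 2: "s powr p + p * s powr (p - 1) * (t - s)
        = s powr p + p * (t * s powr (p - 1)) - p * (s powr (p - 1) * s)"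
      by (simp add: algebra_simps)
    show ?thesis
      using 1 unfolding 2 s by simp
  qed
qed

lemma abs_le_one_plus_powr:
  fixes t p :: real
  assumes "1 \<le> p"
  shows "\<bar>t\<bar> \<le> 1 + \<bar>t\<bar> powr p"
proof (cases "\<bar>t\<bar> \<le> 1")
  case False
  then have "\<bar>t\<bar> powr 1 \<le> \<bar>t\<bar> powr p"
    using assms by (intro powr_mono) auto
  then show ?thesis
    using False by auto
qed (simp add: add_increasing2)

lemma (in finite_measure) integrable_of_powr:
  fixes u :: "'a \<Rightarrow> real"
  assumes "1 \<le> p" "u \<in> borel_measurable M" "integrable M (\<lambda>x. \<bar>u x\<bar> powr p)"
  shows "integrable M u"
proof (rule Bochner_Integration.integrable_bound)
  show "integrable M (\<lambda>x. 1 + \<bar>u x\<bar> powr p)"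
    using assms(3) by auto
  show "AE x in M. norm (u x) \<le> norm (1 + \<bar>u x\<bar> powr p)"
    using abs_le_one_plus_powr[OF assms(1)] by (auto simp: add_nonneg_nonneg)
qed (fact assms(2))

text \<open>A crude substitute for Minkowski's inequality: errors only have to tend to 0, so the
  factor \<open>2 powr p\<close> does no harm and no roots have to be taken.\<close>

lemma abs_add_powr_le:
  fixes a b p :: real
  assumes "0 \<le> p"
  shows "\<bar>a + b\<bar> powr p \<le> 2 powr p * (\<bar>a\<bar> powr p + \<bar>b\<bar> powr p)"
proof -
  define c where "c = max \<bar>a\<bar> \<bar>b\<bar>"
  have "\<bar>a + b\<bar> powr p \<le> (2 * c) powr p"
    using assms by (intro powr_mono2) (auto simp: c_def)
  also have "\<dots> = 2 powr p * c powr p"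
    by (simp add: powr_mult c_def)
  also have "c powr p \<le> \<bar>a\<bar> powr p + \<bar>b\<bar> powr p"
    by (auto simp: c_def max_def)
  finally show ?thesis
    by simp
qed

text \<open>Fatou's lemma in the form that carries L^1 and L^2 bounds over to a.e. limits.\<close>

lemma nn_integral_le_of_AE_tendsto:
  fixes h :: "nat \<Rightarrow> 'a \<Rightarrow> ennreal"
  assumes "\<And>i. h i \<in> borel_measurable M"
    and "AE x in M. (\<lambda>i. h i x) \<longlonglongrightarrow> g x"
    and "eventually (\<lambda>i. (\<integral>\<^sup>+x. h i x \<partial>M) \<le> c) sequentially"
  shows "(\<integral>\<^sup>+x. g x \<partial>M) \<le> c"
proof -
  have "(\<integral>\<^sup>+x. g x \<partial>M) = (\<integral>\<^sup>+x. liminf (\<lambda>i. h i x) \<partial>M)"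
    using assms(2) by (intro nn_integral_cong_AE, eventually_elim) (simp add: lim_imp_Liminf)
  also have "\<dots> \<le> liminf (\<lambda>i. \<integral>\<^sup>+x. h i x \<partial>M)"
    using assms(1) by (rule nn_integral_liminf)
  also have "\<dots> \<le> liminf (\<lambda>i::nat. c)"
    using assms(3) by (rule Liminf_mono)
  finally show ?thesis
    by (simp add: Liminf_const)
qed

lemma integrable_power2_of_bounded:
  fixes u :: "'a \<Rightarrow> real"
  assumes "integrable M u" "\<And>x. x \<in> space M \<Longrightarrow> \<bar>u x\<bar> \<le> K"
  shows "integrable M (\<lambda>x. (u x)\<^sup>2)"
proof (rule Bochner_Integration.integrable_bound)
  show "integrable M (\<lambda>x. K * u x)"
    using assms(1) by simp
  show "AE x in M. norm ((u x)\<^sup>2) \<le> norm (K * u x)"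
  proof (rule AE_I2)
    fix x assume "x \<in> space M"
    then have "\<bar>u x\<bar> * \<bar>u x\<bar> \<le> \<bar>K\<bar> * \<bar>u x\<bar>"
      using assms(2)[of x] by (intro mult_right_mono) auto
    then show "norm ((u x)\<^sup>2) \<le> norm (K * u x)"
      by (simp add: power2_eq_square abs_mult)
  qed
qed (use assms(1) in measurable)

text \<open>The weight replaces the measure by a finite one with the same null sets. The cap at 1 is
  used in \<open>L2_Cauchy_AE_subseq\<close> at the points where differences are large.\<close>

lemma (in sigma_finite_measure) ex_integrable_weight:
  obtains w :: "'a \<Rightarrow> real" where "integrable M w" "\<And>x. x \<in> space M \<Longrightarrow> 0 < w x \<and> w x \<le> 1"
proof -
  obtain h where h: "h \<in> borel_measurable M" "integral\<^sup>N M h \<noteq> \<infinity>"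
    "\<And>x. x \<in> space M \<Longrightarrow> 0 < h x \<and> h x < \<infinity>"
    using Ex_finite_integrable_function by auto
  define w where "w x = min 1 (enn2real (h x))" for x
  have [measurable]: "w \<in> borel_measurable M"
    unfolding w_def using h(1) by measurable
  have w: "0 < w x \<and> w x \<le> 1" if "x \<in> space M" for x
    using h(3)[OF that] by (auto simp: w_def enn2real_positive_iff)
  have "(\<integral>\<^sup>+x. ennreal (norm (w x)) \<partial>M) \<le> integral\<^sup>N M h"
  proof (rule nn_integral_mono)
    fix x assume "x \<in> space M"
    then have "ennreal (norm (w x)) \<le> ennreal (enn2real (h x))"
      using w by (intro ennreal_leI) (auto simp: w_def)
    also have "\<dots> = h x"
      using h(3)[OF \<open>x \<in> space M\<close>] by (intro ennreal_enn2real) simp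
    finally show "ennreal (norm (w x)) \<le> h x" .
  qed
  then have "integrable M w"
    using h(2) by (intro integrableI_bounded) (auto simp: less_top top_unique intro: le_less_trans)
  then show thesis
    using w that by blast
qed

text \<open>On an infinite measure space L^2 distances do not control L^1 distances. After
  multiplication by an integrable weight they do, so that an a.e. Cauchy subsequence can be
  extracted in L^1; dividing by \<open>w x > 0\<close> returns to \<open>s\<close>.\<close>

lemma (in sigma_finite_measure) L2_Cauchy_AE_subseq:
  fixes s :: "nat \<Rightarrow> 'a \<Rightarrow> real"
  assumes "\<And>n. s n \<in> borel_measurable M" "\<And>n x. x \<in> space M \<Longrightarrow> \<bar>s n x\<bar> \<le> K"
    and int: "\<And>i j. integrable M (\<lambda>x. (s i x - s j x)\<^sup>2)"
    and Cauchy: "\<And>e. 0 < e \<Longrightarrow> \<exists>N. \<forall>i\<ge>N. \<forall>j\<ge>N. (\<integral>x. (s i x - s j x)\<^sup>2 \<partial>M) < e"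
  obtains r where "strict_mono r" "AE x in M. Cauchy (\<lambda>i. s (r i) x)"
proof -
  obtain w :: "'a \<Rightarrow> real" where w: "integrable M w" "\<And>x. x \<in> space M \<Longrightarrow> 0 < w x \<and> w x \<le> 1"
    by (rule ex_integrable_weight) blast
  have int_ws: "integrable M (\<lambda>x. w x * s n x)" for n
  proof (rule Bochner_Integration.integrable_bound)
    show "integrable M (\<lambda>x. K * w x)"
      using w(1) by simp
    show "AE x in M. norm (w x * s n x) \<le> norm (K * w x)"
    proof (rule AE_I2)
      fix x assume x: "x \<in> space M"
      have "\<bar>w x\<bar> * \<bar>s n x\<bar> \<le> \<bar>w x\<bar> * \<bar>K\<bar>"
        using assms(2)[OF x, of n] by (intro mult_left_mono) auto
      then show "norm (w x * s n x) \<le> norm (K * w x)"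
        by (simp add: abs_mult mult.commute)
    qed
  qed (use w(1) assms(1) in measurable)
  have "\<exists>N. \<forall>i\<ge>N. \<forall>j\<ge>N. (\<integral>x. norm (w x * s i x - w x * s j x) \<partial>M) < e" if e: "0 < e" for e
  proof -
    \<comment> \<open>The summand 1 keeps W positive even for the zero measure. With the next
      definition \<open>\<epsilon> * W = e / 2\<close>.\<close>
    define W where "W = (\<integral>x. w x \<partial>M) + 1"
    have "0 \<le> (\<integral>x. w x \<partial>M)"
      using w(2) by (intro integral_nonneg_AE AE_I2) (auto intro: less_imp_le)
    then have W: "0 < W"
      by (simp add: W_def)
    define \<epsilon> where "\<epsilon> = e / (2 * W)"
    have \<epsilon>: "0 < \<epsilon>"
      using e W by (simp add: \<epsilon>_def)
    obtain N where N: "\<And>i j. N \<le> i \<Longrightarrow> N \<le> j \<Longrightarrow> (\<integral>x. (s i x - s j x)\<^sup>2 \<partial>M) < \<epsilon> * (e / 2)"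
      using Cauchy[of "\<epsilon> * (e / 2)"] e \<epsilon> by auto
    have "(\<integral>x. norm (w x * s i x - w x * s j x) \<partial>M) < e" if "N \<le> i" "N \<le> j" for i j
    proof -
      have "(\<integral>x. norm (w x * s i x - w x * s j x) \<partial>M) \<le> (\<integral>x. \<epsilon> * w x + (1 / \<epsilon>) * (s i x - s j x)\<^sup>2 \<partial>M)"
      proof (rule integral_mono)
        fix x assume x: "x \<in> space M"
        define d where "d = \<bar>s i x - s j x\<bar>"
        \<comment> \<open>A difference up to \<epsilon> is paid for by the weight. A larger one
          satisfies \<open>d \<le> d\<^sup>2 / \<epsilon>\<close>, and there
          \<open>w x \<le> 1\<close> suffices.\<close>
        have "w x * d \<le> \<epsilon> * w x + (1 / \<epsilon>) * d\<^sup>2"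
        proof (cases "d \<le> \<epsilon>")
          case True
          then have "w x * d \<le> w x * \<epsilon>"
            using w(2)[OF x] by (intro mult_left_mono) auto
          then show ?thesis
            using \<epsilon> by (simp add: mult.commute add_increasing2)
        next
          case False
          then have "d * \<epsilon> \<le> d * d"
            using \<epsilon> by (intro mult_left_mono) auto
          then have "d \<le> (1 / \<epsilon>) * d\<^sup>2"
            using \<epsilon> by (simp add: field_simps power2_eq_square)
          moreover have "w x * d \<le> 1 * d"
            using w(2)[OF x] by (intro mult_right_mono) (auto simp: d_def)
          ultimately show ?thesis
            using \<epsilon> w(2)[OF x] by (simp add: add_increasing)
        qed
        moreover have "norm (w x * s i x - w x * s j x) = w x * d"
          using w(2)[OF x] by (simp add: d_def abs_mult flip: right_diff_distrib)
        ultimately show "norm (w x * s i x - w x * s j x) \<le> \<epsilon> * w x + (1 / \<epsilon>) * (s i x - s j x)\<^sup>2"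
          by (simp add: d_def)
      qed (use int_ws int w(1) in auto)
      also have "\<dots> = \<epsilon> * (\<integral>x. w x \<partial>M) + (1 / \<epsilon>) * (\<integral>x. (s i x - s j x)\<^sup>2 \<partial>M)"
        using int w(1) by simp
      also have "\<dots> < \<epsilon> * W + (1 / \<epsilon>) * (\<epsilon> * (e / 2))"
        using \<epsilon> N[OF that] by (intro add_strict_mono mult_strict_left_mono) (auto simp: W_def)
      also have "\<dots> = e"
        using W \<epsilon> by (simp add: \<epsilon>_def)
      finally show ?thesis .
    qed
    then show ?thesis
      by blast
  qed
  then obtain r where r: "strict_mono r" "AE x in M. Cauchy (\<lambda>i. w x * s (r i) x)"
    using cauchy_L1_AE_cauchy_subseq[of M "\<lambda>n x. w x * s n x"] int_ws by blast
  have "AE x in M. Cauchy (\<lambda>i. s (r i) x)"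
    using r(2) AE_space
  proof eventually_elim
    case (elim x)
    then have "convergent (\<lambda>i. w x * s (r i) x)"
      by (simp add: Cauchy_convergent_iff)
    then have "convergent (\<lambda>i. s (r i) x)"
      using w(2)[OF elim(2)] by (subst (asm) convergent_mult_const_iff) auto
    then show ?case
      by (simp add: Cauchy_convergent_iff)
  qed
  then show thesis
    using r(1) that by blast
qed

text \<open>The constant is the essential supremum of v, taken as the infimum of its a.e. upper
  bounds. A nonnegative level below it is no such bound, so the dichotomy turns that level into an
  a.e. lower bound.\<close>

lemma AE_eq_const_of_dichotomy:
  fixes v :: "'a \<Rightarrow> real"
  assumes nonneg: "AE x in M. 0 \<le> v x"
    and dich: "\<And>c. 0 \<le> c \<Longrightarrow> (AE x in M. v x \<le> c) \<or> (AE x in M. c < v x)"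
  shows "\<exists>c. AE x in M. v x = c"
proof (cases "AE x in M. False")
  \<comment> \<open>This is the zero measure, for which every real number would be an a.e. upper
    bound and the infimum below would be meaningless.\<close>
  case True
  then have "AE x in M. v x = 0"
    by eventually_elim simp
  then show ?thesis ..
next
  case nontrivial: False
  define S where "S = {c. AE x in M. v x \<le> c}"
  have "S \<noteq> {}"
  proof
    assume "S = {}"
    then have "AE x in M. real n < v x" for n
      using dich[of "real n"] by (auto simp: S_def)
    then have "AE x in M. \<forall>n. real n < v x"
      by (simp add: AE_all_countable)
    then have "AE x in M. False"
      by eventually_elim (metis less_asym reals_Archimedean2)
    then show False
      using nontrivial by simp
  qed
  moreover have S_nonneg: "0 \<le> c" if "c \<in> S" for c
  proof (rule ccontr)
    assume "\<not> 0 \<le> c"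
    have "AE x in M. v x \<le> c"
      using that by (simp add: S_def)
    then have "AE x in M. False"
      using nonneg by eventually_elim (use \<open>\<not> 0 \<le> c\<close> in auto)
    then show False
      using nontrivial by simp
  qed
  ultimately have S: "S \<noteq> {}" "bdd_below S"
    by (auto intro: bdd_belowI[of _ 0])
  define c where "c = Inf S"
  have "0 \<le> c"
    unfolding c_def using S S_nonneg by (intro cInf_greatest)
  have up: "AE x in M. v x \<le> c + 1 / real (Suc n)" for n
  proof -
    have "Inf S < c + 1 / real (Suc n)"
      by (simp add: c_def)
    then obtain d where d: "d \<in> S" "d < c + 1 / real (Suc n)"
      using S cInf_less_iff by blast
    then have "AE x in M. v x \<le> d"
      by (simp add: S_def)
    then show ?thesis
      using d(2) by (auto elim!: eventually_mono)
  qed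
  \<comment> \<open>The dichotomy is available only for levels c \<ge> 0; a negative level lies
    below v anyway.\<close>
  have low: "AE x in M. c - 1 / real (Suc n) \<le> v x" for n
  proof (cases "0 \<le> c - 1 / real (Suc n)")
    case True
    have "c - 1 / real (Suc n) \<notin> S"
    proof
      assume "c - 1 / real (Suc n) \<in> S"
      then have "c \<le> c - 1 / real (Suc n)"
        unfolding c_def using S by (intro cInf_lower)
      then show False
        by (simp add: field_simps)
    qed
    then have "AE x in M. c - 1 / real (Suc n) < v x"
      using dich[OF True] by (auto simp: S_def)
    then show ?thesis
      by eventually_elim simp
  next
    case False
    then show ?thesis
      using nonneg by (auto elim!: eventually_mono)
  qed
  have lim: "(\<lambda>n. 1 / real (Suc n)) \<longlonglongrightarrow> 0"
    by (rule LIMSEQ_Suc[OF lim_1_over_n])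
  have "AE x in M. \<forall>n. v x \<le> c + 1 / real (Suc n) \<and> c - 1 / real (Suc n) \<le> v x"
    unfolding AE_all_countable using up low by (auto intro: AE_conjI)
  then have "AE x in M. v x = c"
  proof eventually_elim
    case (elim x)
    have "v x \<le> c + 0"
      using elim by (intro LIMSEQ_le_const[OF tendsto_add[OF tendsto_const lim]]) auto
    moreover have "c - 0 \<le> v x"
      using elim by (intro LIMSEQ_le_const2[OF tendsto_diff[OF tendsto_const lim]]) auto
    ultimately show ?case
      by simp
  qed
  then show ?thesis ..
qed

lemma Lp_norm_tendsto_zero_iff:
  assumes "0 < p"
  shows "((\<lambda>i. Lp_norm M p (h i)) \<longlongrightarrow> 0) F \<longleftrightarrow> ((\<lambda>i. \<integral>x. \<bar>h i x\<bar> powr p \<partial>M) \<longlongrightarrow> 0) F"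
proof
  assume "((\<lambda>i. Lp_norm M p (h i)) \<longlongrightarrow> 0) F"
  then have "((\<lambda>i. Lp_norm M p (h i) powr p) \<longlongrightarrow> 0) F"
    using assms by (intro tendsto_zero_powrI[of _ _ _ p]) (auto simp: Lp_norm_def)
  moreover have "Lp_norm M p (h i) powr p = (\<integral>x. \<bar>h i x\<bar> powr p \<partial>M)" for i
    using assms by (simp add: Lp_norm_def powr_powr)
  ultimately show "((\<lambda>i. \<integral>x. \<bar>h i x\<bar> powr p \<partial>M) \<longlongrightarrow> 0) F"
    by simp
next
  assume "((\<lambda>i. \<integral>x. \<bar>h i x\<bar> powr p \<partial>M) \<longlongrightarrow> 0) F"
  then show "((\<lambda>i. Lp_norm M p (h i)) \<longlongrightarrow> 0) F"
    unfolding Lp_norm_def using assms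
    by (intro tendsto_zero_powrI[of _ _ _ "1 / p"]) auto
qed

text \<open>A nonzero constant is not integrable on an infinite measure space, but there
  \<open>mean_const\<close> is 0. Hence the differences in \<open>Lp_ergodic\<close> always lie in
  L^p.\<close>

lemma mean_const_integrable_powr:
  fixes p :: real
  shows "integrable M (\<lambda>x. \<bar>mean_const M u\<bar> powr p)"
proof (cases "emeasure M (space M) < \<infinity>")
  case True
  then interpret finite_measure M
    by (intro finite_measureI) auto
  show ?thesis
    by simp
qed (simp add: mean_const_def)

lemma integrable_powr_diff:
  fixes f g :: "'a \<Rightarrow> real"
  assumes "0 \<le> p" "f \<in> borel_measurable M" "g \<in> borel_measurable M"
    and "integrable M (\<lambda>x. \<bar>f x\<bar> powr p)" "integrable M (\<lambda>x. \<bar>g x\<bar> powr p)"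
  shows "integrable M (\<lambda>x. \<bar>f x - g x\<bar> powr p)"
proof (rule Bochner_Integration.integrable_bound)
  show "integrable M (\<lambda>x. 2 powr p * (\<bar>f x\<bar> powr p + \<bar>g x\<bar> powr p))"
    using assms(4,5) by simp
  show "AE x in M. norm (\<bar>f x - g x\<bar> powr p) \<le> norm (2 powr p * (\<bar>f x\<bar> powr p + \<bar>g x\<bar> powr p))"
    using abs_add_powr_le[OF assms(1), of "f _" "- g _"] by simp
qed (use assms(2,3) in measurable)

lemma mean_const_integrable: "integrable M (\<lambda>x. mean_const M u)"
proof (cases "emeasure M (space M) < \<infinity>")
  case True
  then interpret finite_measure M
    by (intro finite_measureI) auto
  show ?thesis
    by simp
qed (simp add: mean_const_def)

text \<open>Below \<epsilon> one factor \<open>\<bar>t\<bar> powr (p - 1)\<close> is small; above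
  \<epsilon> the bound \<open>K powr p\<close> may be inflated by
  \<open>t\<^sup>2 / \<epsilon>\<^sup>2 \<ge> 1\<close>. The same estimate serves p < 2 and p >
  2.\<close>

lemma powr_le_linear_plus_quadratic:
  fixes t p :: real
  assumes "1 \<le> p" "0 < \<epsilon>" "\<bar>t\<bar> \<le> K"
  shows "\<bar>t\<bar> powr p \<le> \<epsilon> powr (p - 1) * \<bar>t\<bar> + K powr p / \<epsilon>\<^sup>2 * t\<^sup>2"
proof (cases "\<bar>t\<bar> \<le> \<epsilon>")
  case True
  have "\<bar>t\<bar> powr p = \<bar>t\<bar> powr (p - 1) * \<bar>t\<bar>"
    using powr_add[of "\<bar>t\<bar>" "p - 1" 1] by simp
  also have "\<dots> \<le> \<epsilon> powr (p - 1) * \<bar>t\<bar>"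
    using True assms(1) by (intro mult_right_mono powr_mono2) auto
  finally show ?thesis
    by (simp add: add_increasing2)
next
  case False
  have "\<bar>t\<bar> powr p \<le> K powr p * 1"
    using assms by (simp add: powr_mono2)
  also have "\<dots> \<le> K powr p * (\<bar>t\<bar>\<^sup>2 / \<epsilon>\<^sup>2)"
  proof (intro mult_left_mono)
    have "\<epsilon>\<^sup>2 \<le> \<bar>t\<bar>\<^sup>2"
      using False assms(2) by (intro power_mono) auto
    then show "1 \<le> \<bar>t\<bar>\<^sup>2 / \<epsilon>\<^sup>2"
      using assms(2) by (simp add: divide_simps)
  qed simp
  also have "\<dots> = K powr p / \<epsilon>\<^sup>2 * t\<^sup>2"
    by simp
  finally show ?thesis
    by (simp add: add_increasing)
qed

text \<open>In the preceding bound the L^1 norm stays below L and gets a small coefficient; the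
  coefficient of the squared L^2 norm may be huge, since that norm tends to 0.\<close>

lemma Lp_tendsto_zero_of_L2:
  fixes h :: "'i \<Rightarrow> 'a \<Rightarrow> real"
  assumes p: "1 < p"
    and bound: "eventually (\<lambda>i. integrable M (h i) \<and> (\<forall>x\<in>space M. \<bar>h i x\<bar> \<le> K) \<and>
      (\<integral>x. \<bar>h i x\<bar> \<partial>M) \<le> L) F"
    and lim: "((\<lambda>i. \<integral>x. (h i x)\<^sup>2 \<partial>M) \<longlongrightarrow> 0) F"
  shows "((\<lambda>i. \<integral>x. \<bar>h i x\<bar> powr p \<partial>M) \<longlongrightarrow> 0) F"
proof (rule order_tendstoI)
  fix e :: real assume e: "0 < e"
  define L' where "L' = \<bar>L\<bar> + 1"
  have L': "0 < L'" "L \<le> L'"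
    by (auto simp: L'_def)
  define \<eta> where "\<eta> = e / (2 * L')"
  have \<eta>: "0 < \<eta>" "\<eta> * L \<le> e / 2"
  proof -
    show "0 < \<eta>"
      using e L' by (simp add: \<eta>_def)
    then have "\<eta> * L \<le> \<eta> * L'"
      using L' by (intro mult_left_mono) auto
    also have "\<dots> = e / 2"
      using L' by (simp add: \<eta>_def)
    finally show "\<eta> * L \<le> e / 2" .
  qed
  \<comment> \<open>The solution of \<open>\<epsilon> powr (p - 1) = \<eta>\<close>; this is where p
    > 1 enters, as for p = 1 the L^1 coefficient could not be made small.\<close>
  define \<epsilon> where "\<epsilon> = \<eta> powr (1 / (p - 1))"
  have \<epsilon>: "0 < \<epsilon>" "\<epsilon> powr (p - 1) = \<eta>"
    using \<eta>(1) p by (simp_all add: \<epsilon>_def powr_powr)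
  define C where "C = K powr p / \<epsilon>\<^sup>2"
  have "((\<lambda>i. C * (\<integral>x. (h i x)\<^sup>2 \<partial>M)) \<longlongrightarrow> 0) F"
    using lim by (rule tendsto_mult_right_zero)
  then have "eventually (\<lambda>i. C * (\<integral>x. (h i x)\<^sup>2 \<partial>M) < e / 2) F"
    using e by (intro order_tendstoD) auto
  then show "eventually (\<lambda>i. (\<integral>x. \<bar>h i x\<bar> powr p \<partial>M) < e) F"
    using bound
  proof eventually_elim
    case (elim i)
    have int: "integrable M (h i)" "integrable M (\<lambda>x. (h i x)\<^sup>2)"
      using elim by (auto intro: integrable_power2_of_bounded)
    have "(\<integral>x. \<bar>h i x\<bar> powr p \<partial>M) \<le> (\<integral>x. \<eta> * \<bar>h i x\<bar> + C * (h i x)\<^sup>2 \<partial>M)"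
    proof (rule integral_mono')
      show "integrable M (\<lambda>x. \<eta> * \<bar>h i x\<bar> + C * (h i x)\<^sup>2)"
        using int by simp
      show "\<bar>h i x\<bar> powr p \<le> \<eta> * \<bar>h i x\<bar> + C * (h i x)\<^sup>2" if "x \<in> space M" for x
        using powr_le_linear_plus_quadratic[of p \<epsilon> "h i x" K] p \<epsilon> elim that by (simp add: C_def)
    qed (use \<eta>(1) in \<open>simp add: C_def\<close>)
    also have "\<dots> = \<eta> * (\<integral>x. \<bar>h i x\<bar> \<partial>M) + C * (\<integral>x. (h i x)\<^sup>2 \<partial>M)"
      using int by simp
    also have "\<eta> * (\<integral>x. \<bar>h i x\<bar> \<partial>M) \<le> \<eta> * L"
      using elim \<eta>(1) by (intro mult_left_mono) auto
    finally show ?case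
      using elim(1) \<eta>(2) by linarith
  qed
qed (auto intro!: always_eventually intro: less_le_trans)

text \<open>Cauchy-Schwarz against the constant 1, obtained from the nonnegative variance of h.
  Scaling h by the total mass avoids division.\<close>

lemma (in finite_measure) integral_power2_le:
  fixes h :: "'a \<Rightarrow> real"
  assumes "integrable M h" "integrable M (\<lambda>x. (h x)\<^sup>2)"
  shows "(\<integral>x. h x \<partial>M)\<^sup>2 \<le> measure M (space M) * (\<integral>x. (h x)\<^sup>2 \<partial>M)"
proof (cases "measure M (space M) = 0")
  case True
  then have "AE x in M. h x = 0"
    by (intro AE_I'[of "space M"]) (auto simp: null_sets_def emeasure_eq_measure)
  then have "(\<integral>x. h x \<partial>M) = 0"
    by (rule integral_eq_zero_AE)
  then show ?thesis
    using True by simp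
next
  case False
  define \<mu> where "\<mu> = measure M (space M)"
  define A where "A = (\<integral>x. h x \<partial>M)"
  have \<mu>: "0 < \<mu>"
    using False measure_nonneg[of M "space M"] unfolding \<mu>_def by linarith
  have "0 \<le> (\<integral>x. (\<mu> * h x - A)\<^sup>2 \<partial>M)"
    by simp
  also have "\<dots> = (\<integral>x. \<mu>\<^sup>2 * (h x)\<^sup>2 - 2 * \<mu> * A * h x + A\<^sup>2 \<partial>M)"
    by (intro Bochner_Integration.integral_cong) (auto simp: power2_eq_square algebra_simps)
  also have "\<dots> = \<mu>\<^sup>2 * (\<integral>x. (h x)\<^sup>2 \<partial>M) - 2 * \<mu> * A * A + A\<^sup>2 * \<mu>"
    using assms by (simp add: \<mu>_def A_def)
  also have "\<dots> = \<mu> * (\<mu> * (\<integral>x. (h x)\<^sup>2 \<partial>M) - A\<^sup>2)"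
    by (simp add: power2_eq_square algebra_simps)
  finally have "0 \<le> \<mu> * (\<integral>x. (h x)\<^sup>2 \<partial>M) - A\<^sup>2"
    using \<mu> by (simp add: zero_le_mult_iff)
  then show ?thesis
    by (simp add: \<mu>_def A_def)
qed

section \<open>Kernels and sub-invariance\<close>

locale sub_invariant_resolvent = sigma_finite_measure m
  for m :: "'a measure" +
  fixes U :: "real \<Rightarrow> 'a \<Rightarrow> 'a measure"
  assumes resolvent: "sub_markovian_resolvent m U"
    and sub_invariant: "sub_invariant m U"
begin

abbreviation T :: "real \<Rightarrow> ('a \<Rightarrow> real) \<Rightarrow> 'a \<Rightarrow> real" where
  "T \<equiv> resolvent_op U"

lemma sets_U: "0 < \<alpha> \<Longrightarrow> x \<in> space m \<Longrightarrow> sets (U \<alpha> x) = sets m"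
  using resolvent by (auto simp: sub_markovian_resolvent_def kernel_def)

lemma space_U: "0 < \<alpha> \<Longrightarrow> x \<in> space m \<Longrightarrow> space (U \<alpha> x) = space m"
  using sets_U sets_eq_imp_space_eq by blast

lemma borel_measurable_U:
  "0 < \<alpha> \<Longrightarrow> x \<in> space m \<Longrightarrow> f \<in> borel_measurable m \<Longrightarrow> f \<in> borel_measurable (U \<alpha> x)"
  using measurable_cong_sets[OF sets_U refl] by blast

lemma emeasure_U_measurable:
  "0 < \<alpha> \<Longrightarrow> A \<in> sets m \<Longrightarrow> (\<lambda>x. emeasure (U \<alpha> x) A) \<in> borel_measurable m"
  using resolvent by (auto simp: sub_markovian_resolvent_def kernel_def)

lemma emeasure_U_space_le:
  assumes "0 < \<alpha>" "x \<in> space m"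
  shows "emeasure (U \<alpha> x) (space m) \<le> ennreal (1 / \<alpha>)"
proof -
  have le: "ennreal \<alpha> * emeasure (U \<alpha> x) (space m) \<le> 1"
    using resolvent assms by (auto simp: sub_markovian_resolvent_def)
  have "emeasure (U \<alpha> x) (space m) = ennreal (1 / \<alpha>) * (ennreal \<alpha> * emeasure (U \<alpha> x) (space m))"
    using assms by (simp add: mult.assoc[symmetric] ennreal_mult[symmetric])
  also have "\<dots> \<le> ennreal (1 / \<alpha>)"
    using mult_left_mono[OF le, of "ennreal (1 / \<alpha>)"] by simp
  finally show ?thesis .
qed

lemma finite_measure_U:
  assumes "0 < \<alpha>" "x \<in> space m"
  shows "finite_measure (U \<alpha> x)"
proof (rule finite_measureI)
  show "emeasure (U \<alpha> x) (space (U \<alpha> x)) \<noteq> \<infinity>"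
    using emeasure_U_space_le[OF assms] assms by (auto simp: space_U top_unique)
qed

lemma measure_U_space_le:
  assumes "0 < \<alpha>" "x \<in> space m"
  shows "\<alpha> * measure (U \<alpha> x) (space m) \<le> 1"
proof -
  have "measure (U \<alpha> x) (space m) \<le> 1 / \<alpha>"
    using emeasure_U_space_le[OF assms] assms(1) unfolding measure_def
    by (intro enn2real_leI) auto
  then show ?thesis
    using assms by (simp add: field_simps)
qed

section \<open>Integration against the kernels: measurability, sub-invariance and null sets\<close>

lemma nn_integral_U_measurable:
  assumes "0 < \<alpha>" "f \<in> borel_measurable m"
  shows "(\<lambda>x. \<integral>\<^sup>+y. f y \<partial>U \<alpha> x) \<in> borel_measurable m"
  using assms(2)
proof (induction rule: borel_measurable_induct)
  case (cong f g)
  have "(\<integral>\<^sup>+y. f y \<partial>U \<alpha> x) = (\<integral>\<^sup>+y. g y \<partial>U \<alpha> x)" if "x \<in> space m" for x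
    using cong(3) assms(1) that by (intro nn_integral_cong) (auto simp: space_U)
  then show ?case
    by (rule measurable_cong[THEN iffD2, OF _ cong(4)])
next
  case (set A)
  have "(\<integral>\<^sup>+y. indicator A y \<partial>U \<alpha> x) = emeasure (U \<alpha> x) A" if "x \<in> space m" for x
    using set assms(1) that by (simp add: sets_U)
  then show ?case
    by (rule measurable_cong[THEN iffD2, OF _ emeasure_U_measurable[OF assms(1) set]])
next
  case (mult u c)
  have "(\<integral>\<^sup>+y. c * u y \<partial>U \<alpha> x) = c * (\<integral>\<^sup>+y. u y \<partial>U \<alpha> x)" if "x \<in> space m" for x
    using mult(2) assms(1) that by (intro nn_integral_cmult borel_measurable_U)
  then show ?case
    by (rule measurable_cong[THEN iffD2]) (use mult(4) in measurable)
next
  case (add u v)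
  have "(\<integral>\<^sup>+y. v y + u y \<partial>U \<alpha> x) = (\<integral>\<^sup>+y. v y \<partial>U \<alpha> x) + (\<integral>\<^sup>+y. u y \<partial>U \<alpha> x)"
    if "x \<in> space m" for x
    using add(1,3) assms(1) that by (intro nn_integral_add borel_measurable_U)
  then show ?case
    by (rule measurable_cong[THEN iffD2]) (use add(6,7) in measurable)
next
  case (seq F)
  have "(\<integral>\<^sup>+y. (SUP i. F i) y \<partial>U \<alpha> x) = (SUP i. \<integral>\<^sup>+y. F i y \<partial>U \<alpha> x)"
    if "x \<in> space m" for x
    unfolding SUP_apply using seq(1,3) assms(1) that
    by (intro nn_integral_monotone_convergence_SUP borel_measurable_U)
  then show ?case
    by (rule measurable_cong[THEN iffD2]) (use seq(5) in measurable)
qed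

lemma nn_integral_sub_invariant:
  assumes "0 < \<alpha>" "f \<in> borel_measurable m"
  shows "(\<integral>\<^sup>+x. ennreal \<alpha> * (\<integral>\<^sup>+y. f y \<partial>U \<alpha> x) \<partial>m) \<le> (\<integral>\<^sup>+x. f x \<partial>m)"
  using assms(2)
proof (induction rule: borel_measurable_induct)
  case (cong f g)
  have "(\<integral>\<^sup>+y. f y \<partial>U \<alpha> x) = (\<integral>\<^sup>+y. g y \<partial>U \<alpha> x)" if "x \<in> space m" for x
    using cong(3) assms(1) that by (intro nn_integral_cong) (auto simp: space_U)
  then have "(\<integral>\<^sup>+x. ennreal \<alpha> * (\<integral>\<^sup>+y. f y \<partial>U \<alpha> x) \<partial>m)
      = (\<integral>\<^sup>+x. ennreal \<alpha> * (\<integral>\<^sup>+y. g y \<partial>U \<alpha> x) \<partial>m)"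
    by (intro nn_integral_cong) auto
  moreover have "(\<integral>\<^sup>+x. f x \<partial>m) = (\<integral>\<^sup>+x. g x \<partial>m)"
    using cong(3) by (intro nn_integral_cong)
  ultimately show ?case
    using cong(4) by simp
next
  case (set A)
  have "(\<integral>\<^sup>+x. ennreal \<alpha> * (\<integral>\<^sup>+y. indicator A y \<partial>U \<alpha> x) \<partial>m)
      = (\<integral>\<^sup>+x. ennreal \<alpha> * emeasure (U \<alpha> x) A \<partial>m)"
    using set assms(1) by (intro nn_integral_cong) (simp add: sets_U)
  then show ?case
    using sub_invariant set assms(1) by (auto simp: sub_invariant_def)
next
  case (mult u c)
  have "(\<integral>\<^sup>+x. ennreal \<alpha> * (\<integral>\<^sup>+y. c * u y \<partial>U \<alpha> x) \<partial>m)
      = (\<integral>\<^sup>+x. c * (ennreal \<alpha> * (\<integral>\<^sup>+y. u y \<partial>U \<alpha> x)) \<partial>m)"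
    using mult(2) assms(1)
    by (intro nn_integral_cong) (simp add: nn_integral_cmult borel_measurable_U mult.left_commute)
  also have "\<dots> = c * (\<integral>\<^sup>+x. ennreal \<alpha> * (\<integral>\<^sup>+y. u y \<partial>U \<alpha> x) \<partial>m)"
    using mult(2) assms(1) by (intro nn_integral_cmult) (auto intro!: borel_measurable_times_ennreal nn_integral_U_measurable)
  also have "\<dots> \<le> c * (\<integral>\<^sup>+x. u x \<partial>m)"
    using mult(4) by (rule mult_left_mono) simp
  also have "\<dots> = (\<integral>\<^sup>+x. c * u x \<partial>m)"
    using mult(2) by (simp add: nn_integral_cmult)
  finally show ?case .
next
  case (add u v)
  have "(\<integral>\<^sup>+x. ennreal \<alpha> * (\<integral>\<^sup>+y. v y + u y \<partial>U \<alpha> x) \<partial>m)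
      = (\<integral>\<^sup>+x. ennreal \<alpha> * (\<integral>\<^sup>+y. v y \<partial>U \<alpha> x) + ennreal \<alpha> * (\<integral>\<^sup>+y. u y \<partial>U \<alpha> x) \<partial>m)"
    using add(1,3) assms(1)
    by (intro nn_integral_cong) (simp add: nn_integral_add borel_measurable_U distrib_left)
  also have "\<dots> = (\<integral>\<^sup>+x. ennreal \<alpha> * (\<integral>\<^sup>+y. v y \<partial>U \<alpha> x) \<partial>m)
      + (\<integral>\<^sup>+x. ennreal \<alpha> * (\<integral>\<^sup>+y. u y \<partial>U \<alpha> x) \<partial>m)"
    using add(1,3) assms(1) by (intro nn_integral_add) (auto intro!: borel_measurable_times_ennreal nn_integral_U_measurable)
  also have "\<dots> \<le> (\<integral>\<^sup>+x. v x \<partial>m) + (\<integral>\<^sup>+x. u x \<partial>m)"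
    using add(6,7) by (rule add_mono[rotated])
  also have "\<dots> = (\<integral>\<^sup>+x. v x + u x \<partial>m)"
    using add(1,3) by (simp add: nn_integral_add)
  finally show ?case .
next
  case (seq F)
  have inc: "incseq (\<lambda>i x. ennreal \<alpha> * (\<integral>\<^sup>+y. F i y \<partial>U \<alpha> x))"
    using seq(3) by (auto simp: mono_def le_fun_def intro!: mult_left_mono nn_integral_mono)
  have "(\<integral>\<^sup>+x. ennreal \<alpha> * (\<integral>\<^sup>+y. (SUP i. F i) y \<partial>U \<alpha> x) \<partial>m)
      = (\<integral>\<^sup>+x. (SUP i. ennreal \<alpha> * (\<integral>\<^sup>+y. F i y \<partial>U \<alpha> x)) \<partial>m)"
    unfolding SUP_apply using seq(1,3) assms(1)
    by (intro nn_integral_cong)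
      (simp add: nn_integral_monotone_convergence_SUP borel_measurable_U SUP_mult_left_ennreal)
  also have "\<dots> = (SUP i. \<integral>\<^sup>+x. ennreal \<alpha> * (\<integral>\<^sup>+y. F i y \<partial>U \<alpha> x) \<partial>m)"
    using seq(1) assms(1) inc
    by (intro nn_integral_monotone_convergence_SUP) (auto intro!: borel_measurable_times_ennreal nn_integral_U_measurable)
  also have "\<dots> \<le> (SUP i. \<integral>\<^sup>+x. F i x \<partial>m)"
    using seq(5) by (intro SUP_mono) auto
  also have "\<dots> = (\<integral>\<^sup>+x. (SUP i. F i) x \<partial>m)"
    unfolding SUP_apply using seq(1,3) by (intro nn_integral_monotone_convergence_SUP[symmetric])
  finally show ?case .
qed

text \<open>Sub-invariance applied to a null set N gives \<alpha> U_\<alpha>(1_N) integral 0, so N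
  is null for \<open>U \<alpha> x\<close> at almost every x. This makes \<open>T \<alpha>\<close>
  well defined on a.e. classes.\<close>

lemma AE_AE_U:
  assumes "0 < \<alpha>" "AE x in m. P x"
  shows "AE x in m. AE y in U \<alpha> x. P y"
proof -
  obtain N where N: "{x \<in> space m. \<not> P x} \<subseteq> N" "N \<in> null_sets m"
    using assms(2) unfolding eventually_ae_filter by auto
  have meas: "(\<lambda>x. ennreal \<alpha> * (\<integral>\<^sup>+y. indicator N y \<partial>U \<alpha> x)) \<in> borel_measurable m"
    using assms(1) N(2)
    by (intro borel_measurable_times_ennreal nn_integral_U_measurable) auto
  have "(\<integral>\<^sup>+x. ennreal \<alpha> * (\<integral>\<^sup>+y. indicator N y \<partial>U \<alpha> x) \<partial>m) = 0"
    using nn_integral_sub_invariant[OF assms(1), of "indicator N"] null_setsD1[OF N(2)]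
      null_setsD2[OF N(2)] by simp
  then have "AE x in m. ennreal \<alpha> * (\<integral>\<^sup>+y. indicator N y \<partial>U \<alpha> x) = 0"
    using nn_integral_0_iff_AE[OF meas] by blast
  then show ?thesis
    using AE_space
  proof eventually_elim
    case (elim x)
    then have "emeasure (U \<alpha> x) N = 0"
      using assms(1) N(2) by (auto simp: sets_U)
    then show ?case
      using N elim(2) assms(1) by (intro AE_I[of _ _ N]) (auto simp: space_U sets_U)
  qed
qed

lemma T_measurable:
  assumes "0 < \<alpha>" "u \<in> borel_measurable m"
  shows "T \<alpha> u \<in> borel_measurable m"
proof -
  have [measurable]: "(\<lambda>x. \<integral>\<^sup>+y. ennreal \<bar>u y\<bar> \<partial>U \<alpha> x) \<in> borel_measurable m"
    "(\<lambda>x. \<integral>\<^sup>+y. ennreal (u y) \<partial>U \<alpha> x) \<in> borel_measurable m"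
    "(\<lambda>x. \<integral>\<^sup>+y. ennreal (- u y) \<partial>U \<alpha> x) \<in> borel_measurable m"
    using assms by (intro nn_integral_U_measurable; measurable)+
  \<comment> \<open>The Bochner integral has default value 0 where u is not integrable, and
    integrability at x is itself a measurable condition on x.\<close>
  have *: "(\<lambda>x. \<alpha> * (if (\<integral>\<^sup>+y. ennreal \<bar>u y\<bar> \<partial>U \<alpha> x) < \<infinity>
      then enn2real (\<integral>\<^sup>+y. u y \<partial>U \<alpha> x) - enn2real (\<integral>\<^sup>+y. - u y \<partial>U \<alpha> x) else 0))
      \<in> borel_measurable m"
    by measurable
  show ?thesis
  proof (rule measurable_cong[THEN iffD2, OF _ *])
    show "T \<alpha> u x = \<alpha> * (if (\<integral>\<^sup>+y. ennreal \<bar>u y\<bar> \<partial>U \<alpha> x) < \<infinity>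
        then enn2real (\<integral>\<^sup>+y. u y \<partial>U \<alpha> x) - enn2real (\<integral>\<^sup>+y. - u y \<partial>U \<alpha> x) else 0)"
      if "x \<in> space m" for x
    proof (cases "integrable (U \<alpha> x) u")
      case True
      then show ?thesis
        by (simp add: resolvent_op_def real_lebesgue_integral_def integrable_iff_bounded)
    next
      case False
      then show ?thesis
        using borel_measurable_U[OF assms(1) that assms(2)]
        by (simp add: resolvent_op_def not_integrable_integral_eq integrable_iff_bounded)
    qed
  qed
qed

lemma T_cong_AE:
  assumes "0 < \<alpha>" "u \<in> borel_measurable m" "v \<in> borel_measurable m" "AE x in m. u x = v x"
  shows "AE x in m. T \<alpha> u x = T \<alpha> v x"
  using AE_AE_U[OF assms(1,4)] AE_space
proof eventually_elim
  case (elim x)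
  then show ?case
    unfolding resolvent_op_def using assms(1-3)
    by (intro arg_cong[of _ _ "(*) \<alpha>"] integral_cong_AE borel_measurable_U)
qed

lemma bounded_integrable_U:
  fixes M :: real
  assumes "0 < \<alpha>" "x \<in> space m" "u \<in> borel_measurable m" "\<And>y. y \<in> space m \<Longrightarrow> \<bar>u y\<bar> \<le> M"
  shows "integrable (U \<alpha> x) u"
proof -
  interpret finite_measure "U \<alpha> x"
    using assms by (intro finite_measure_U)
  show ?thesis
    using assms by (intro integrable_const_bound[of _ M]) (auto simp: space_U intro: borel_measurable_U)
qed

section \<open>The resolvent equation for nonnegative functions\<close>

lemma resolvent_measure:
  assumes "0 < \<alpha>" "0 < \<beta>" "x \<in> space m" "A \<in> sets m"
  shows "measure (U \<alpha> x) A - measure (U \<beta> x) A = (\<beta> - \<alpha>) * (\<integral>y. measure (U \<beta> y) A \<partial>U \<alpha> x)"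
  using resolvent assms by (auto simp: sub_markovian_resolvent_def)

lemma emeasure_U_eq_measure:
  assumes "0 < \<alpha>" "x \<in> space m"
  shows "emeasure (U \<alpha> x) A = ennreal (measure (U \<alpha> x) A)"
proof -
  interpret finite_measure "U \<alpha> x"
    using assms by (intro finite_measure_U)
  show ?thesis
    by (rule emeasure_eq_measure)
qed

text \<open>The resolvent equation is given with real-valued measures. The bound
  \<open>1 / \<delta>\<close> on the inner mass makes the integrand integrable, so the iterated
  integral can be read in either number type.\<close>

lemma nn_integral_emeasure_U:
  assumes "0 < \<gamma>" "0 < \<delta>" "x \<in> space m" "A \<in> sets m"
  shows "(\<integral>\<^sup>+y. emeasure (U \<delta> y) A \<partial>U \<gamma> x) = ennreal (\<integral>y. measure (U \<delta> y) A \<partial>U \<gamma> x)"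
proof -
  have m: "(\<lambda>y. measure (U \<delta> y) A) \<in> borel_measurable m"
    unfolding measure_def using assms emeasure_U_measurable by measurable
  have "\<bar>measure (U \<delta> y) A\<bar> \<le> 1 / \<delta>" if "y \<in> space m" for y
  proof -
    interpret finite_measure "U \<delta> y"
      using assms that by (intro finite_measure_U)
    have "measure (U \<delta> y) A \<le> measure (U \<delta> y) (space m)"
      using bounded_measure[of A] assms(2) that by (simp add: space_U)
    also have "\<dots> \<le> 1 / \<delta>"
      using measure_U_space_le[OF assms(2) that] assms(2) by (simp add: field_simps)
    finally show ?thesis
      by simp
  qed
  then have i: "integrable (U \<gamma> x) (\<lambda>y. measure (U \<delta> y) A)"
    using assms m by (intro bounded_integrable_U)
  have "(\<integral>\<^sup>+y. emeasure (U \<delta> y) A \<partial>U \<gamma> x) = (\<integral>\<^sup>+y. ennreal (measure (U \<delta> y) A) \<partial>U \<gamma> x)"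
    using assms by (intro nn_integral_cong) (auto simp: space_U emeasure_U_eq_measure)
  then show ?thesis
    using nn_integral_eq_integral[OF i] by simp
qed

text \<open>Subtraction is avoided by the additive form, and \<alpha> \<le> \<beta> keeps the
  coefficient nonnegative. The parameters \<gamma>, \<delta> treat both orders of composition in a
  single induction over f.\<close>

lemma nn_resolvent:
  assumes "0 < \<alpha>" "\<alpha> \<le> \<beta>" and \<gamma>\<delta>: "\<gamma> = \<alpha> \<and> \<delta> = \<beta> \<or> \<gamma> = \<beta> \<and> \<delta> = \<alpha>"
    and "f \<in> borel_measurable m" and x: "x \<in> space m"
  shows "(\<integral>\<^sup>+y. f y \<partial>U \<alpha> x) = (\<integral>\<^sup>+y. f y \<partial>U \<beta> x)
    + ennreal (\<beta> - \<alpha>) * (\<integral>\<^sup>+y. (\<integral>\<^sup>+z. f z \<partial>U \<delta> y) \<partial>U \<gamma> x)"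
  using assms(4)
proof (induction rule: borel_measurable_induct)
  have pos: "0 < \<alpha>" "0 < \<beta>" "0 < \<gamma>" "0 < \<delta>"
    using assms by auto
  case (cong f g)
  have *: "(\<integral>\<^sup>+y. f y \<partial>U \<epsilon> x) = (\<integral>\<^sup>+y. g y \<partial>U \<epsilon> x)" if "x \<in> space m" "0 < \<epsilon>" for x \<epsilon>
    using cong(3) that by (intro nn_integral_cong) (auto simp: space_U)
  have "(\<integral>\<^sup>+y. (\<integral>\<^sup>+z. f z \<partial>U \<delta> y) \<partial>U \<gamma> x) = (\<integral>\<^sup>+y. (\<integral>\<^sup>+z. g z \<partial>U \<delta> y) \<partial>U \<gamma> x)"
    using pos x by (intro nn_integral_cong *) (auto simp: space_U)
  then show ?case
    using cong(4) * x pos by simp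
next
  have pos: "0 < \<alpha>" "0 < \<beta>" "0 < \<gamma>" "0 < \<delta>"
    using assms by auto
  case (set A)
  have eq: "(\<integral>\<^sup>+z. indicator A z \<partial>U \<epsilon> y) = emeasure (U \<epsilon> y) A" if "0 < \<epsilon>" "y \<in> space m" for \<epsilon> y
    using set that by (simp add: sets_U)
  have "(\<integral>\<^sup>+y. (\<integral>\<^sup>+z. indicator A z \<partial>U \<delta> y) \<partial>U \<gamma> x) = (\<integral>\<^sup>+y. emeasure (U \<delta> y) A \<partial>U \<gamma> x)"
    using pos x eq by (intro nn_integral_cong) (auto simp: space_U)
  also have "\<dots> = ennreal (\<integral>y. measure (U \<delta> y) A \<partial>U \<gamma> x)"
    using pos x set by (intro nn_integral_emeasure_U)
  finally have 1: "(\<integral>\<^sup>+y. (\<integral>\<^sup>+z. indicator A z \<partial>U \<delta> y) \<partial>U \<gamma> x)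
      = ennreal (\<integral>y. measure (U \<delta> y) A \<partial>U \<gamma> x)" .
  \<comment> \<open>The equation for the pair (\<alpha>, \<beta>) contains one order of composition;
    the equation for (\<beta>, \<alpha>), after a change of sign, contains the other.\<close>
  have 2: "measure (U \<alpha> x) A = measure (U \<beta> x) A + (\<beta> - \<alpha>) * (\<integral>y. measure (U \<delta> y) A \<partial>U \<gamma> x)"
    using resolvent_measure[OF pos(1,2) x set] resolvent_measure[OF pos(2,1) x set] \<gamma>\<delta>
    by (auto simp: algebra_simps)
  have nonneg: "0 \<le> (\<integral>y. measure (U \<delta> y) A \<partial>U \<gamma> x)"
    by simp
  show ?case
    using assms(2) pos x nonneg
    by (simp add: eq 1 emeasure_U_eq_measure 2 ennreal_mult[symmetric] ennreal_plus[symmetric]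
      del: ennreal_plus)
next
  have pos: "0 < \<alpha>" "0 < \<beta>" "0 < \<gamma>" "0 < \<delta>"
    using assms by auto
  case (mult u c)
  have eq: "(\<integral>\<^sup>+z. c * u z \<partial>U \<epsilon> y) = c * (\<integral>\<^sup>+z. u z \<partial>U \<epsilon> y)" if "0 < \<epsilon>" "y \<in> space m" for \<epsilon> y
    using mult(2) that by (intro nn_integral_cmult borel_measurable_U)
  have "(\<integral>\<^sup>+y. (\<integral>\<^sup>+z. c * u z \<partial>U \<delta> y) \<partial>U \<gamma> x) = (\<integral>\<^sup>+y. c * (\<integral>\<^sup>+z. u z \<partial>U \<delta> y) \<partial>U \<gamma> x)"
    using pos x eq by (intro nn_integral_cong) (auto simp: space_U)
  also have "\<dots> = c * (\<integral>\<^sup>+y. (\<integral>\<^sup>+z. u z \<partial>U \<delta> y) \<partial>U \<gamma> x)"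
    using pos x mult(2) by (intro nn_integral_cmult borel_measurable_U nn_integral_U_measurable)
  finally show ?case
    using mult(4) pos x by (simp add: eq distrib_left mult.left_commute)
next
  have pos: "0 < \<alpha>" "0 < \<beta>" "0 < \<gamma>" "0 < \<delta>"
    using assms by auto
  case (add u v)
  have eq: "(\<integral>\<^sup>+z. v z + u z \<partial>U \<epsilon> y) = (\<integral>\<^sup>+z. v z \<partial>U \<epsilon> y) + (\<integral>\<^sup>+z. u z \<partial>U \<epsilon> y)"
    if "0 < \<epsilon>" "y \<in> space m" for \<epsilon> y
    using add(1,3) that by (intro nn_integral_add borel_measurable_U)
  have "(\<integral>\<^sup>+y. (\<integral>\<^sup>+z. v z + u z \<partial>U \<delta> y) \<partial>U \<gamma> x)
      = (\<integral>\<^sup>+y. (\<integral>\<^sup>+z. v z \<partial>U \<delta> y) + (\<integral>\<^sup>+z. u z \<partial>U \<delta> y) \<partial>U \<gamma> x)"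
    using pos x eq by (intro nn_integral_cong) (auto simp: space_U)
  also have "\<dots> = (\<integral>\<^sup>+y. (\<integral>\<^sup>+z. v z \<partial>U \<delta> y) \<partial>U \<gamma> x) + (\<integral>\<^sup>+y. (\<integral>\<^sup>+z. u z \<partial>U \<delta> y) \<partial>U \<gamma> x)"
    using pos x add(1,3) by (intro nn_integral_add borel_measurable_U nn_integral_U_measurable)
  finally show ?case
    using add(6,7) pos x by (simp add: eq distrib_left)
next
  have pos: "0 < \<alpha>" "0 < \<beta>" "0 < \<gamma>" "0 < \<delta>"
    using assms by auto
  case (seq F)
  have eq: "(\<integral>\<^sup>+z. (SUP i. F i) z \<partial>U \<epsilon> y) = (SUP i. \<integral>\<^sup>+z. F i z \<partial>U \<epsilon> y)"
    if "0 < \<epsilon>" "y \<in> space m" for \<epsilon> y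
    unfolding SUP_apply using seq(1,3) that
    by (intro nn_integral_monotone_convergence_SUP borel_measurable_U)
  have "(\<integral>\<^sup>+y. (\<integral>\<^sup>+z. (SUP i. F i) z \<partial>U \<delta> y) \<partial>U \<gamma> x)
      = (\<integral>\<^sup>+y. (SUP i. \<integral>\<^sup>+z. F i z \<partial>U \<delta> y) \<partial>U \<gamma> x)"
    using pos x eq by (intro nn_integral_cong) (auto simp: space_U)
  also have "\<dots> = (SUP i. \<integral>\<^sup>+y. (\<integral>\<^sup>+z. F i z \<partial>U \<delta> y) \<partial>U \<gamma> x)"
  proof (intro nn_integral_monotone_convergence_SUP borel_measurable_U nn_integral_U_measurable)
    show "incseq (\<lambda>i y. \<integral>\<^sup>+z. F i z \<partial>U \<delta> y)"
      using seq(3) by (auto simp: mono_def le_fun_def intro!: nn_integral_mono)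
  qed (use pos x seq(1) in auto)
  finally have 1: "(\<integral>\<^sup>+y. (\<integral>\<^sup>+z. (SUP i. F i) z \<partial>U \<delta> y) \<partial>U \<gamma> x)
      = (SUP i. \<integral>\<^sup>+y. (\<integral>\<^sup>+z. F i z \<partial>U \<delta> y) \<partial>U \<gamma> x)" .
  have "(SUP i. \<integral>\<^sup>+z. F i z \<partial>U \<alpha> x) = (SUP i. (\<integral>\<^sup>+z. F i z \<partial>U \<beta> x)
      + ennreal (\<beta> - \<alpha>) * (\<integral>\<^sup>+y. (\<integral>\<^sup>+z. F i z \<partial>U \<delta> y) \<partial>U \<gamma> x))"
    using seq(5) by simp
  also have "\<dots> = (SUP i. (\<integral>\<^sup>+z. F i z \<partial>U \<beta> x))
      + (SUP i. ennreal (\<beta> - \<alpha>) * (\<integral>\<^sup>+y. (\<integral>\<^sup>+z. F i z \<partial>U \<delta> y) \<partial>U \<gamma> x))"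
    using seq(3) by (intro ennreal_SUP_add)
      (auto simp: mono_def le_fun_def intro!: nn_integral_mono mult_left_mono)
  finally show ?case
    using pos x by (simp add: eq 1 SUP_mult_left_ennreal del: SUP_apply Sup_apply)
qed

lemma nn_integral_U_antimono:
  assumes "0 < \<alpha>" "\<alpha> \<le> \<beta>" "f \<in> borel_measurable m" "x \<in> space m"
  shows "(\<integral>\<^sup>+y. f y \<partial>U \<beta> x) \<le> (\<integral>\<^sup>+y. f y \<partial>U \<alpha> x)"
  by (subst nn_resolvent[OF assms(1,2) disjI1 assms(3,4)]) (auto simp: add_increasing2)

section \<open>Contractivity in L^p\<close>

lemma T_abs_le:
  assumes "0 < \<alpha>" "x \<in> space m"
  shows "\<bar>T \<alpha> u x\<bar> \<le> T \<alpha> (\<lambda>y. \<bar>u y\<bar>) x"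
  using assms integral_abs_bound[of "U \<alpha> x" u]
  by (simp add: resolvent_op_def abs_mult)

text \<open>Jensen's inequality for the measure \<alpha> U_\<alpha>(x, .) of mass \<mu> \<le> 1: the
  tangent of the p-th power at \<open>s\<close> is integrated, where s is the value of
  \<open>T \<alpha>\<close> on |u|. Finiteness of the right-hand side is needed to make s a genuine
  integral.\<close>

lemma T_powr_le:
  assumes "1 \<le> p" "0 < \<alpha>" "x \<in> space m" "u \<in> borel_measurable m"
  shows "ennreal (\<bar>T \<alpha> u x\<bar> powr p) \<le> ennreal \<alpha> * (\<integral>\<^sup>+y. ennreal (\<bar>u y\<bar> powr p) \<partial>U \<alpha> x)"
proof (cases "(\<integral>\<^sup>+y. ennreal (\<bar>u y\<bar> powr p) \<partial>U \<alpha> x) = \<infinity>")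
  case True
  then show ?thesis
    using assms by (simp add: ennreal_mult_top)
next
  case False
  interpret finite_measure "U \<alpha> x"
    using assms by (intro finite_measure_U)
  have [measurable]: "u \<in> borel_measurable (U \<alpha> x)"
    using assms by (intro borel_measurable_U)
  have int: "integrable (U \<alpha> x) (\<lambda>y. \<bar>u y\<bar> powr p)"
    using False by (intro integrableI_bounded) (auto simp: less_top)
  have int_u: "integrable (U \<alpha> x) u"
    by (rule integrable_of_powr[OF assms(1) _ int]) simp
  define s where "s = T \<alpha> (\<lambda>y. \<bar>u y\<bar>) x"
  define \<mu> where "\<mu> = \<alpha> * measure (U \<alpha> x) (space m)"
  have Ts: "\<bar>T \<alpha> u x\<bar> \<le> s"
    using T_abs_le[OF assms(2,3)] by (simp add: s_def)
  have "s powr p \<le> \<alpha> * (\<integral>y. \<bar>u y\<bar> powr p \<partial>U \<alpha> x)"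
  proof (cases "s = 0")
    case True
    then show ?thesis
      using assms(2) by simp
  next
    case False
    then have s: "0 < s"
      using Ts by auto
    have "\<mu> \<le> 1"
      using measure_U_space_le[OF assms(2,3)] by (simp add: \<mu>_def)
    \<comment> \<open>The integrated tangent equals
      \<open>s powr p * (\<mu> + p * (1 - \<mu>))\<close>. Since p \<ge> 1 the missing mass is
      counted with a factor of at least 1, so nothing is lost.\<close>
    then have "1 \<le> \<mu> + p * (1 - \<mu>)"
      using assms(1) mult_right_mono[OF assms(1), of "1 - \<mu>"] by simp
    then have "s powr p \<le> s powr p * (\<mu> + p * (1 - \<mu>))"
      using mult_left_mono[of 1 _ "s powr p"] by simp
    also have "\<dots> = s powr p * \<mu> + p * s powr (p - 1) * (s - s * \<mu>)"
    proof -
      have "s powr p = s powr (p - 1) * s"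
        using s powr_add[of s "p - 1" 1] by simp
      then show ?thesis
        by (simp add: algebra_simps)
    qed
    also have "\<dots> = \<alpha> * (\<integral>y. s powr p + p * s powr (p - 1) * (\<bar>u y\<bar> - s) \<partial>U \<alpha> x)"
    proof -
      have "(\<integral>y. s powr p + p * s powr (p - 1) * (\<bar>u y\<bar> - s) \<partial>U \<alpha> x)
          = s powr p * measure (U \<alpha> x) (space m)
            + p * s powr (p - 1) * ((\<integral>y. \<bar>u y\<bar> \<partial>U \<alpha> x) - s * measure (U \<alpha> x) (space m))"
        using int_u assms(2,3) by (simp add: space_U)
      moreover have "P * (a * k) + c * (s - s * (a * k)) = a * (P * k + c * (I - s * k))"
        if "s = a * I" for P a k c s I :: real
        using that by (simp add: algebra_simps)
      ultimately show ?thesis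
        by (simp add: s_def \<mu>_def resolvent_op_def)
    qed
    also have "\<dots> \<le> \<alpha> * (\<integral>y. \<bar>u y\<bar> powr p \<partial>U \<alpha> x)"
      using assms(1,2) s int int_u by (intro mult_left_mono integral_mono powr_tangent_le) auto
    finally show ?thesis .
  qed
  moreover have "\<bar>T \<alpha> u x\<bar> powr p \<le> s powr p"
    using Ts assms(1) by (intro powr_mono2) auto
  ultimately have "ennreal (\<bar>T \<alpha> u x\<bar> powr p) \<le> ennreal (\<alpha> * (\<integral>y. \<bar>u y\<bar> powr p \<partial>U \<alpha> x))"
    by (intro ennreal_leI) simp
  also have "\<dots> = ennreal \<alpha> * (\<integral>\<^sup>+y. ennreal (\<bar>u y\<bar> powr p) \<partial>U \<alpha> x)"
    using assms(2) int by (simp add: ennreal_mult nn_integral_eq_integral)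
  finally show ?thesis .
qed

lemma nn_integral_T_powr_le:
  assumes "1 \<le> p" "0 < \<alpha>" "u \<in> borel_measurable m"
  shows "(\<integral>\<^sup>+x. ennreal (\<bar>T \<alpha> u x\<bar> powr p) \<partial>m) \<le> (\<integral>\<^sup>+x. ennreal (\<bar>u x\<bar> powr p) \<partial>m)"
proof -
  have "(\<integral>\<^sup>+x. ennreal (\<bar>T \<alpha> u x\<bar> powr p) \<partial>m)
      \<le> (\<integral>\<^sup>+x. ennreal \<alpha> * (\<integral>\<^sup>+y. ennreal (\<bar>u y\<bar> powr p) \<partial>U \<alpha> x) \<partial>m)"
    using assms by (intro nn_integral_mono T_powr_le)
  also have "\<dots> \<le> (\<integral>\<^sup>+x. ennreal (\<bar>u x\<bar> powr p) \<partial>m)"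
    using assms by (intro nn_integral_sub_invariant) auto
  finally show ?thesis .
qed

lemma
  assumes "1 \<le> p" "0 < \<alpha>" "u \<in> borel_measurable m" "integrable m (\<lambda>x. \<bar>u x\<bar> powr p)"
  shows integrable_T_powr: "integrable m (\<lambda>x. \<bar>T \<alpha> u x\<bar> powr p)"
    and integral_T_powr_le: "(\<integral>x. \<bar>T \<alpha> u x\<bar> powr p \<partial>m) \<le> (\<integral>x. \<bar>u x\<bar> powr p \<partial>m)"
proof -
  have [measurable]: "u \<in> borel_measurable m" "T \<alpha> u \<in> borel_measurable m"
    using assms by (auto intro: T_measurable)
  have le: "(\<integral>\<^sup>+x. ennreal (\<bar>T \<alpha> u x\<bar> powr p) \<partial>m) \<le> ennreal (\<integral>x. \<bar>u x\<bar> powr p \<partial>m)"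
    using nn_integral_T_powr_le[OF assms(1-3)] assms(4) by (simp add: nn_integral_eq_integral)
  show int: "integrable m (\<lambda>x. \<bar>T \<alpha> u x\<bar> powr p)"
    using le by (intro integrableI_bounded) (auto intro: le_less_trans)
  show "(\<integral>x. \<bar>T \<alpha> u x\<bar> powr p \<partial>m) \<le> (\<integral>x. \<bar>u x\<bar> powr p \<partial>m)"
    using le int by (simp add: nn_integral_eq_integral)
qed

lemma
  assumes "0 < \<alpha>" "integrable m u"
  shows integrable_T: "integrable m (T \<alpha> u)"
    and integral_abs_T_le: "(\<integral>x. \<bar>T \<alpha> u x\<bar> \<partial>m) \<le> (\<integral>x. \<bar>u x\<bar> \<partial>m)"
proof -
  have u: "u \<in> borel_measurable m"
    using assms by auto
  have int: "integrable m (\<lambda>x. \<bar>T \<alpha> u x\<bar>)"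
    using integrable_T_powr[OF order.refl assms(1) u] assms(2) by simp
  then show "integrable m (T \<alpha> u)"
    using T_measurable[OF assms(1) u] by (simp add: integrable_abs_iff)
  show "(\<integral>x. \<bar>T \<alpha> u x\<bar> \<partial>m) \<le> (\<integral>x. \<bar>u x\<bar> \<partial>m)"
    using integral_T_powr_le[OF order.refl assms(1) u] assms(2) by simp
qed

lemma integral_T_power2_le:
  assumes "0 < \<alpha>" "u \<in> borel_measurable m" "integrable m (\<lambda>x. (u x)\<^sup>2)"
  shows "(\<integral>x. (T \<alpha> u x)\<^sup>2 \<partial>m) \<le> (\<integral>x. (u x)\<^sup>2 \<partial>m)"
proof -
  have *: "\<bar>t\<bar> powr 2 = t\<^sup>2" for t :: real
    by (cases "t = 0") auto
  show ?thesis
    using integral_T_powr_le[of 2 \<alpha> u] assms by (simp add: *)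
qed

section \<open>Pointwise calculus on bounded functions\<close>

definition bdd :: "('a \<Rightarrow> real) \<Rightarrow> bool" where
  "bdd u \<longleftrightarrow> u \<in> borel_measurable m \<and> (\<exists>M. \<forall>x\<in>space m. \<bar>u x\<bar> \<le> M)"

lemma bddI: "u \<in> borel_measurable m \<Longrightarrow> (\<And>x. x \<in> space m \<Longrightarrow> \<bar>u x\<bar> \<le> M) \<Longrightarrow> bdd u"
  by (auto simp: bdd_def)

lemma bdd_measurable: "bdd u \<Longrightarrow> u \<in> borel_measurable m"
  by (simp add: bdd_def)

lemma bdd_const: "bdd (\<lambda>_. c)"
  by (rule bddI[of _ "\<bar>c\<bar>"]) auto

lemma bdd_add:
  assumes "bdd u" "bdd v"
  shows "bdd (\<lambda>x. u x + v x)"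
proof -
  obtain M N where "\<And>x. x \<in> space m \<Longrightarrow> \<bar>u x\<bar> \<le> M" "\<And>x. x \<in> space m \<Longrightarrow> \<bar>v x\<bar> \<le> N"
    using assms by (auto simp: bdd_def)
  then show ?thesis
    using assms
    by (intro bddI[of _ "M + N"]) (auto simp: bdd_def intro: order_trans[OF abs_triangle_ineq] add_mono)
qed

lemma bdd_cmult:
  assumes "bdd u"
  shows "bdd (\<lambda>x. c * u x)"
proof -
  obtain M where "\<And>x. x \<in> space m \<Longrightarrow> \<bar>u x\<bar> \<le> M"
    using assms by (auto simp: bdd_def)
  then show ?thesis
    using assms by (intro bddI[of _ "\<bar>c\<bar> * M"]) (auto simp: bdd_def abs_mult intro: mult_left_mono)
qed

lemma bdd_diff: "bdd u \<Longrightarrow> bdd v \<Longrightarrow> bdd (\<lambda>x. u x - v x)"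
  using bdd_add[of u "\<lambda>x. (-1) * v x"] bdd_cmult[of v "-1"] by simp

lemma integrable_U: "0 < \<alpha> \<Longrightarrow> x \<in> space m \<Longrightarrow> bdd u \<Longrightarrow> integrable (U \<alpha> x) u"
  by (auto simp: bdd_def intro: bounded_integrable_U)

lemma T_add: "0 < \<alpha> \<Longrightarrow> x \<in> space m \<Longrightarrow> bdd u \<Longrightarrow> bdd v \<Longrightarrow>
    T \<alpha> (\<lambda>y. u y + v y) x = T \<alpha> u x + T \<alpha> v x"
  by (simp add: resolvent_op_def integrable_U distrib_left)

lemma T_diff: "0 < \<alpha> \<Longrightarrow> x \<in> space m \<Longrightarrow> bdd u \<Longrightarrow> bdd v \<Longrightarrow>
    T \<alpha> (\<lambda>y. u y - v y) x = T \<alpha> u x - T \<alpha> v x"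
  by (simp add: resolvent_op_def integrable_U right_diff_distrib)

lemma T_cmult: "T \<alpha> (\<lambda>y. c * u y) x = c * T \<alpha> u x"
  by (simp add: resolvent_op_def)

lemma T_cong: "0 < \<alpha> \<Longrightarrow> x \<in> space m \<Longrightarrow> (\<And>y. y \<in> space m \<Longrightarrow> u y = v y) \<Longrightarrow> T \<alpha> u x = T \<alpha> v x"
  unfolding resolvent_op_def
  by (intro arg_cong[of _ _ "(*) \<alpha>"] Bochner_Integration.integral_cong) (auto simp: space_U)

lemma T_mono:
  assumes "0 < \<alpha>" "x \<in> space m" "bdd u" "bdd v" "\<And>y. y \<in> space m \<Longrightarrow> u y \<le> v y"
  shows "T \<alpha> u x \<le> T \<alpha> v x"
  unfolding resolvent_op_def using assms
  by (intro mult_left_mono integral_mono integrable_U) (auto simp: space_U)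

lemma T_const_le:
  assumes "0 < \<alpha>" "x \<in> space m" "0 \<le> c"
  shows "0 \<le> T \<alpha> (\<lambda>_. c) x" "T \<alpha> (\<lambda>_. c) x \<le> c"
proof -
  show "0 \<le> T \<alpha> (\<lambda>_. c) x"
    using assms by (simp add: resolvent_op_def)
  have "c * (\<alpha> * measure (U \<alpha> x) (space m)) \<le> c * 1"
    using measure_U_space_le[OF assms(1,2)] assms(3) by (intro mult_left_mono)
  then show "T \<alpha> (\<lambda>_. c) x \<le> c"
    using assms by (simp add: resolvent_op_def space_U mult_ac)
qed

lemma T_bound:
  assumes "0 < \<alpha>" "x \<in> space m" "u \<in> borel_measurable m" "\<And>y. y \<in> space m \<Longrightarrow> \<bar>u y\<bar> \<le> M"
  shows "\<bar>T \<alpha> u x\<bar> \<le> M"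
proof -
  have "bdd (\<lambda>y. \<bar>u y\<bar>)"
    using assms by (intro bddI[of _ M]) auto
  then have "\<bar>T \<alpha> u x\<bar> \<le> T \<alpha> (\<lambda>_. M) x"
    using assms by (intro order_trans[OF T_abs_le] T_mono bdd_const)
  also have "\<dots> \<le> M"
    using assms order_trans[OF abs_ge_zero assms(4)[OF assms(2)]] by (intro T_const_le)
  finally show ?thesis .
qed

lemma bdd_T:
  assumes "0 < \<alpha>" "bdd u"
  shows "bdd (T \<alpha> u)"
proof -
  obtain M where "\<And>x. x \<in> space m \<Longrightarrow> \<bar>u x\<bar> \<le> M"
    using assms by (auto simp: bdd_def)
  then show ?thesis
    using assms by (intro bddI[of _ M] T_bound T_measurable) (auto simp: bdd_def)
qed

lemma nn_integral_U_eq_T: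
  assumes "0 < \<alpha>" "x \<in> space m" "bdd u" "\<And>y. y \<in> space m \<Longrightarrow> 0 \<le> u y"
  shows "(\<integral>\<^sup>+y. ennreal (u y) \<partial>U \<alpha> x) = ennreal (T \<alpha> u x / \<alpha>)"
  using assms by (subst nn_integral_eq_integral)
    (auto simp: resolvent_op_def space_U intro!: integrable_U AE_I2)

lemma T_nonneg:
  assumes "0 < \<alpha>" "x \<in> space m" "\<And>y. y \<in> space m \<Longrightarrow> 0 \<le> u y"
  shows "0 \<le> T \<alpha> u x"
  unfolding resolvent_op_def using assms
  by (intro mult_nonneg_nonneg integral_nonneg_AE AE_I2) (auto simp: space_U)

text \<open>The kernel equation rewritten with U_\<alpha> = T_\<alpha> / \<alpha> and multiplied by
  \<alpha> \<beta>, which equals \<gamma> \<delta> in both orders of composition. Nonnegativity of u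
  permits the passage from extended to real integrals.\<close>

lemma resolvent_identity_nonneg:
  assumes "0 < \<alpha>" "\<alpha> \<le> \<beta>" and \<gamma>\<delta>: "\<gamma> = \<alpha> \<and> \<delta> = \<beta> \<or> \<gamma> = \<beta> \<and> \<delta> = \<alpha>"
    and x: "x \<in> space m" and u: "bdd u" "\<And>y. y \<in> space m \<Longrightarrow> 0 \<le> u y"
  shows "(\<beta> - \<alpha>) * T \<gamma> (T \<delta> u) x = \<beta> * T \<alpha> u x - \<alpha> * T \<beta> u x"
proof -
  have pos: "0 < \<alpha>" "0 < \<beta>" "0 < \<gamma>" "0 < \<delta>"
    using assms by auto
  have nn: "0 \<le> T \<delta> u y" if "y \<in> space m" for y
    using T_nonneg[OF pos(4) that u(2)] .
  have "(\<integral>\<^sup>+y. (\<integral>\<^sup>+z. ennreal (u z) \<partial>U \<delta> y) \<partial>U \<gamma> x)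
      = (\<integral>\<^sup>+y. ennreal (1 / \<delta> * T \<delta> u y) \<partial>U \<gamma> x)"
    using pos x u by (intro nn_integral_cong) (simp add: nn_integral_U_eq_T space_U)
  also have "\<dots> = ennreal (T \<gamma> (\<lambda>y. 1 / \<delta> * T \<delta> u y) x / \<gamma>)"
    using pos x u nn by (intro nn_integral_U_eq_T bdd_cmult bdd_T) auto
  also have "\<dots> = ennreal (T \<gamma> (T \<delta> u) x / (\<gamma> * \<delta>))"
    unfolding T_cmult by (simp add: mult.commute)
  finally have "ennreal (T \<alpha> u x / \<alpha>)
      = ennreal (T \<beta> u x / \<beta>) + ennreal (\<beta> - \<alpha>) * ennreal (T \<gamma> (T \<delta> u) x / (\<gamma> * \<delta>))"
    using nn_resolvent[OF assms(1,2) \<gamma>\<delta> _ x, of "\<lambda>y. ennreal (u y)"] pos x u bdd_measurable[OF u(1)]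
    by (simp add: nn_integral_U_eq_T)
  also have "\<dots> = ennreal (T \<beta> u x / \<beta> + (\<beta> - \<alpha>) * (T \<gamma> (T \<delta> u) x / (\<gamma> * \<delta>)))"
    using assms(2) pos T_nonneg[OF pos(2) x u(2)] T_nonneg[OF pos(3) x nn]
    by (simp add: ennreal_mult[symmetric] ennreal_plus[symmetric] del: ennreal_plus)
  finally have eq: "T \<alpha> u x / \<alpha> = T \<beta> u x / \<beta> + (\<beta> - \<alpha>) * (T \<gamma> (T \<delta> u) x / (\<gamma> * \<delta>))"
    using assms(2) pos T_nonneg[OF pos(1) x u(2)] T_nonneg[OF pos(2) x u(2)] T_nonneg[OF pos(3) x nn]
    by (subst (asm) ennreal_inj) auto
  have "(\<beta> - \<alpha>) * T \<gamma> (T \<delta> u) x = (\<gamma> * \<delta>) * ((\<beta> - \<alpha>) * (T \<gamma> (T \<delta> u) x / (\<gamma> * \<delta>)))"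
    using pos by simp
  also have "\<dots> = (\<alpha> * \<beta>) * (T \<alpha> u x / \<alpha> - T \<beta> u x / \<beta>)"
    using eq \<gamma>\<delta> by auto
  also have "\<dots> = \<beta> * T \<alpha> u x - \<alpha> * T \<beta> u x"
    using pos by (simp add: right_diff_distrib)
  finally show ?thesis .
qed

text \<open>Both u + M and the constant M are nonnegative when M bounds |u|, and their difference is
  u. The case \<alpha> > \<beta> is the other order of composition with the sign reversed.\<close>

lemma resolvent_identity:
  assumes "0 < \<alpha>" "0 < \<beta>" and x: "x \<in> space m" and u: "bdd u"
  shows "(\<beta> - \<alpha>) * T \<alpha> (T \<beta> u) x = \<beta> * T \<alpha> u x - \<alpha> * T \<beta> u x"
proof -
  have nonneg: "(\<beta> - \<alpha>) * T \<alpha> (T \<beta> v) x = \<beta> * T \<alpha> v x - \<alpha> * T \<beta> v x"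
    if v: "bdd v" "\<And>y. y \<in> space m \<Longrightarrow> 0 \<le> v y" for v
  proof (cases "\<alpha> \<le> \<beta>")
    case True
    then show ?thesis
      using resolvent_identity_nonneg[of \<alpha> \<beta> \<alpha> \<beta>] assms v by auto
  next
    case False
    then have "(\<alpha> - \<beta>) * T \<alpha> (T \<beta> v) x = \<alpha> * T \<beta> v x - \<beta> * T \<alpha> v x"
      using resolvent_identity_nonneg[of \<beta> \<alpha> \<alpha> \<beta>] assms v by auto
    then show ?thesis
      by (simp add: algebra_simps)
  qed
  obtain M where M: "\<And>y. y \<in> space m \<Longrightarrow> \<bar>u y\<bar> \<le> M"
    using u by (auto simp: bdd_def)
  have M0: "0 \<le> M"
    using M[OF x] by (auto intro: order_trans)
  define v where "v = (\<lambda>y. u y + M)"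
  have v: "bdd v" "\<And>y. y \<in> space m \<Longrightarrow> 0 \<le> v y"
    using u M by (auto simp: v_def intro!: bdd_add bdd_const) (smt (verit))
  have uv: "T \<epsilon> u y = T \<epsilon> v y - T \<epsilon> (\<lambda>_. M) y" if "0 < \<epsilon>" "y \<in> space m" for \<epsilon> y
    using that u by (simp add: v_def T_add bdd_const)
  have "T \<alpha> (T \<beta> u) x = T \<alpha> (\<lambda>y. T \<beta> v y - T \<beta> (\<lambda>_. M) y) x"
    using assms uv by (intro T_cong) auto
  also have "\<dots> = T \<alpha> (T \<beta> v) x - T \<alpha> (T \<beta> (\<lambda>_. M)) x"
    using assms v by (intro T_diff bdd_T bdd_const) auto
  finally have "(\<beta> - \<alpha>) * T \<alpha> (T \<beta> u) x
      = (\<beta> - \<alpha>) * T \<alpha> (T \<beta> v) x - (\<beta> - \<alpha>) * T \<alpha> (T \<beta> (\<lambda>_. M)) x"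
    by (simp add: right_diff_distrib)
  also have "\<dots> = (\<beta> * T \<alpha> v x - \<alpha> * T \<beta> v x)
      - (\<beta> * T \<alpha> (\<lambda>_. M) x - \<alpha> * T \<beta> (\<lambda>_. M) x)"
    using nonneg[OF v] nonneg[OF bdd_const, of M] M0 by simp
  finally show ?thesis
    using assms by (simp add: uv right_diff_distrib)
qed

section \<open>The mean ergodic theorem\<close>

lemma bdd_bound:
  assumes "bdd u"
  obtains M where "0 \<le> M" "\<And>x. x \<in> space m \<Longrightarrow> \<bar>u x\<bar> \<le> M"
proof -
  obtain M where "\<And>x. x \<in> space m \<Longrightarrow> \<bar>u x\<bar> \<le> M"
    using assms by (auto simp: bdd_def)
  then show thesis
    using that[of "max 0 M"] by (auto simp: le_max_iff_disj)
qed

text \<open>A space that is stable under every \<open>T \<alpha>\<close>, contained in every L^p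
  with p \<ge> 1 by \<open>bdd_int_Lp\<close>, and dense there by
  \<open>bdd_int_approximation\<close>.\<close>

definition bdd_int :: "('a \<Rightarrow> real) \<Rightarrow> bool" where
  "bdd_int u \<longleftrightarrow> bdd u \<and> integrable m u"

lemma bdd_int_add: "bdd_int u \<Longrightarrow> bdd_int v \<Longrightarrow> bdd_int (\<lambda>x. u x + v x)"
  and bdd_int_diff: "bdd_int u \<Longrightarrow> bdd_int v \<Longrightarrow> bdd_int (\<lambda>x. u x - v x)"
  and bdd_int_cmult: "bdd_int u \<Longrightarrow> bdd_int (\<lambda>x. c * u x)"
  and bdd_int_T: "0 < \<alpha> \<Longrightarrow> bdd_int u \<Longrightarrow> bdd_int (T \<alpha> u)"
  by (auto simp: bdd_int_def bdd_add bdd_diff bdd_cmult bdd_T integrable_T)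

section \<open>Squared L^2 norms and the minimising argument\<close>

definition sqnorm :: "('a \<Rightarrow> real) \<Rightarrow> real" where
  "sqnorm u = (\<integral>x. (u x)\<^sup>2 \<partial>m)"

lemma integrable_power2: "bdd_int u \<Longrightarrow> integrable m (\<lambda>x. (u x)\<^sup>2)"
  by (auto simp: bdd_int_def bdd_def intro: integrable_power2_of_bounded)

lemma sqnorm_nonneg: "0 \<le> sqnorm u"
  by (simp add: sqnorm_def)

lemma sqnorm_T_le: "0 < \<alpha> \<Longrightarrow> bdd_int u \<Longrightarrow> sqnorm (T \<alpha> u) \<le> sqnorm u"
  unfolding sqnorm_def
  by (rule integral_T_power2_le) (auto simp: integrable_power2, simp add: bdd_int_def bdd_def)

lemma sqnorm_cmult: "sqnorm (\<lambda>x. c * u x) = c\<^sup>2 * sqnorm u"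
  by (simp add: sqnorm_def power_mult_distrib)

lemma sqnorm_minus_commute: "sqnorm (\<lambda>x. u x - v x) = sqnorm (\<lambda>x. v x - u x)"
  by (simp add: sqnorm_def power2_commute)

lemma sqnorm_cong: "(\<And>x. x \<in> space m \<Longrightarrow> u x = v x) \<Longrightarrow> sqnorm u = sqnorm v"
  unfolding sqnorm_def by (intro Bochner_Integration.integral_cong) auto

text \<open>Written with the midpoint, because it is the midpoint whose norm is bounded from below
  in \<open>sqnorm_midpoint_ge\<close>.\<close>

lemma sqnorm_parallelogram:
  assumes "bdd_int u" "bdd_int v"
  shows "sqnorm (\<lambda>x. u x - v x) + 4 * sqnorm (\<lambda>x. 1 / 2 * (u x + v x)) = 2 * sqnorm u + 2 * sqnorm v"
proof -
  have "sqnorm (\<lambda>x. u x - v x) + sqnorm (\<lambda>x. u x + v x)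
      = (\<integral>x. (u x - v x)\<^sup>2 + (u x + v x)\<^sup>2 \<partial>m)"
    unfolding sqnorm_def using assms
    by (intro Bochner_Integration.integral_add[symmetric] integrable_power2 bdd_int_diff bdd_int_add)
  also have "\<dots> = (\<integral>x. 2 * (u x)\<^sup>2 + 2 * (v x)\<^sup>2 \<partial>m)"
    by (intro Bochner_Integration.integral_cong) (auto simp: power2_eq_square algebra_simps)
  also have "\<dots> = 2 * sqnorm u + 2 * sqnorm v"
    using integrable_power2[OF assms(1)] integrable_power2[OF assms(2)] by (simp add: sqnorm_def)
  finally show ?thesis
    by (simp only: sqnorm_cmult) (simp add: power2_eq_square)
qed

lemma sqnorm_add_le:
  assumes "bdd_int u" "bdd_int v"
  shows "sqnorm (\<lambda>x. u x + v x) \<le> 2 * sqnorm u + 2 * sqnorm v"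
  using sqnorm_parallelogram[OF assms] sqnorm_nonneg[of "\<lambda>x. u x - v x"]
  by (simp only: sqnorm_cmult) (simp add: power2_eq_square)

lemma sqnorm_convex:
  assumes "bdd_int u" "bdd_int v" "0 \<le> t" "t \<le> 1"
  shows "sqnorm (\<lambda>x. (1 - t) * u x + t * v x) \<le> (1 - t) * sqnorm u + t * sqnorm v"
proof -
  have "sqnorm (\<lambda>x. (1 - t) * u x + t * v x) \<le> (\<integral>x. (1 - t) * (u x)\<^sup>2 + t * (v x)\<^sup>2 \<partial>m)"
    unfolding sqnorm_def
  proof (rule integral_mono)
    show "integrable m (\<lambda>x. ((1 - t) * u x + t * v x)\<^sup>2)"
      using assms by (intro integrable_power2 bdd_int_add bdd_int_cmult)
    show "integrable m (\<lambda>x. (1 - t) * (u x)\<^sup>2 + t * (v x)\<^sup>2)"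
      using assms integrable_power2 by auto
    show "((1 - t) * u x + t * v x)\<^sup>2 \<le> (1 - t) * (u x)\<^sup>2 + t * (v x)\<^sup>2" for x
    proof -
      have "(1 - t) * (u x)\<^sup>2 + t * (v x)\<^sup>2 - ((1 - t) * u x + t * v x)\<^sup>2 = t * (1 - t) * (u x - v x)\<^sup>2"
        by (simp add: power2_eq_square algebra_simps)
      moreover have "0 \<le> t * (1 - t) * (u x - v x)\<^sup>2"
        using assms by simp
      ultimately show ?thesis
        by linarith
    qed
  qed
  also have "\<dots> = (1 - t) * sqnorm u + t * sqnorm v"
    using integrable_power2[OF assms(1)] integrable_power2[OF assms(2)] by (simp add: sqnorm_def)
  finally show ?thesis .
qed

lemma sqnorm_T_antimono:
  assumes u: "bdd_int u" and "0 < \<gamma>" "\<gamma> \<le> \<beta>"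
  shows "sqnorm (T \<gamma> u) \<le> sqnorm (T \<beta> u)"
proof -
  define t where "t = \<gamma> / \<beta>"
  have t: "0 \<le> t" "t \<le> 1" and \<beta>: "0 < \<beta>"
    using assms by (auto simp: t_def)
  \<comment> \<open>By the resolvent equation \<open>T\<^sub>\<gamma> u\<close> is a convex combination of \<open>T\<^sub>\<gamma> T\<^sub>\<beta> u\<close> and \<open>T\<^sub>\<beta> u\<close>.\<close>
  have "T \<gamma> u x = (1 - t) * T \<gamma> (T \<beta> u) x + t * T \<beta> u x" if "x \<in> space m" for x
  proof -
    have "\<beta> * T \<gamma> u x = (\<beta> - \<gamma>) * T \<gamma> (T \<beta> u) x + \<gamma> * T \<beta> u x"
      using resolvent_identity[OF assms(2) \<beta> that, of u] u by (simp add: bdd_int_def)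
    then show ?thesis
      using \<beta> by (simp add: t_def field_simps)
  qed
  then have "sqnorm (T \<gamma> u) = sqnorm (\<lambda>x. (1 - t) * T \<gamma> (T \<beta> u) x + t * T \<beta> u x)"
    by (rule sqnorm_cong)
  also have "\<dots> \<le> (1 - t) * sqnorm (T \<gamma> (T \<beta> u)) + t * sqnorm (T \<beta> u)"
    using t u assms(2) \<beta> by (intro sqnorm_convex bdd_int_T)
  also have "\<dots> \<le> (1 - t) * sqnorm (T \<beta> u) + t * sqnorm (T \<beta> u)"
    using t u assms(2) \<beta> by (intro add_right_mono mult_left_mono sqnorm_T_le bdd_int_T) auto
  finally show ?thesis
    by (simp add: algebra_simps)
qed

text \<open>By the resolvent equation the difference times \<alpha> - \<delta> is \<delta> times a
  function bounded by 2 M, and 2 \<delta> \<le> \<alpha> gives \<alpha> - \<delta> \<ge> \<alpha> /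
  2. For fixed \<alpha> the error is therefore uniformly of order \<delta>.\<close>

lemma T_T_diff_le:
  assumes "bdd u" "\<And>y. y \<in> space m \<Longrightarrow> \<bar>u y\<bar> \<le> M" "0 < \<delta>" "2 * \<delta> \<le> \<alpha>" "x \<in> space m"
  shows "\<bar>T \<delta> u x - T \<delta> (T \<alpha> u) x\<bar> \<le> \<delta> * (4 * M / \<alpha>)"
proof -
  have \<alpha>: "0 < \<alpha>" "\<delta> < \<alpha>"
    using assms by auto
  have "(\<alpha> - \<delta>) * (T \<delta> u x - T \<delta> (T \<alpha> u) x) = \<delta> * (T \<alpha> u x - T \<delta> u x)"
    using resolvent_identity[OF assms(3) \<alpha>(1) assms(5,1)] by (simp add: algebra_simps)
  then have eq: "(\<alpha> - \<delta>) * \<bar>T \<delta> u x - T \<delta> (T \<alpha> u) x\<bar> = \<delta> * \<bar>T \<alpha> u x - T \<delta> u x\<bar>"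
    using \<alpha> assms(3) by (metis abs_mult abs_of_pos diff_gt_0_iff_gt)
  have "\<bar>T \<alpha> u x\<bar> \<le> M" "\<bar>T \<delta> u x\<bar> \<le> M"
    using assms \<alpha> by (auto intro!: T_bound bdd_measurable)
  then have "\<delta> * \<bar>T \<alpha> u x - T \<delta> u x\<bar> \<le> \<delta> * (2 * M)"
    using assms(3) by (intro mult_left_mono) auto
  moreover have "(\<alpha> / 2) * \<bar>T \<delta> u x - T \<delta> (T \<alpha> u) x\<bar> \<le> (\<alpha> - \<delta>) * \<bar>T \<delta> u x - T \<delta> (T \<alpha> u) x\<bar>"
    using assms(4) by (intro mult_right_mono) auto
  ultimately have "(\<alpha> / 2) * \<bar>T \<delta> u x - T \<delta> (T \<alpha> u) x\<bar> \<le> \<delta> * (2 * M)"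
    using eq by linarith
  then show ?thesis
    using \<alpha> by (simp add: field_simps)
qed

text \<open>For the midpoint v the functions \<open>T \<delta> u\<close> and
  \<open>T \<delta> v\<close> differ pointwise by at most \<delta> K. Factoring a difference of
  squares and using contractivity in L^1 bounds the difference of the squared norms by \<delta> L,
  and then \<delta> tends to 0.\<close>

lemma sqnorm_midpoint_ge:
  assumes u: "bdd_int u" and "0 < \<alpha>" "0 < \<beta>" and d: "\<And>\<delta>. 0 < \<delta> \<Longrightarrow> d \<le> sqnorm (T \<delta> u)"
  shows "d \<le> sqnorm (\<lambda>x. 1 / 2 * (T \<alpha> u x + T \<beta> u x))"
proof -
  define v where "v = (\<lambda>x. 1 / 2 * (T \<alpha> u x + T \<beta> u x))"
  have v: "bdd_int v"
    unfolding v_def using u assms(2,3) by (intro bdd_int_cmult bdd_int_add bdd_int_T)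
  obtain M where M: "0 \<le> M" "\<And>x. x \<in> space m \<Longrightarrow> \<bar>u x\<bar> \<le> M"
    using u bdd_bound[of u] by (auto simp: bdd_int_def)
  have bu: "bdd u" and iu: "integrable m u" and iv: "integrable m v"
    using u v by (auto simp: bdd_int_def)
  \<comment> \<open>The average of the two constants that \<open>T_T_diff_le\<close> gives for
    \<alpha> and for \<beta>; the later condition on \<delta> is what that lemma asks for with both
    parameters.\<close>
  define K where "K = 1 / 2 * (4 * M / \<alpha> + 4 * M / \<beta>)"
  have K: "0 \<le> K"
    using M(1) assms(2,3) by (simp add: K_def)
  define L where "L = K * ((\<integral>x. \<bar>u x\<bar> \<partial>m) + (\<integral>x. \<bar>v x\<bar> \<partial>m))"
  have "d \<le> sqnorm v + \<delta> * L" if \<delta>: "0 < \<delta>" "\<delta> < min \<alpha> \<beta> / 2" for \<delta>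
  proof -
    have [simp]: "integrable m (T \<delta> u)" "integrable m (T \<delta> v)"
      using \<delta>(1) iu iv by (auto intro: integrable_T)
    have Tv: "T \<delta> v x = 1 / 2 * (T \<delta> (T \<alpha> u) x + T \<delta> (T \<beta> u) x)" if "x \<in> space m" for x
      unfolding v_def using \<delta>(1) assms(2,3) that bu by (simp only: T_cmult) (simp add: T_add bdd_T)
    have diff: "\<bar>T \<delta> u x - T \<delta> v x\<bar> \<le> \<delta> * K" if x: "x \<in> space m" for x
    proof -
      have "\<bar>T \<delta> u x - T \<delta> (T \<alpha> u) x\<bar> \<le> \<delta> * (4 * M / \<alpha>)" "\<bar>T \<delta> u x - T \<delta> (T \<beta> u) x\<bar> \<le> \<delta> * (4 * M / \<beta>)"
        using T_T_diff_le[OF bu M(2) \<delta>(1) _ x, of \<alpha>] T_T_diff_le[OF bu M(2) \<delta>(1) _ x, of \<beta>] \<delta>(2)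
        by simp_all
      moreover have "\<delta> * K = 1 / 2 * (\<delta> * (4 * M / \<alpha>) + \<delta> * (4 * M / \<beta>))"
        by (simp only: K_def distrib_left mult.left_commute)
      moreover have "\<bar>a - 1 / 2 * (b + c)\<bar> \<le> 1 / 2 * (k + l)"
        if "\<bar>a - b\<bar> \<le> k" "\<bar>a - c\<bar> \<le> l" for a b c k l :: real
        using that by (simp add: add_divide_distrib)
      ultimately show ?thesis
        unfolding Tv[OF x] by metis
    qed
    have int2: "integrable m (\<lambda>x. (T \<delta> u x)\<^sup>2)" "integrable m (\<lambda>x. (T \<delta> v x)\<^sup>2)"
      using \<delta>(1) u v by (auto intro!: integrable_power2 bdd_int_T)
    have "d \<le> sqnorm (T \<delta> u)"
      using d \<delta>(1) by blast
    also have "\<dots> = sqnorm (T \<delta> v) + (\<integral>x. (T \<delta> u x)\<^sup>2 - (T \<delta> v x)\<^sup>2 \<partial>m)"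
      using int2 by (simp add: sqnorm_def)
    also have "(\<integral>x. (T \<delta> u x)\<^sup>2 - (T \<delta> v x)\<^sup>2 \<partial>m) \<le> (\<integral>x. \<delta> * K * (\<bar>T \<delta> u x\<bar> + \<bar>T \<delta> v x\<bar>) \<partial>m)"
    proof (rule integral_mono)
      fix x assume x: "x \<in> space m"
      have "(T \<delta> u x)\<^sup>2 - (T \<delta> v x)\<^sup>2 = (T \<delta> u x - T \<delta> v x) * (T \<delta> u x + T \<delta> v x)"
        by (simp add: power2_eq_square algebra_simps)
      also have "\<dots> \<le> \<bar>T \<delta> u x - T \<delta> v x\<bar> * \<bar>T \<delta> u x + T \<delta> v x\<bar>"
        by (metis abs_ge_self abs_mult)
      also have "\<dots> \<le> \<delta> * K * (\<bar>T \<delta> u x\<bar> + \<bar>T \<delta> v x\<bar>)"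
        using diff[OF x] by (intro mult_mono) auto
      finally show "(T \<delta> u x)\<^sup>2 - (T \<delta> v x)\<^sup>2 \<le> \<delta> * K * (\<bar>T \<delta> u x\<bar> + \<bar>T \<delta> v x\<bar>)" .
    qed (use int2 in auto)
    also have "\<dots> = \<delta> * K * ((\<integral>x. \<bar>T \<delta> u x\<bar> \<partial>m) + (\<integral>x. \<bar>T \<delta> v x\<bar> \<partial>m))"
      by simp
    also have "\<dots> \<le> \<delta> * L"
      unfolding L_def mult.assoc
      using \<delta>(1) iu iv K by (intro mult_left_mono add_mono integral_abs_T_le) auto
    also have "sqnorm (T \<delta> v) \<le> sqnorm v"
      using \<delta>(1) v by (rule sqnorm_T_le)
    finally show ?thesis
      by simp
  qed
  then have ev: "eventually (\<lambda>\<delta>. d \<le> sqnorm v + \<delta> * L) (at_right 0)"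
    using assms(2,3) by (intro eventually_at_rightI[of 0 "min \<alpha> \<beta> / 2"]) auto
  have lim: "((\<lambda>\<delta>. sqnorm v + \<delta> * L) \<longlongrightarrow> sqnorm v + 0 * L) (at_right 0)"
    by (intro tendsto_intros)
  show ?thesis
    unfolding v_def[symmetric] using tendsto_lowerbound[OF lim ev] by simp
qed

text \<open>The argument for nearest points of convex sets: two squared norms below d + e/4 and a
  midpoint of squared norm at least d leave less than 4 (d + e/4) - 4 d = e for the
  difference.\<close>

lemma T_L2_Cauchy:
  assumes u: "bdd_int u" and e: "0 < e"
  obtains \<delta> where "0 < \<delta>"
    "\<And>\<alpha> \<beta>. 0 < \<alpha> \<Longrightarrow> \<alpha> \<le> \<delta> \<Longrightarrow> 0 < \<beta> \<Longrightarrow> \<beta> \<le> \<delta> \<Longrightarrow> sqnorm (\<lambda>x. T \<alpha> u x - T \<beta> u x) < e"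
proof -
  define d where "d = (INF \<alpha>\<in>{0<..}. sqnorm (T \<alpha> u))"
  have bdd_below: "bdd_below ((\<lambda>\<alpha>. sqnorm (T \<alpha> u)) ` {0<..})"
    by (rule bdd_belowI[of _ 0]) (auto intro: sqnorm_nonneg)
  have d: "d \<le> sqnorm (T \<alpha> u)" if "0 < \<alpha>" for \<alpha>
    unfolding d_def using that bdd_below by (intro cINF_lower) auto
  have "d < d + e / 4"
    using e by simp
  then obtain \<delta> where \<delta>: "0 < \<delta>" "sqnorm (T \<delta> u) < d + e / 4"
    unfolding d_def using bdd_below by (subst (asm) cINF_less_iff) auto
  have "sqnorm (\<lambda>x. T \<alpha> u x - T \<beta> u x) < e"
    if "0 < \<alpha>" "\<alpha> \<le> \<delta>" "0 < \<beta>" "\<beta> \<le> \<delta>" for \<alpha> \<beta>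
    using sqnorm_parallelogram[OF bdd_int_T[OF that(1) u] bdd_int_T[OF that(3) u]]
      sqnorm_midpoint_ge[OF u that(1,3) d]
      sqnorm_T_antimono[OF u that(1,2)] sqnorm_T_antimono[OF u that(3,4)] \<delta>(2)
    by linarith
  then show thesis
    using \<delta>(1) that by blast
qed

text \<open>Instead of completeness of L^2, the a.e. limit of a subsequence along \<alpha> = 1/(n+1)
  supplies the limit function. Fatou's lemma makes it integrable and extends the convergence to the
  whole filter \<alpha> \<rightarrow> 0.\<close>

lemma mean_ergodic:
  assumes u: "bdd_int u"
  obtains g where "bdd_int g" "\<And>\<beta>. 0 < \<beta> \<Longrightarrow> AE x in m. T \<beta> g x = g x"
    "((\<lambda>\<alpha>. sqnorm (\<lambda>x. T \<alpha> u x - g x)) \<longlongrightarrow> 0) (at_right 0)"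
proof -
  obtain M where M: "\<And>x. x \<in> space m \<Longrightarrow> \<bar>u x\<bar> \<le> M"
    using u by (auto simp: bdd_int_def bdd_def)
  have bu: "bdd u" and iu: "integrable m u" and mu: "u \<in> borel_measurable m"
    using u by (auto simp: bdd_int_def bdd_def)
  define a where "a n = 1 / real (Suc n)" for n
  have a: "0 < a n" for n
    by (simp add: a_def)
  have a_lim: "a \<longlonglongrightarrow> 0"
    unfolding a_def by (rule LIMSEQ_Suc[OF lim_1_over_n])
  define s where "s n = T (a n) u" for n
  have [measurable]: "T \<alpha> u \<in> borel_measurable m" if "0 < \<alpha>" for \<alpha>
    using that mu by (rule T_measurable)
  have [measurable]: "s n \<in> borel_measurable m" for n
    unfolding s_def using a by measurable
  have s_le: "\<bar>s n x\<bar> \<le> M" if "x \<in> space m" for n x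
    unfolding s_def using a that mu M by (intro T_bound)
  have s_int: "bdd_int (s n)" for n
    unfolding s_def using a u by (intro bdd_int_T)
  have small: "eventually (\<lambda>n. a n \<le> \<delta>) sequentially" if "0 < \<delta>" for \<delta>
    using order_tendstoD(2)[OF a_lim that] by eventually_elim simp
  have s_Cauchy: "\<exists>N. \<forall>i\<ge>N. \<forall>j\<ge>N. (\<integral>x. (s i x - s j x)\<^sup>2 \<partial>m) < e" if e: "0 < e" for e
  proof -
    obtain \<delta> where \<delta>: "0 < \<delta>"
      "\<And>\<alpha> \<beta>. 0 < \<alpha> \<Longrightarrow> \<alpha> \<le> \<delta> \<Longrightarrow> 0 < \<beta> \<Longrightarrow> \<beta> \<le> \<delta> \<Longrightarrow> sqnorm (\<lambda>x. T \<alpha> u x - T \<beta> u x) < e"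
      using T_L2_Cauchy[OF u e] by blast
    obtain N where "\<And>n. N \<le> n \<Longrightarrow> a n \<le> \<delta>"
      using small[OF \<delta>(1)] by (auto simp: eventually_sequentially)
    then show ?thesis
      using \<delta>(2) a by (intro exI[of _ N]) (auto simp: sqnorm_def s_def)
  qed
  have s_int2: "integrable m (\<lambda>x. (s i x - s j x)\<^sup>2)" for i j
    using s_int by (intro integrable_power2 bdd_int_diff)
  obtain r where r: "strict_mono r" "AE x in m. Cauchy (\<lambda>i. s (r i) x)"
    by (rule L2_Cauchy_AE_subseq[of s M]) (use s_le s_int2 s_Cauchy in auto)
  \<comment> \<open>\<open>lim\<close> is arbitrary where the subsequence diverges. Clamping to
    [-M, M] makes g bounded everywhere and changes nothing where the limit exists.\<close>
  define g where "g x = max (- M) (min M (lim (\<lambda>i. s (r i) x)))" for x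
  have [measurable]: "g \<in> borel_measurable m"
    unfolding g_def by measurable
  have lim: "AE x in m. (\<lambda>i. s (r i) x) \<longlonglongrightarrow> g x"
    using r(2) AE_space
  proof eventually_elim
    case (elim x)
    then have l: "(\<lambda>i. s (r i) x) \<longlonglongrightarrow> lim (\<lambda>i. s (r i) x)"
      by (simp add: Cauchy_convergent_iff convergent_LIMSEQ_iff)
    have "- M \<le> s (r i) x" "s (r i) x \<le> M" for i
      using s_le[OF elim(2), of "r i"] by auto
    then have "- M \<le> lim (\<lambda>i. s (r i) x)" "lim (\<lambda>i. s (r i) x) \<le> M"
      using LIMSEQ_le_const[OF l] LIMSEQ_le_const2[OF l] by blast+
    then show ?case
      using l by (simp add: g_def)
  qed
  have "(\<integral>\<^sup>+x. ennreal \<bar>g x\<bar> \<partial>m) \<le> ennreal (\<integral>x. \<bar>u x\<bar> \<partial>m)"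
  proof (rule nn_integral_le_of_AE_tendsto)
    show "AE x in m. (\<lambda>i. ennreal \<bar>s (r i) x\<bar>) \<longlonglongrightarrow> ennreal \<bar>g x\<bar>"
      using lim by eventually_elim (intro tendsto_ennrealI tendsto_rabs)
    show "eventually (\<lambda>i. (\<integral>\<^sup>+x. ennreal \<bar>s (r i) x\<bar> \<partial>m) \<le> ennreal (\<integral>x. \<bar>u x\<bar> \<partial>m)) sequentially"
    proof (rule always_eventually, rule allI)
      fix i
      have "integrable m (\<lambda>x. \<bar>s (r i) x\<bar>)"
        using s_int by (auto simp: bdd_int_def)
      then show "(\<integral>\<^sup>+x. ennreal \<bar>s (r i) x\<bar> \<partial>m) \<le> ennreal (\<integral>x. \<bar>u x\<bar> \<partial>m)"
        using integral_abs_T_le[OF a iu] by (simp add: nn_integral_eq_integral s_def ennreal_leI)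
    qed
  qed measurable
  then have "integrable m g"
    by (intro integrableI_bounded) (auto intro: le_less_trans)
  moreover have "bdd g"
  proof (rule bddI)
    show "\<bar>g x\<bar> \<le> M" if "x \<in> space m" for x
      using s_le[OF that, of 0] by (auto simp: g_def max_def min_def)
  qed measurable
  ultimately have g: "bdd_int g"
    by (simp add: bdd_int_def)
  have conv: "((\<lambda>\<alpha>. sqnorm (\<lambda>x. T \<alpha> u x - g x)) \<longlongrightarrow> 0) (at_right 0)"
  proof (rule order_tendstoI)
    fix e :: real assume e: "0 < e"
    obtain \<delta> where \<delta>: "0 < \<delta>"
      "\<And>\<alpha> \<beta>. 0 < \<alpha> \<Longrightarrow> \<alpha> \<le> \<delta> \<Longrightarrow> 0 < \<beta> \<Longrightarrow> \<beta> \<le> \<delta> \<Longrightarrow> sqnorm (\<lambda>x. T \<alpha> u x - T \<beta> u x) < e / 2"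
      using T_L2_Cauchy[OF u half_gt_zero[OF e]] by blast
    have "sqnorm (\<lambda>x. T \<alpha> u x - g x) < e" if \<alpha>: "0 < \<alpha>" "\<alpha> < \<delta>" for \<alpha>
    proof -
      have [measurable]: "T \<alpha> u \<in> borel_measurable m"
        using \<alpha>(1) mu by (rule T_measurable)
      have int: "integrable m (\<lambda>x. (T \<alpha> u x - g x)\<^sup>2)"
        using \<alpha>(1) u g by (intro integrable_power2 bdd_int_diff bdd_int_T)
      have "(\<integral>\<^sup>+x. ennreal ((T \<alpha> u x - g x)\<^sup>2) \<partial>m) \<le> ennreal (e / 2)"
      proof (rule nn_integral_le_of_AE_tendsto)
        show "AE x in m. (\<lambda>i. ennreal ((T \<alpha> u x - s (r i) x)\<^sup>2)) \<longlonglongrightarrow> ennreal ((T \<alpha> u x - g x)\<^sup>2)"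
          using lim by eventually_elim (intro tendsto_ennrealI tendsto_intros)
        have "filterlim r sequentially sequentially"
          using r(1) by (rule filterlim_subseq)
        from eventually_compose_filterlim[OF small[OF \<delta>(1)] this]
        show "eventually (\<lambda>i. (\<integral>\<^sup>+x. ennreal ((T \<alpha> u x - s (r i) x)\<^sup>2) \<partial>m) \<le> ennreal (e / 2)) sequentially"
        proof eventually_elim
          case (elim i)
          have "integrable m (\<lambda>x. (T \<alpha> u x - s (r i) x)\<^sup>2)"
            using \<alpha>(1) u s_int by (intro integrable_power2 bdd_int_diff bdd_int_T)
          then show ?case
            using \<delta>(2)[OF \<alpha>(1) less_imp_le[OF \<alpha>(2)] a elim]
            by (simp add: nn_integral_eq_integral s_def sqnorm_def ennreal_leI)
        qed
      qed measurable
      then have "sqnorm (\<lambda>x. T \<alpha> u x - g x) \<le> e / 2"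
        using int e by (simp add: nn_integral_eq_integral sqnorm_def)
      then show ?thesis
        using e by simp
    qed
    then show "eventually (\<lambda>\<alpha>. sqnorm (\<lambda>x. T \<alpha> u x - g x) < e) (at_right 0)"
      using \<delta>(1) by (intro eventually_at_rightI[of 0 \<delta>]) auto
  qed (auto intro: always_eventually less_le_trans[OF _ sqnorm_nonneg])
  have "AE x in m. T \<beta> g x = g x" if \<beta>: "0 < \<beta>" for \<beta>
  proof -
    have le: "sqnorm (\<lambda>x. T \<beta> g x - g x)
        \<le> 8 * sqnorm (\<lambda>x. T \<alpha> u x - g x) + 8 * ((\<alpha> / (\<alpha> - \<beta>))\<^sup>2 * sqnorm u)"
      if \<alpha>: "0 < \<alpha>" "\<alpha> < \<beta>" for \<alpha>
    proof -
      have bg: "bdd g" "bdd (T \<alpha> u)"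
        using g \<alpha> bu by (auto simp: bdd_int_def intro: bdd_T)
      have Tbi: "bdd_int (T \<alpha> u)" "bdd_int (T \<beta> u)"
        using \<alpha>(1) \<beta> u by (auto intro: bdd_int_T)
      \<comment> \<open>The splitting is \<open>T \<beta> g - g = A + C + B\<close> with B =
        \<open>T \<beta> (T \<alpha> u) - T \<alpha> u\<close>. The resolvent equation gives B the
        form written below, whose factor \<open>\<alpha> / (\<alpha> - \<beta>)\<close> vanishes as
        \<alpha> tends to 0.\<close>
      define A where "A = T \<beta> (\<lambda>x. g x - T \<alpha> u x)"
      define B where "B = (\<lambda>x. \<alpha> / (\<alpha> - \<beta>) * (T \<beta> u x - T \<alpha> u x))"
      define C where "C = (\<lambda>x. T \<alpha> u x - g x)"
      have ABC: "bdd_int A" "bdd_int B" "bdd_int C"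
        unfolding A_def B_def C_def
        by (intro bdd_int_T bdd_int_diff bdd_int_cmult; use u g \<alpha> \<beta> in simp)+
      have "T \<beta> g x - g x = A x + C x + B x" if x: "x \<in> space m" for x
      proof -
        have "(\<alpha> - \<beta>) * T \<beta> (T \<alpha> u) x = \<alpha> * T \<beta> u x - \<beta> * T \<alpha> u x"
          using resolvent_identity[OF \<beta> \<alpha>(1) x bu] .
        then have "B x = T \<beta> (T \<alpha> u) x - T \<alpha> u x"
          using \<alpha> unfolding B_def by (simp add: field_simps)
        then show ?thesis
          using \<beta> x bg by (simp add: A_def C_def T_diff)
      qed
      then have "sqnorm (\<lambda>x. T \<beta> g x - g x) = sqnorm (\<lambda>x. A x + C x + B x)"
        by (rule sqnorm_cong)
      also have "\<dots> \<le> 4 * sqnorm A + 4 * sqnorm C + 2 * sqnorm B"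
        using sqnorm_add_le[OF bdd_int_add[OF ABC(1,3)] ABC(2)] sqnorm_add_le[OF ABC(1,3)] by linarith
      also have "sqnorm A \<le> sqnorm C"
        using sqnorm_T_le[OF \<beta> bdd_int_diff[OF g Tbi(1)]]
        by (simp add: A_def C_def sqnorm_minus_commute[of g])
      also have "sqnorm B = (\<alpha> / (\<alpha> - \<beta>))\<^sup>2 * sqnorm (\<lambda>x. T \<beta> u x - T \<alpha> u x)"
        unfolding B_def by (rule sqnorm_cmult)
      also have "\<dots> \<le> (\<alpha> / (\<alpha> - \<beta>))\<^sup>2 * (4 * sqnorm u)"
        using sqnorm_parallelogram[OF Tbi(2,1)] sqnorm_T_le[OF \<beta> u] sqnorm_T_le[OF \<alpha>(1) u]
          sqnorm_nonneg[of "\<lambda>x. 1 / 2 * (T \<beta> u x + T \<alpha> u x)"]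
        by (intro mult_left_mono) (linarith | simp)+
      finally show ?thesis
        by (simp add: C_def)
    qed
    have "((\<lambda>\<alpha>. 8 * sqnorm (\<lambda>x. T \<alpha> u x - g x) + 8 * ((\<alpha> / (\<alpha> - \<beta>))\<^sup>2 * sqnorm u))
        \<longlongrightarrow> 8 * 0 + 8 * ((0 / (0 - \<beta>))\<^sup>2 * sqnorm u)) (at_right 0)"
      using \<beta> by (intro tendsto_intros conv) auto
    moreover have "eventually (\<lambda>\<alpha>. sqnorm (\<lambda>x. T \<beta> g x - g x)
        \<le> 8 * sqnorm (\<lambda>x. T \<alpha> u x - g x) + 8 * ((\<alpha> / (\<alpha> - \<beta>))\<^sup>2 * sqnorm u)) (at_right 0)"
      using \<beta> le by (intro eventually_at_rightI[of 0 \<beta>]) auto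
    ultimately have "sqnorm (\<lambda>x. T \<beta> g x - g x) \<le> 0"
      using tendsto_lowerbound[of _ _ "at_right (0::real)"] by fastforce
    then have "(\<integral>x. (T \<beta> g x - g x)\<^sup>2 \<partial>m) = 0"
      using sqnorm_nonneg[of "\<lambda>x. T \<beta> g x - g x"] unfolding sqnorm_def by (rule order.antisym)
    then have "AE x in m. (T \<beta> g x - g x)\<^sup>2 = 0"
      using g \<beta> by (subst (asm) integral_nonneg_eq_0_iff_AE)
        (auto intro!: integrable_power2 bdd_int_diff bdd_int_T)
    then show ?thesis
      by eventually_elim simp
  qed
  then show thesis
    using g conv that by blast
qed

section \<open>Irreducibility and invariant functions\<close>

text \<open>Sub-invariance applied to the p-th power of |u| makes its integral against
  \<open>U \<alpha> x\<close> finite for almost every x. As \<open>U \<alpha> x\<close> is a finite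
  measure, u itself is then integrable there.\<close>

lemma AE_integrable_U:
  assumes "1 \<le> p" "0 < \<alpha>" "u \<in> Lp m p"
  shows "AE x in m. integrable (U \<alpha> x) u"
proof -
  have [measurable]: "u \<in> borel_measurable m" and int: "integrable m (\<lambda>x. \<bar>u x\<bar> powr p)"
    using assms(3) by (auto simp: Lp_def)
  have meas: "(\<lambda>x. ennreal \<alpha> * (\<integral>\<^sup>+y. ennreal (\<bar>u y\<bar> powr p) \<partial>U \<alpha> x)) \<in> borel_measurable m"
    using assms(2) by (intro borel_measurable_times_ennreal nn_integral_U_measurable) auto
  have "(\<integral>\<^sup>+x. ennreal \<alpha> * (\<integral>\<^sup>+y. ennreal (\<bar>u y\<bar> powr p) \<partial>U \<alpha> x) \<partial>m)
      \<le> (\<integral>\<^sup>+x. ennreal (\<bar>u x\<bar> powr p) \<partial>m)"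
    using assms(2) by (intro nn_integral_sub_invariant) auto
  also have "\<dots> < \<infinity>"
    using int by (simp add: nn_integral_eq_integral)
  finally have "AE x in m. ennreal \<alpha> * (\<integral>\<^sup>+y. ennreal (\<bar>u y\<bar> powr p) \<partial>U \<alpha> x) \<noteq> \<infinity>"
    using meas by (intro nn_integral_PInf_AE) auto
  then show ?thesis
    using AE_space
  proof eventually_elim
    case (elim x)
    interpret finite_measure "U \<alpha> x"
      using assms(2) elim(2) by (rule finite_measure_U)
    have u: "u \<in> borel_measurable (U \<alpha> x)"
      using assms(2) elim(2) by (rule borel_measurable_U) measurable
    have "(\<integral>\<^sup>+y. ennreal (\<bar>u y\<bar> powr p) \<partial>U \<alpha> x) < \<infinity>"
      using elim(1) assms(2) by (auto simp: ennreal_mult_eq_top_iff less_top)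
    then have "integrable (U \<alpha> x) (\<lambda>y. \<bar>u y\<bar> powr p)"
      using u by (intro integrableI_bounded) auto
    then show ?case
      by (rule integrable_of_powr[OF assms(1) u])
  qed
qed

text \<open>Monotonicity in \<alpha> reduces the uncountable supremum to a sequence, so that it is
  measurable and the exceptional null sets for the single parameters can be united.\<close>

lemma initial_kernel_eq_SUP:
  assumes "f \<in> borel_measurable m" "x \<in> space m"
  shows "initial_kernel U f x = (SUP n. \<integral>\<^sup>+y. f y \<partial>U (1 / real (Suc n)) x)"
  unfolding initial_kernel_def
proof (rule SUP_eq)
  fix \<alpha> :: real assume "\<alpha> \<in> {0<..}"
  then have \<alpha>: "0 < \<alpha>"
    by simp
  then obtain n where "1 / real (Suc n) < \<alpha>"
    using nat_approx_posE by blast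
  then have "(\<integral>\<^sup>+y. f y \<partial>U \<alpha> x) \<le> (\<integral>\<^sup>+y. f y \<partial>U (1 / real (Suc n)) x)"
    using assms by (intro nn_integral_U_antimono) auto
  then show "\<exists>n\<in>UNIV. (\<integral>\<^sup>+y. f y \<partial>U \<alpha> x) \<le> (\<integral>\<^sup>+y. f y \<partial>U (1 / real (Suc n)) x)"
    by blast
next
  fix n :: nat
  show "\<exists>\<alpha>\<in>{0<..}. (\<integral>\<^sup>+y. f y \<partial>U (1 / real (Suc n)) x) \<le> (\<integral>\<^sup>+y. f y \<partial>U \<alpha> x)"
    by (intro bexI[of _ "1 / real (Suc n)"]) auto
qed

lemma initial_kernel_measurable:
  assumes "f \<in> borel_measurable m"
  shows "initial_kernel U f \<in> borel_measurable m"
proof -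
  have [measurable]: "(\<lambda>x. \<integral>\<^sup>+y. f y \<partial>U (1 / real (Suc n)) x) \<in> borel_measurable m" for n
    using assms by (intro nn_integral_U_measurable) auto
  have "(\<lambda>x. SUP n. \<integral>\<^sup>+y. f y \<partial>U (1 / real (Suc n)) x) \<in> borel_measurable m"
    by measurable
  with initial_kernel_eq_SUP[OF assms] show ?thesis
    by (rule measurable_cong[THEN iffD2])
qed

lemma AE_initial_kernel_eq_0:
  assumes "f \<in> borel_measurable m"
    and "\<And>\<alpha>. 0 < \<alpha> \<Longrightarrow> AE x in m. P x \<longrightarrow> (\<integral>\<^sup>+y. f y \<partial>U \<alpha> x) = 0"
  shows "AE x in m. P x \<longrightarrow> initial_kernel U f x = 0"
proof -
  have "AE x in m. \<forall>n. P x \<longrightarrow> (\<integral>\<^sup>+y. f y \<partial>U (1 / real (Suc n)) x) = 0"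
    unfolding AE_all_countable by (intro allI assms(2)) simp
  then show ?thesis
    using AE_space by eventually_elim (auto simp: initial_kernel_eq_SUP[OF assms(1)])
qed

text \<open>The difference of the p-th powers is nonnegative a.e., while contractivity makes its
  integral nonpositive; so it vanishes, and the power is strictly increasing.\<close>

lemma T_eq_of_le:
  assumes "1 \<le> p" "0 < \<alpha>" "v \<in> Lp m p"
    and "\<And>x. x \<in> space m \<Longrightarrow> 0 \<le> v x" "AE x in m. v x \<le> T \<alpha> v x"
  shows "AE x in m. T \<alpha> v x = v x"
proof -
  have v: "v \<in> borel_measurable m" and int: "integrable m (\<lambda>x. \<bar>v x\<bar> powr p)"
    using assms(3) by (auto simp: Lp_def)
  have intT: "integrable m (\<lambda>x. \<bar>T \<alpha> v x\<bar> powr p)"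
    using assms(1,2) v int by (rule integrable_T_powr)
  have nonneg: "AE x in m. 0 \<le> \<bar>T \<alpha> v x\<bar> powr p - \<bar>v x\<bar> powr p"
    using assms(5) AE_space
  proof eventually_elim
    case (elim x)
    then have "\<bar>v x\<bar> powr p \<le> \<bar>T \<alpha> v x\<bar> powr p"
      using assms(1,4) by (intro powr_mono2) auto
    then show ?case
      by simp
  qed
  have int_diff: "integrable m (\<lambda>x. \<bar>T \<alpha> v x\<bar> powr p - \<bar>v x\<bar> powr p)"
    using intT int by auto
  have "(\<integral>x. \<bar>T \<alpha> v x\<bar> powr p - \<bar>v x\<bar> powr p \<partial>m) \<le> 0"
    using integral_T_powr_le[OF assms(1,2) v int] intT int by simp
  then have "(\<integral>x. \<bar>T \<alpha> v x\<bar> powr p - \<bar>v x\<bar> powr p \<partial>m) = 0"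
    using integral_nonneg_AE[OF nonneg] by (rule order.antisym)
  then have "AE x in m. \<bar>T \<alpha> v x\<bar> powr p - \<bar>v x\<bar> powr p = 0"
    using integral_nonneg_eq_0_iff_AE[OF int_diff nonneg] by blast
  then show ?thesis
    using assms(5) AE_space
  proof eventually_elim
    case (elim x)
    have "\<not> v x < T \<alpha> v x"
    proof
      assume "v x < T \<alpha> v x"
      then have "\<bar>v x\<bar> powr p < \<bar>T \<alpha> v x\<bar> powr p"
        using assms(1) assms(4)[OF elim(3)] by (intro powr_less_mono2) auto
      then show False
        using elim(1) by simp
    qed
    then show ?case
      using elim(2) by simp
  qed
qed

text \<open>The sign of c matters twice: it keeps the truncation below |u|, hence in L^p even on an
  infinite space, and it gives \<open>T \<alpha> (\<lambda>_. c) x \<le> c\<close> when only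
  \<alpha> U_\<alpha> 1 \<le> 1 is known.\<close>

lemma positive_part_invariant:
  assumes "1 \<le> p" "0 \<le> c" "0 < \<alpha>" "u \<in> Lp m p" "AE x in m. T \<alpha> u x = u x"
  shows "AE x in m. T \<alpha> (\<lambda>y. max 0 (u y - c)) x = max 0 (u x - c)"
    and "(\<lambda>y. max 0 (u y - c)) \<in> Lp m p"
proof -
  have [measurable]: "u \<in> borel_measurable m" and int: "integrable m (\<lambda>x. \<bar>u x\<bar> powr p)"
    using assms(4) by (auto simp: Lp_def)
  have le: "\<bar>max 0 (u y - c)\<bar> \<le> \<bar>u y\<bar>" for y
    using assms(2) by auto
  show Lp: "(\<lambda>y. max 0 (u y - c)) \<in> Lp m p"
    unfolding Lp_def
  proof (intro CollectI conjI)
    show "integrable m (\<lambda>y. \<bar>max 0 (u y - c)\<bar> powr p)"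
      using int
    proof (rule Bochner_Integration.integrable_bound)
      show "AE y in m. norm (\<bar>max 0 (u y - c)\<bar> powr p) \<le> norm (\<bar>u y\<bar> powr p)"
        using le assms(1) by (auto intro!: powr_mono2 simp del: abs_le_self_iff)
    qed measurable
  qed measurable
  have "AE x in m. max 0 (u x - c) \<le> T \<alpha> (\<lambda>y. max 0 (u y - c)) x"
    using AE_integrable_U[OF assms(1,3,4)] AE_integrable_U[OF assms(1,3) Lp] assms(5) AE_space
  proof eventually_elim
    case (elim x)
    interpret finite_measure "U \<alpha> x"
      using assms(3) elim(4) by (rule finite_measure_U)
    have "0 \<le> T \<alpha> (\<lambda>y. max 0 (u y - c)) x"
      using assms(3) elim(4) by (intro T_nonneg) auto
    moreover have "u x - c \<le> T \<alpha> (\<lambda>y. max 0 (u y - c)) x"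
    proof -
      have "u x - c \<le> T \<alpha> u x - T \<alpha> (\<lambda>_. c) x"
        using T_const_le[OF assms(3) elim(4) assms(2)] elim(3) by simp
      also have "\<dots> = \<alpha> * (\<integral>y. u y - c \<partial>U \<alpha> x)"
        using elim(1) by (simp add: resolvent_op_def right_diff_distrib)
      also have "\<dots> \<le> T \<alpha> (\<lambda>y. max 0 (u y - c)) x"
        unfolding resolvent_op_def using elim(1,2) assms(3)
        by (intro mult_left_mono integral_mono) auto
      finally show ?thesis .
    qed
    ultimately show ?case
      by simp
  qed
  then show "AE x in m. T \<alpha> (\<lambda>y. max 0 (u y - c)) x = max 0 (u x - c)"
    using assms(1,3) Lp by (intro T_eq_of_le) auto
qed

text \<open>At a zero of v, invariance makes the integral of the nonnegative function v against
  \<open>U \<alpha> x\<close> vanish, so this measure does not charge the set where v > 0.\<close>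

lemma absorbing_zero_set:
  assumes "1 \<le> p" "v \<in> Lp m p" "\<And>x. x \<in> space m \<Longrightarrow> 0 \<le> v x"
    and inv: "\<And>\<alpha>. 0 < \<alpha> \<Longrightarrow> AE x in m. T \<alpha> v x = v x"
  shows "absorbing m U {x \<in> space m. v x = 0}"
proof -
  have [measurable]: "v \<in> borel_measurable m"
    using assms(2) by (simp add: Lp_def)
  let ?A = "{x \<in> space m. v x = 0}"
  have [measurable]: "?A \<in> sets m"
    by measurable
  have "AE x in m. x \<in> ?A \<longrightarrow> (\<integral>\<^sup>+y. indicator (space m - ?A) y \<partial>U \<alpha> x) = 0" if \<alpha>: "0 < \<alpha>" for \<alpha>
    using inv[OF \<alpha>] AE_integrable_U[OF assms(1) \<alpha> assms(2)] AE_space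
  proof eventually_elim
    case (elim x)
    show ?case
    proof
      assume "x \<in> ?A"
      then have "(\<integral>y. v y \<partial>U \<alpha> x) = 0"
        using elim(1) \<alpha> by (simp add: resolvent_op_def)
      moreover have "AE y in U \<alpha> x. 0 \<le> v y"
        using assms(3) \<alpha> elim(3) by (intro AE_I2) (auto simp: space_U)
      ultimately have "AE y in U \<alpha> x. v y = 0"
        using integral_nonneg_eq_0_iff_AE[OF elim(2)] by blast
      then have "AE y in U \<alpha> x. indicator (space m - ?A) y = (0 :: ennreal)"
        by eventually_elim (auto simp: indicator_def)
      then have "(\<integral>\<^sup>+y. indicator (space m - ?A) y \<partial>U \<alpha> x) = (\<integral>\<^sup>+y. 0 \<partial>U \<alpha> x)"
        by (rule nn_integral_cong_AE)
      then show "(\<integral>\<^sup>+y. indicator (space m - ?A) y \<partial>U \<alpha> x) = 0"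
        by simp
    qed
  qed
  then show ?thesis
    unfolding absorbing_def by (intro conjI AE_initial_kernel_eq_0) measurable
qed

text \<open>Absorbing level sets are at hand only for c \<ge> 0, so the positive parts of u and of
  -u are shown to be constant separately.\<close>

lemma irreducible_positive_part_const:
  assumes "1 \<le> p" "m_irreducible m U" "u \<in> Lp m p"
    and inv: "\<And>\<alpha>. 0 < \<alpha> \<Longrightarrow> AE x in m. T \<alpha> u x = u x"
  shows "\<exists>c. AE x in m. max 0 (u x) = c"
proof (rule AE_eq_const_of_dichotomy)
  fix c :: real assume c: "0 \<le> c"
  have [measurable]: "u \<in> borel_measurable m"
    using assms(3) by (simp add: Lp_def)
  let ?A = "{x \<in> space m. max 0 (u x - c) = 0}"
  have sets: "?A \<in> sets m" "space m - ?A \<in> sets m"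
    by measurable
  have "absorbing m U ?A"
    using positive_part_invariant(2)[OF assms(1) c zero_less_one assms(3) inv]
      positive_part_invariant(1)[OF assms(1) c _ assms(3) inv]
    by (intro absorbing_zero_set[OF assms(1)]) auto
  then have "emeasure m ?A = 0 \<or> emeasure m (space m - ?A) = 0"
    using assms(2) by (auto simp: m_irreducible_def)
  then show "(AE x in m. max 0 (u x) \<le> c) \<or> (AE x in m. c < max 0 (u x))"
  proof
    assume "emeasure m ?A = 0"
    then have "?A \<in> null_sets m"
      using sets by auto
    then have "AE x in m. x \<notin> ?A"
      by (rule AE_not_in)
    then have "AE x in m. c < max 0 (u x)"
      using AE_space by eventually_elim (auto simp: max_def split: if_splits)
    then show ?thesis ..
  next
    assume "emeasure m (space m - ?A) = 0"
    then have "space m - ?A \<in> null_sets m"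
      using sets by auto
    then have "AE x in m. x \<notin> space m - ?A"
      by (rule AE_not_in)
    then have "AE x in m. max 0 (u x) \<le> c"
      using AE_space by eventually_elim (use c in \<open>auto simp: max_def split: if_splits\<close>)
    then show ?thesis ..
  qed
qed simp

theorem irreducible_imp_invariant_constant:
  assumes "1 \<le> p" "m_irreducible m U"
  shows "invariant_constant m p U"
  unfolding invariant_constant_def
proof (intro ballI impI)
  fix u assume u: "u \<in> Lp m p" and inv: "\<forall>\<alpha>>0. AE x in m. T \<alpha> u x = u x"
  have "(\<lambda>x. - u x) \<in> Lp m p"
    using u by (auto simp: Lp_def)
  moreover have "AE x in m. T \<alpha> (\<lambda>x. - u x) x = - u x" if "0 < \<alpha>" for \<alpha>
    using inv[rule_format, OF that] by eventually_elim (simp add: resolvent_op_def)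
  ultimately obtain c where c: "AE x in m. max 0 (- u x) = c"
    using irreducible_positive_part_const[OF assms] by blast
  obtain d where d: "AE x in m. max 0 (u x) = d"
    using irreducible_positive_part_const[OF assms u] inv by blast
  have "AE x in m. u x = d - c"
    using c d by eventually_elim (auto simp: max_def split: if_splits)
  then show "\<exists>c. AE x in m. u x = c" ..
qed

section \<open>Consequences of L^p convergence\<close>

theorem Lp_ergodic_imp_invariant_constant:
  assumes "1 \<le> p" "Lp_ergodic m p U"
  shows "invariant_constant m p U"
  unfolding invariant_constant_def
proof (intro ballI impI)
  fix u assume u: "u \<in> Lp m p" and inv: "\<forall>\<alpha>>0. AE x in m. T \<alpha> u x = u x"
  have [measurable]: "u \<in> borel_measurable m" and int: "integrable m (\<lambda>x. \<bar>u x\<bar> powr p)"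
    using u by (auto simp: Lp_def)
  define c where "c = mean_const m u"
  have "((\<lambda>\<alpha>. \<integral>x. \<bar>T \<alpha> u x - c\<bar> powr p \<partial>m) \<longlongrightarrow> 0) (at_right 0)"
    using assms u Lp_norm_tendsto_zero_iff[of p m "\<lambda>\<alpha> x. T \<alpha> u x - c" "at_right 0"]
    by (auto simp: Lp_ergodic_def c_def)
  \<comment> \<open>Invariance makes the convergent integral independent of \<alpha>, so its value
    is the limit 0.\<close>
  moreover have "(\<integral>x. \<bar>T \<alpha> u x - c\<bar> powr p \<partial>m) = (\<integral>x. \<bar>u x - c\<bar> powr p \<partial>m)" if \<alpha>: "0 < \<alpha>" for \<alpha>
  proof (rule integral_cong_AE)
    have [measurable]: "T \<alpha> u \<in> borel_measurable m"
      using \<alpha> by (rule T_measurable) measurable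
    show "(\<lambda>x. \<bar>T \<alpha> u x - c\<bar> powr p) \<in> borel_measurable m"
      by measurable
    show "AE x in m. \<bar>T \<alpha> u x - c\<bar> powr p = \<bar>u x - c\<bar> powr p"
      using inv[rule_format, OF \<alpha>] by eventually_elim simp
  qed measurable
  then have "eventually (\<lambda>\<alpha>. (\<integral>x. \<bar>T \<alpha> u x - c\<bar> powr p \<partial>m) = (\<integral>x. \<bar>u x - c\<bar> powr p \<partial>m)) (at_right 0)"
    by (intro eventually_at_rightI[of 0 1]) auto
  ultimately have "((\<lambda>\<alpha>::real. \<integral>x. \<bar>u x - c\<bar> powr p \<partial>m) \<longlongrightarrow> 0) (at_right 0)"
    using tendsto_cong by fast
  then have zero: "(\<integral>x. \<bar>u x - c\<bar> powr p \<partial>m) = 0"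
    by (simp add: tendsto_const_iff)
  have "integrable m (\<lambda>x. \<bar>u x - c\<bar> powr p)"
    unfolding c_def using assms(1) int mean_const_integrable_powr by (intro integrable_powr_diff) auto
  then have "AE x in m. \<bar>u x - c\<bar> powr p = 0"
    using zero by (subst (asm) integral_nonneg_eq_0_iff_AE) auto
  then have "AE x in m. u x = c"
    by eventually_elim simp
  then show "\<exists>c. AE x in m. u x = c" ..
qed

text \<open>Convergence in L^p gives a.e. convergence to c > 0 along a subsequence of \<alpha> =
  1/(n+1), and U_\<alpha> u = T_\<alpha> u / \<alpha> then grows without bound.\<close>

lemma Lp_ergodic_imp_initial_kernel_infinite:
  assumes "1 \<le> p" "Lp_ergodic m p U" and fin: "emeasure m (space m) < \<infinity>"
    and f: "f \<in> borel_measurable m" and nz: "\<not> (AE x in m. f x = 0)"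
  shows "AE x in m. initial_kernel U f x = \<infinity>"
proof -
  interpret m: finite_measure m
    using fin by (intro finite_measureI) auto
  note f[measurable]
  \<comment> \<open>Truncation at 1 gives a real function that lies in L^p because m is finite, and
    that vanishes only where f does.\<close>
  define u where "u x = enn2real (min 1 (f x))" for x
  have [measurable]: "u \<in> borel_measurable m"
    unfolding u_def by measurable
  have eu: "ennreal (u x) = min 1 (f x)" for x
    unfolding u_def by (intro ennreal_enn2real) (auto simp: min_less_iff_disj)
  have u_nonneg: "0 \<le> u x" for x
    by (simp add: u_def)
  have u_le: "u x \<le> 1" for x
  proof -
    have "ennreal (u x) \<le> ennreal 1"
      unfolding eu by simp
    then show ?thesis
      by (subst (asm) ennreal_le_iff) auto
  qed
  have bu: "bdd u"
    using u_nonneg u_le by (intro bddI[of _ 1]) auto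
  have int_u: "integrable m u"
    using u_nonneg u_le by (intro m.integrable_const_bound[of _ 1]) auto
  have u_Lp: "u \<in> Lp m p"
    unfolding Lp_def using assms(1) u_nonneg u_le
    by (auto intro!: m.integrable_const_bound[of _ 1] AE_I2 powr_le1)
  have "(\<integral>x. u x \<partial>m) \<noteq> 0"
  proof
    assume "(\<integral>x. u x \<partial>m) = 0"
    then have "AE x in m. u x = 0"
      using int_u u_nonneg by (subst (asm) integral_nonneg_eq_0_iff_AE) auto
    then have "AE x in m. f x = 0"
    proof eventually_elim
      case (elim x)
      then have "min 1 (f x) = 0"
        using eu[of x] by simp
      then show ?case
        by (auto simp: min_def split: if_splits)
    qed
    then show False
      using nz by simp
  qed
  moreover have "0 \<le> (\<integral>x. u x \<partial>m)"
    using u_nonneg by simp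
  ultimately have pos: "0 < (\<integral>x. u x \<partial>m)"
    by simp
  have "0 < measure m (space m)"
  proof (rule ccontr)
    assume "\<not> 0 < measure m (space m)"
    then have "emeasure m (space m) = 0"
      using m.emeasure_eq_measure[of "space m"] measure_nonneg[of m "space m"] by simp
    then have "AE x in m. f x = 0"
      by (intro AE_I'[of "space m"]) (auto simp: null_sets_def)
    then show False
      using nz by simp
  qed
  define c where "c = mean_const m u"
  have c: "0 < c"
    using pos \<open>0 < measure m (space m)\<close> fin by (simp add: c_def mean_const_def)
  define a where "a n = 1 / real (Suc n)" for n
  have a: "0 < a n" for n
    by (simp add: a_def)
  have a_lim: "a \<longlonglongrightarrow> 0"
    unfolding a_def by (rule LIMSEQ_Suc[OF lim_1_over_n])
  have a_right: "filterlim a (at_right 0) sequentially"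
    using a_lim a by (intro tendsto_imp_filterlim_at_right) auto
  have "((\<lambda>\<alpha>. \<integral>x. \<bar>T \<alpha> u x - c\<bar> powr p \<partial>m) \<longlongrightarrow> 0) (at_right 0)"
    using assms(1,2) u_Lp Lp_norm_tendsto_zero_iff[of p m "\<lambda>\<alpha> x. T \<alpha> u x - c" "at_right 0"]
    by (auto simp: Lp_ergodic_def c_def)
  then have "(\<lambda>n. \<integral>x. \<bar>T (a n) u x - c\<bar> powr p \<partial>m) \<longlonglongrightarrow> 0"
    using a_right by (rule filterlim_compose)
  moreover have "integrable m (\<lambda>x. \<bar>T (a n) u x - c\<bar> powr p)" for n
    unfolding c_def using assms(1) u_Lp a[of n] mean_const_integrable_powr
    by (intro integrable_powr_diff integrable_T_powr) (auto simp: Lp_def intro: T_measurable)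
  ultimately obtain r where r: "strict_mono r" "AE x in m. (\<lambda>n. \<bar>T (a (r n)) u x - c\<bar> powr p) \<longlonglongrightarrow> 0"
    using tendsto_L1_AE_subseq[of m "\<lambda>n x. \<bar>T (a n) u x - c\<bar> powr p"] by auto
  show ?thesis
    using r(2) AE_space
  proof eventually_elim
    case (elim x)
    have "(\<lambda>n. (\<bar>T (a (r n)) u x - c\<bar> powr p) powr (1 / p)) \<longlonglongrightarrow> 0"
      by (rule tendsto_zero_powrI[OF elim(1) tendsto_const]) (use assms(1) in auto)
    then have "(\<lambda>n. \<bar>T (a (r n)) u x - c\<bar>) \<longlonglongrightarrow> 0"
      using assms(1) by (simp add: powr_powr)
    then have "(\<lambda>n. T (a (r n)) u x) \<longlonglongrightarrow> c"
      by (simp add: tendsto_rabs_zero_iff LIM_zero_iff)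
    then have ev1: "eventually (\<lambda>n. c / 2 < T (a (r n)) u x) sequentially"
      using c by (intro order_tendstoD) auto
    have ar: "(\<lambda>n. a (r n)) \<longlonglongrightarrow> 0"
      using LIMSEQ_subseq_LIMSEQ[OF a_lim r(1)] by (simp add: comp_def)
    have "of_nat k \<le> initial_kernel U f x" for k
    proof -
      \<comment> \<open>Together with a value above c / 2 this makes the quotient by
        \<open>a (r n)\<close> at least k; the summand 1 covers k = 0.\<close>
      have "eventually (\<lambda>n. a (r n) < c / (2 * (real k + 1))) sequentially"
        using c ar by (intro order_tendstoD) auto
      then obtain n where n: "c / 2 < T (a (r n)) u x" "a (r n) < c / (2 * (real k + 1))"
        using eventually_happens[OF eventually_conj[OF ev1]] by auto
      have "real k * a (r n) \<le> (real k + 1) * a (r n)"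
        using a[of "r n"] by (intro mult_right_mono) auto
      also have "\<dots> \<le> c / 2"
        using n(2) by (simp add: field_simps)
      also have "\<dots> \<le> T (a (r n)) u x"
        using n(1) by simp
      finally have "real k \<le> T (a (r n)) u x / a (r n)"
        using a[of "r n"] by (simp add: field_simps)
      then have "of_nat k \<le> ennreal (T (a (r n)) u x / a (r n))"
        by (metis ennreal_leI ennreal_of_nat_eq_real_of_nat)
      also have "\<dots> = (\<integral>\<^sup>+y. ennreal (u y) \<partial>U (a (r n)) x)"
        using a elim(2) bu u_nonneg by (intro nn_integral_U_eq_T[symmetric])
      also have "\<dots> \<le> (\<integral>\<^sup>+y. f y \<partial>U (a (r n)) x)"
        by (intro nn_integral_mono) (simp add: eu)
      also have "\<dots> \<le> initial_kernel U f x"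
        unfolding initial_kernel_def using a by (intro SUP_upper) auto
      finally show ?thesis .
    qed
    then have "(SUP k. of_nat k) \<le> initial_kernel U f x"
      by (rule SUP_least)
    then show ?case
      by (simp add: ennreal_SUP_of_nat_eq_top top_unique)
  qed
qed

text \<open>The potential of f is a.e. 0 if f is a.e. 0, and a.e. infinite otherwise.\<close>

theorem Lp_ergodic_imp_recurrent:
  assumes "1 \<le> p" "Lp_ergodic m p U" "emeasure m (space m) < \<infinity>"
  shows "m_recurrent m U"
  unfolding m_recurrent_def
proof (intro allI impI, elim conjE)
  fix f :: "'a \<Rightarrow> ennreal" assume f: "f \<in> borel_measurable m"
  have "AE x in m. \<not> (0 < initial_kernel U f x \<and> initial_kernel U f x < \<infinity>)"
  proof (cases "AE x in m. f x = 0")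
    case True
    have "AE x in m. True \<longrightarrow> initial_kernel U f x = 0"
    proof (rule AE_initial_kernel_eq_0[OF f])
      fix \<alpha> :: real assume "0 < \<alpha>"
      then show "AE x in m. True \<longrightarrow> (\<integral>\<^sup>+y. f y \<partial>U \<alpha> x) = 0"
        using AE_AE_U[OF _ True, of \<alpha>] by (auto elim!: eventually_mono simp: nn_integral_cong_AE)
    qed
    then show ?thesis
      by eventually_elim simp
  next
    case False
    then show ?thesis
      using Lp_ergodic_imp_initial_kernel_infinite[OF assms f] by (auto elim!: eventually_mono)
  qed
  moreover have "{x \<in> space m. 0 < initial_kernel U f x \<and> initial_kernel U f x < \<infinity>} \<in> sets m"
    using initial_kernel_measurable[OF f] by measurable
  ultimately show "{x \<in> space m. 0 < initial_kernel U f x \<and> initial_kernel U f x < \<infinity>} \<in> null_sets m"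
    by (subst (asm) AE_iff_null) (simp_all only: not_not)
qed

text \<open>If the complement of an absorbing set has positive measure, its potential is infinite
  a.e., yet it is 0 a.e. on the absorbing set.\<close>

theorem Lp_ergodic_imp_irreducible:
  assumes "1 \<le> p" "Lp_ergodic m p U" "emeasure m (space m) < \<infinity>"
  shows "m_irreducible m U"
  unfolding m_irreducible_def
proof (intro allI impI)
  fix A assume "absorbing m U A"
  then have A[measurable]: "A \<in> sets m"
    and abs: "AE x in m. x \<in> A \<longrightarrow> initial_kernel U (indicator (space m - A)) x = 0"
    by (auto simp: absorbing_def)
  have ind: "indicator (space m - A) \<in> borel_measurable m"
    by measurable
  show "emeasure m A = 0 \<or> emeasure m (space m - A) = 0"
  proof (cases "AE x in m. indicator (space m - A) x = (0 :: ennreal)")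
    case True
    then have "(\<integral>\<^sup>+x. indicator (space m - A) x \<partial>m) = 0"
      using nn_integral_0_iff_AE[OF ind] by blast
    then show ?thesis
      by simp
  next
    case False
    have "AE x in m. x \<notin> A"
      using abs Lp_ergodic_imp_initial_kernel_infinite[OF assms ind False]
      by eventually_elim auto
    then have "A \<in> null_sets m"
      using A sets.sets_into_space[OF A] by (simp add: AE_iff_null_sets)
    then show ?thesis
      by auto
  qed
qed

section \<open>Recurrence and conservativeness\<close>

lemma bdd_int_Lp:
  assumes "1 \<le> p" "bdd_int u"
  shows "u \<in> Lp m p"
proof -
  obtain M where M: "0 \<le> M" "\<And>x. x \<in> space m \<Longrightarrow> \<bar>u x\<bar> \<le> M"
    using assms(2) bdd_bound[of u] by (auto simp: bdd_int_def)
  have [measurable]: "u \<in> borel_measurable m" and int: "integrable m u"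
    using assms(2) by (auto simp: bdd_int_def bdd_def)
  have "integrable m (\<lambda>x. \<bar>u x\<bar> powr p)"
  proof (rule Bochner_Integration.integrable_bound)
    show "integrable m (\<lambda>x. M powr (p - 1) * u x)"
      using int by simp
    show "AE x in m. norm (\<bar>u x\<bar> powr p) \<le> norm (M powr (p - 1) * u x)"
    proof (rule AE_I2)
      fix x assume x: "x \<in> space m"
      have "\<bar>u x\<bar> powr p = \<bar>u x\<bar> powr (p - 1) * \<bar>u x\<bar>"
        using powr_add[of "\<bar>u x\<bar>" "p - 1" 1] by simp
      also have "\<dots> \<le> M powr (p - 1) * \<bar>u x\<bar>"
        using M(2)[OF x] assms(1) by (intro mult_right_mono powr_mono2) auto
      finally show "norm (\<bar>u x\<bar> powr p) \<le> norm (M powr (p - 1) * u x)"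
        by (simp add: abs_mult)
    qed
  qed measurable
  then show ?thesis
    by (simp add: Lp_def)
qed

lemma bdd_imp_bdd_int:
  assumes "emeasure m (space m) < \<infinity>" "bdd u"
  shows "bdd_int u"
proof -
  interpret m: finite_measure m
    using assms(1) by (intro finite_measureI) auto
  obtain M where "\<And>x. x \<in> space m \<Longrightarrow> \<bar>u x\<bar> \<le> M"
    using bdd_bound[OF assms(2)] by blast
  then show ?thesis
    using assms(2) by (auto simp: bdd_int_def bdd_measurable intro!: m.integrable_const_bound[of _ M])
qed

text \<open>Exchanging \<alpha> and \<beta> in the resolvent equation only changes signs. For
  \<alpha> = \<beta> the equation degenerates to 0 = 0, but then there is nothing to prove.\<close>

lemma T_commute:
  assumes "0 < \<alpha>" "0 < \<beta>" "x \<in> space m" "bdd u"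
  shows "T \<alpha> (T \<beta> u) x = T \<beta> (T \<alpha> u) x"
proof (cases "\<alpha> = \<beta>")
  case False
  have "(\<beta> - \<alpha>) * T \<alpha> (T \<beta> u) x = (\<beta> - \<alpha>) * T \<beta> (T \<alpha> u) x"
    using resolvent_identity[OF assms] resolvent_identity[OF assms(2,1,3,4)]
    by (simp add: algebra_simps)
  then show ?thesis
    using False by simp
qed simp

text \<open>With w = 1 - T_\<alpha> 1 the resolvent equation gives (\<alpha> - \<beta>) T_\<beta> w
  = \<beta> (T_\<alpha> 1 - T_\<beta> 1) \<le> \<beta>. For 2 \<beta> \<le> \<alpha> this bounds
  U_\<beta> w by 2/\<alpha>; for larger \<beta> the trivial bound 1/\<beta> is already
  smaller.\<close>

lemma initial_kernel_defect_le:
  assumes "0 < \<alpha>" "x \<in> space m"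
  shows "initial_kernel U (\<lambda>y. ennreal (1 - T \<alpha> (\<lambda>_. 1) y)) x \<le> ennreal (2 / \<alpha>)"
  unfolding initial_kernel_def
proof (rule SUP_least)
  fix \<beta> :: real assume "\<beta> \<in> {0<..}"
  then have \<beta>: "0 < \<beta>"
    by simp
  define w where "w = (\<lambda>y. 1 - T \<alpha> (\<lambda>_. 1) y)"
  have bT: "bdd (T \<alpha> (\<lambda>_. 1))"
    using assms(1) by (intro bdd_T bdd_const)
  have w: "bdd w" "\<And>y. y \<in> space m \<Longrightarrow> 0 \<le> w y" "\<And>y. y \<in> space m \<Longrightarrow> w y \<le> 1"
    using T_const_le[OF assms(1), of _ 1] bT by (auto simp: w_def intro!: bdd_diff bdd_const)
  have "T \<beta> w x \<le> \<beta> * (2 / \<alpha>)"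
  proof (cases "2 * \<beta> \<le> \<alpha>")
    case True
    have "T \<beta> w x = T \<beta> (\<lambda>_. 1) x - T \<beta> (T \<alpha> (\<lambda>_. 1)) x"
      unfolding w_def using \<beta> assms(2) bT by (intro T_diff bdd_const)
    then have "(\<alpha> - \<beta>) * T \<beta> w x
        = (\<alpha> - \<beta>) * T \<beta> (\<lambda>_. 1) x - (\<alpha> - \<beta>) * T \<beta> (T \<alpha> (\<lambda>_. 1)) x"
      by (simp add: right_diff_distrib)
    also have "\<dots> = \<beta> * (T \<alpha> (\<lambda>_. 1) x - T \<beta> (\<lambda>_. 1) x)"
      unfolding resolvent_identity[OF \<beta> assms bdd_const[of 1]] by (simp add: algebra_simps)
    also have "\<dots> \<le> \<beta> * 1"
      using \<beta> T_const_le[OF assms, of 1] T_const_le[OF \<beta> assms(2), of 1]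
      by (intro mult_left_mono) auto
    finally have "(\<alpha> - \<beta>) * T \<beta> w x \<le> \<beta>"
      by simp
    moreover have "\<alpha> / 2 * T \<beta> w x \<le> (\<alpha> - \<beta>) * T \<beta> w x"
      using True T_nonneg[OF \<beta> assms(2) w(2)] by (intro mult_right_mono) auto
    ultimately have "\<alpha> / 2 * T \<beta> w x \<le> \<beta>"
      by linarith
    then show ?thesis
      using assms(1) by (simp add: field_simps)
  next
    case False
    have "T \<beta> w x \<le> T \<beta> (\<lambda>_. 1) x"
      using \<beta> assms(2) w by (intro T_mono bdd_const) auto
    also have "\<dots> \<le> 1"
      using T_const_le[OF \<beta> assms(2), of 1] by simp
    also have "\<dots> \<le> \<beta> * (2 / \<alpha>)"
      using False assms(1) by (simp add: field_simps)
    finally show ?thesis .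
  qed
  then have "ennreal (T \<beta> w x / \<beta>) \<le> ennreal (2 / \<alpha>)"
    using \<beta> by (intro ennreal_leI) (simp add: field_simps)
  then show "(\<integral>\<^sup>+y. ennreal (1 - T \<alpha> (\<lambda>_. 1) y) \<partial>U \<beta> x) \<le> ennreal (2 / \<alpha>)"
    using nn_integral_U_eq_T[OF \<beta> assms(2) w(1,2)] by (simp add: w_def)
qed

text \<open>The defect w is integrable because m is finite, and its potential is finite, so
  recurrence leaves only the value 0; every \<open>T \<beta> w\<close> lies below a multiple of
  it.\<close>

lemma recurrent_T_T_one:
  assumes "emeasure m (space m) < \<infinity>" "m_recurrent m U" "0 < \<alpha>" "0 < \<beta>"
  shows "AE x in m. T \<beta> (T \<alpha> (\<lambda>_. 1)) x = T \<beta> (\<lambda>_. 1) x"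
proof -
  define w where "w = (\<lambda>y. 1 - T \<alpha> (\<lambda>_. 1) y)"
  have bT: "bdd (T \<alpha> (\<lambda>_. 1))"
    using assms(3) by (intro bdd_T bdd_const)
  have w: "bdd w" "\<And>y. y \<in> space m \<Longrightarrow> 0 \<le> w y" "\<And>y. y \<in> space m \<Longrightarrow> w y \<le> 1"
    using T_const_le[OF assms(3), of _ 1] bT by (auto simp: w_def intro!: bdd_diff bdd_const)
  have [measurable]: "w \<in> borel_measurable m"
    using w(1) by (rule bdd_measurable)
  have "(\<integral>\<^sup>+x. ennreal (w x) \<partial>m) \<le> (\<integral>\<^sup>+x. ennreal 1 \<partial>m)"
    using w(3) by (intro nn_integral_mono ennreal_leI)
  also have "\<dots> < \<infinity>"
    using assms(1) by simp
  finally have "{x \<in> space m. 0 < initial_kernel U (\<lambda>x. ennreal (w x)) x \<and>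
      initial_kernel U (\<lambda>x. ennreal (w x)) x < \<infinity>} \<in> null_sets m"
    using assms(2)[unfolded m_recurrent_def, rule_format, of "\<lambda>x. ennreal (w x)"] by simp
  from AE_not_in[OF this] show ?thesis
    using AE_space
  proof eventually_elim
    case (elim x)
    have "initial_kernel U (\<lambda>x. ennreal (w x)) x < \<infinity>"
      using initial_kernel_defect_le[OF assms(3) elim(2)] by (auto simp: w_def intro: le_less_trans)
    then have "initial_kernel U (\<lambda>x. ennreal (w x)) x = 0"
      using elim by auto
    moreover have "(\<integral>\<^sup>+y. ennreal (w y) \<partial>U \<beta> x) \<le> initial_kernel U (\<lambda>x. ennreal (w x)) x"
      unfolding initial_kernel_def using assms(4) by (intro SUP_upper) auto
    ultimately have "ennreal (T \<beta> w x / \<beta>) = 0"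
      using nn_integral_U_eq_T[OF assms(4) elim(2) w(1,2)] by simp
    then have "T \<beta> w x \<le> 0"
      using assms(4) by (simp add: ennreal_eq_0_iff divide_le_0_iff)
    moreover have "0 \<le> T \<beta> w x"
      using assms(4) elim(2) w(2) by (rule T_nonneg)
    ultimately have "T \<beta> w x = 0"
      by simp
    then show ?case
      using T_diff[OF assms(4) elim(2) bdd_const bT, of 1] by (simp add: w_def)
  qed
qed

lemma recurrent_imp_conservative:
  assumes fin: "emeasure m (space m) < \<infinity>" and rec: "m_recurrent m U" and nv: "nonvanishing m U"
    and "1 \<le> p" "invariant_constant m p U" and \<beta>: "0 < \<beta>"
  shows "AE x in m. T \<beta> (\<lambda>_. 1) x = 1"
proof (cases "emeasure m (space m) = 0")
  case True
  then show ?thesis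
    by (intro AE_I'[of "space m"]) (auto simp: null_sets_def)
next
  case False
  interpret m: finite_measure m
    using fin by (intro finite_measureI) auto
  define h where "h = T 1 (\<lambda>_. 1)"
  have bh: "bdd h"
    unfolding h_def by (intro bdd_T bdd_const) simp
  have h_eq: "AE x in m. T \<beta> (\<lambda>_. 1) x = h x" and h_inv: "AE x in m. T \<beta> h x = h x"
    if \<beta>: "0 < \<beta>" for \<beta>
  proof -
    \<comment> \<open>\<open>recurrent_T_T_one\<close> is used with the roles of 1 and \<beta>
      exchanged, and the two compositions agree by \<open>T_commute\<close>.\<close>
    have "AE x in m. T \<beta> h x = T \<beta> (\<lambda>_. 1) x \<and> T \<beta> h x = h x"
      using recurrent_T_T_one[OF fin rec zero_less_one \<beta>] recurrent_T_T_one[OF fin rec \<beta> zero_less_one]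
        AE_space
      by eventually_elim (use T_commute[OF zero_less_one \<beta> _ bdd_const, of _ 1] in \<open>simp add: h_def\<close>)
    then show "AE x in m. T \<beta> (\<lambda>_. 1) x = h x" "AE x in m. T \<beta> h x = h x"
      by (eventually_elim, simp)+
  qed
  have "h \<in> Lp m p"
    using assms(4) fin bh by (intro bdd_int_Lp bdd_imp_bdd_int)
  then obtain c where c: "AE x in m. h x = c"
    using assms(5) h_inv unfolding invariant_constant_def by blast
  \<comment> \<open>Applying \<open>T \<beta>\<close> to the constant h = c gives c times
    \<open>T \<beta> (\<lambda>_. 1)\<close>, which is again h = c.\<close>
  have "AE x in m. c * c = c"
    using T_cong_AE[OF \<beta> bdd_measurable[OF bh] borel_measurable_const c] h_eq[OF \<beta>] h_inv[OF \<beta>] c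
  proof eventually_elim
    case (elim x)
    have "c = T \<beta> (\<lambda>_. c * 1) x"
      using elim by simp
    also have "\<dots> = c * T \<beta> (\<lambda>_. 1) x"
      by (rule T_cmult)
    finally show ?case
      using elim by simp
  qed
  \<comment> \<open>An a.e. statement about the number c yields the statement itself only for a
    nonzero measure.\<close>
  moreover have nontrivial: "\<not> (AE x in m. False)"
  proof
    assume "AE x in m. False"
    then have "ae_filter m = bot"
      by (simp add: trivial_limit_def)
    then show False
      using False by (simp add: ae_filter_eq_bot_iff)
  qed
  ultimately have "c * c = c"
    by auto
  then consider "c = 0" | "c = 1"
    by auto
  then show ?thesis
  proof cases
    case 1
    \<comment> \<open>If c were 0, every U_\<alpha> 1 would vanish a.e., which
      \<open>nonvanishing\<close> allows only for the zero measure.\<close>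
    have "AE x in m. True \<longrightarrow> initial_kernel U (\<lambda>_. 1) x = 0"
    proof (rule AE_initial_kernel_eq_0)
      fix \<alpha> :: real assume \<alpha>: "0 < \<alpha>"
      show "AE x in m. True \<longrightarrow> (\<integral>\<^sup>+y. 1 \<partial>U \<alpha> x) = 0"
        using h_eq[OF \<alpha>] c AE_space
      proof eventually_elim
        case (elim x)
        then show ?case
          using 1 nn_integral_U_eq_T[OF \<alpha> _ bdd_const, of x 1] by simp
      qed
    qed simp
    then have "emeasure m (space m) = 0"
      using nv by (simp add: nonvanishing_def)
    then show ?thesis
      using False by simp
  next
    case 2
    show ?thesis
      using h_eq[OF \<beta>] c by eventually_elim (simp add: 2)
  qed
qed

text \<open>For nonnegative v + M contractivity in L^1 is an inequality of integrals. Since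
  \<open>T \<beta>\<close> fixes the constant M a.e., M cancels; the argument for -u reverses the
  inequality.\<close>

lemma conservative_integral_T:
  assumes fin: "emeasure m (space m) < \<infinity>" and "0 < \<beta>"
    and cons: "AE x in m. T \<beta> (\<lambda>_. 1) x = 1" and "bdd u"
  shows "(\<integral>x. T \<beta> u x \<partial>m) = (\<integral>x. u x \<partial>m)"
proof -
  interpret m: finite_measure m
    using fin by (intro finite_measureI) auto
  have int_bdd: "integrable m v" if "bdd v" for v
    using bdd_imp_bdd_int[OF fin that] by (simp add: bdd_int_def)
  have le: "(\<integral>x. T \<beta> v x \<partial>m) \<le> (\<integral>x. v x \<partial>m)" if v: "bdd v" for v
  proof -
    obtain M where M: "0 \<le> M" "\<And>x. x \<in> space m \<Longrightarrow> \<bar>v x\<bar> \<le> M"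
      using bdd_bound[OF v] by blast
    define w where "w = (\<lambda>x. v x + M)"
    have w: "bdd w" "\<And>x. x \<in> space m \<Longrightarrow> 0 \<le> w x"
      using M(2) v by (auto simp: w_def intro!: bdd_add bdd_const) (smt (verit))
    have "AE x in m. \<bar>T \<beta> w x\<bar> = T \<beta> v x + M"
      using cons AE_space
    proof eventually_elim
      case (elim x)
      have "T \<beta> w x = T \<beta> v x + T \<beta> (\<lambda>_. M * 1) x"
        using v assms(2) elim(2) by (simp add: w_def T_add bdd_const)
      also have "\<dots> = T \<beta> v x + M"
        unfolding T_cmult using elim(1) by simp
      finally have "T \<beta> w x = T \<beta> v x + M" .
      moreover have "0 \<le> T \<beta> w x"
        using assms(2) elim(2) w(2) by (rule T_nonneg)
      ultimately show ?case
        by simp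
    qed
    then have "(\<integral>x. \<bar>T \<beta> w x\<bar> \<partial>m) = (\<integral>x. T \<beta> v x + M \<partial>m)"
      using v w assms(2) by (intro integral_cong_AE) (auto intro!: bdd_measurable bdd_T bdd_add bdd_const borel_measurable_abs)
    also have "\<dots> = (\<integral>x. T \<beta> v x \<partial>m) + (\<integral>x. M \<partial>m)"
      using v assms(2) by (intro Bochner_Integration.integral_add int_bdd bdd_T bdd_const) auto
    finally have "(\<integral>x. T \<beta> v x \<partial>m) + (\<integral>x. M \<partial>m) \<le> (\<integral>x. \<bar>w x\<bar> \<partial>m)"
      using integral_abs_T_le[OF assms(2) int_bdd[OF w(1)]] by simp
    also have "(\<integral>x. \<bar>w x\<bar> \<partial>m) = (\<integral>x. v x + M \<partial>m)"
      using w(2) by (intro Bochner_Integration.integral_cong) (auto simp: w_def)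
    also have "\<dots> = (\<integral>x. v x \<partial>m) + (\<integral>x. M \<partial>m)"
      using v by (intro Bochner_Integration.integral_add int_bdd bdd_const) auto
    finally show ?thesis
      by simp
  qed
  have "(\<integral>x. T \<beta> (\<lambda>x. -1 * u x) x \<partial>m) \<le> (\<integral>x. -1 * u x \<partial>m)"
    using assms(4) by (intro le bdd_cmult)
  then have "(\<integral>x. u x \<partial>m) \<le> (\<integral>x. T \<beta> u x \<partial>m)"
    unfolding T_cmult by simp
  then show ?thesis
    using le[OF assms(4)] by simp
qed

section \<open>Convergence to the mean\<close>

text \<open>It remains to identify the constant limit g. On an infinite space 0 is the only
  integrable constant; on a finite one g has the same integral as u.\<close>

lemma mean_ergodic_limit:
  assumes p: "1 < p" and ic: "invariant_constant m p U" and u: "bdd_int u"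
    and dich: "emeasure m (space m) = \<infinity> \<or>
      emeasure m (space m) < \<infinity> \<and> (\<forall>\<beta>>0. AE x in m. T \<beta> (\<lambda>_. 1) x = 1)"
  shows "((\<lambda>\<alpha>. \<integral>x. (T \<alpha> u x - mean_const m u)\<^sup>2 \<partial>m) \<longlongrightarrow> 0) (at_right 0)"
proof -
  obtain g where g: "bdd_int g" "\<And>\<beta>. 0 < \<beta> \<Longrightarrow> AE x in m. T \<beta> g x = g x"
    "((\<lambda>\<alpha>. sqnorm (\<lambda>x. T \<alpha> u x - g x)) \<longlongrightarrow> 0) (at_right 0)"
    using mean_ergodic[OF u] by blast
  have [measurable]: "g \<in> borel_measurable m" and int_g: "integrable m g"
    using g(1) by (auto simp: bdd_int_def bdd_def)
  have meas_T: "T \<alpha> u \<in> borel_measurable m" if "0 < \<alpha>" for \<alpha>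
    using that u by (auto simp: bdd_int_def intro: T_measurable bdd_measurable)
  have "g \<in> Lp m p"
    using p g(1) by (intro bdd_int_Lp) auto
  then obtain c where c: "AE x in m. g x = c"
    using ic g(2) unfolding invariant_constant_def by blast
  have g_mean: "AE x in m. g x = mean_const m u"
    using dich
  proof
    assume inf: "emeasure m (space m) = \<infinity>"
    have "integrable m (\<lambda>x. c)"
      using int_g c by (subst integrable_cong_AE[of _ _ g]) (auto elim: eventually_mono)
    then have "c = 0"
      using inf by (auto simp: integrable_iff_bounded ennreal_mult_top split: if_splits)
    then show ?thesis
      using c inf by (simp add: mean_const_def)
  next
    assume fin: "emeasure m (space m) < \<infinity> \<and> (\<forall>\<beta>>0. AE x in m. T \<beta> (\<lambda>_. 1) x = 1)"
    interpret m: finite_measure m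
      using fin by (intro finite_measureI) auto
    define D where "D = (\<integral>x. u x \<partial>m) - (\<integral>x. g x \<partial>m)"
    \<comment> \<open>\<open>T \<alpha>\<close> preserves the integral, so D does not depend on
      \<alpha>, while the right-hand side tends to 0.\<close>
    have "D\<^sup>2 \<le> measure m (space m) * sqnorm (\<lambda>x. T \<alpha> u x - g x)" if \<alpha>: "0 < \<alpha>" for \<alpha>
    proof -
      have diff: "bdd_int (\<lambda>x. T \<alpha> u x - g x)"
        using \<alpha> u g(1) by (intro bdd_int_diff bdd_int_T)
      have "(\<integral>x. T \<alpha> u x - g x \<partial>m) = D"
        using conservative_integral_T[of \<alpha> u] fin \<alpha> u int_g bdd_int_T[OF \<alpha> u]
        by (simp add: D_def bdd_int_def)
      then show ?thesis
        using m.integral_power2_le[of "\<lambda>x. T \<alpha> u x - g x"] diff integrable_power2[OF diff]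
        by (simp add: bdd_int_def sqnorm_def)
    qed
    then have ev: "eventually (\<lambda>\<alpha>. D\<^sup>2 \<le> measure m (space m) * sqnorm (\<lambda>x. T \<alpha> u x - g x)) (at_right 0)"
      by (intro eventually_at_rightI[of 0 1]) auto
    have "((\<lambda>\<alpha>. measure m (space m) * sqnorm (\<lambda>x. T \<alpha> u x - g x)) \<longlongrightarrow> 0) (at_right 0)"
      using g(3) by (rule tendsto_mult_right_zero)
    from tendsto_lowerbound[OF this ev] have "D = 0"
      by simp
    moreover have "(\<integral>x. g x \<partial>m) = c * measure m (space m)"
      using c by (subst integral_cong_AE[of _ _ "\<lambda>_. c"]) auto
    ultimately have u_c: "(\<integral>x. u x \<partial>m) = c * measure m (space m)"
      by (simp add: D_def)
    show ?thesis
    \<comment> \<open>For the zero measure \<open>mean_const\<close> is 0 by the convention on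
      division, and need not be c; a.e. equalities are then vacuous.\<close>
    proof (cases "measure m (space m) = 0")
      case True
      then show ?thesis
        by (intro AE_I'[of "space m"]) (auto simp: null_sets_def m.emeasure_eq_measure)
    next
      case False
      then have "mean_const m u = c"
        using fin u_c by (simp add: mean_const_def)
      then show ?thesis
        using c by simp
    qed
  qed
  have "(\<integral>x. (T \<alpha> u x - mean_const m u)\<^sup>2 \<partial>m) = sqnorm (\<lambda>x. T \<alpha> u x - g x)" if \<alpha>: "0 < \<alpha>" for \<alpha>
    unfolding sqnorm_def
  proof (rule integral_cong_AE)
    show "AE x in m. (T \<alpha> u x - mean_const m u)\<^sup>2 = (T \<alpha> u x - g x)\<^sup>2"
      using g_mean by eventually_elim simp
  qed (use meas_T[OF \<alpha>] in measurable)
  then have "eventually (\<lambda>\<alpha>. sqnorm (\<lambda>x. T \<alpha> u x - g x)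
      = (\<integral>x. (T \<alpha> u x - mean_const m u)\<^sup>2 \<partial>m)) (at_right 0)"
    by (intro eventually_at_rightI[of 0 1]) auto
  then show ?thesis
    using g(3) by (rule Lim_transform_eventually[rotated])
qed

lemma mean_ergodic_limit_Lp:
  assumes p: "1 < p" and ic: "invariant_constant m p U" and u: "bdd_int u"
    and dich: "emeasure m (space m) = \<infinity> \<or>
      emeasure m (space m) < \<infinity> \<and> (\<forall>\<beta>>0. AE x in m. T \<beta> (\<lambda>_. 1) x = 1)"
  shows "((\<lambda>\<alpha>. \<integral>x. \<bar>T \<alpha> u x - mean_const m u\<bar> powr p \<partial>m) \<longlongrightarrow> 0) (at_right 0)"
proof -
  obtain M where M: "0 \<le> M" "\<And>x. x \<in> space m \<Longrightarrow> \<bar>u x\<bar> \<le> M"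
    using u bdd_bound[of u] by (auto simp: bdd_int_def)
  have iu: "integrable m u" and mu: "u \<in> borel_measurable m"
    using u by (auto simp: bdd_int_def bdd_def)
  define c where "c = mean_const m u"
  have ic: "integrable m (\<lambda>x. c)"
    unfolding c_def by (rule mean_const_integrable)
  have "integrable m (\<lambda>x. T \<alpha> u x - c) \<and> (\<forall>x\<in>space m. \<bar>T \<alpha> u x - c\<bar> \<le> M + \<bar>c\<bar>) \<and>
      (\<integral>x. \<bar>T \<alpha> u x - c\<bar> \<partial>m) \<le> (\<integral>x. \<bar>u x\<bar> \<partial>m) + (\<integral>x. \<bar>c\<bar> \<partial>m)" if \<alpha>: "0 < \<alpha>" for \<alpha>
  proof (intro conjI ballI)
    have iT: "integrable m (T \<alpha> u)"
      using \<alpha> iu by (rule integrable_T)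
    then show "integrable m (\<lambda>x. T \<alpha> u x - c)"
      using ic by auto
    show "\<bar>T \<alpha> u x - c\<bar> \<le> M + \<bar>c\<bar>" if "x \<in> space m" for x
      using T_bound[OF \<alpha> that mu M(2)] by linarith
    have "(\<integral>x. \<bar>T \<alpha> u x - c\<bar> \<partial>m) \<le> (\<integral>x. \<bar>T \<alpha> u x\<bar> + \<bar>c\<bar> \<partial>m)"
      using iT ic by (intro integral_mono) (auto intro: abs_triangle_ineq4)
    also have "\<dots> = (\<integral>x. \<bar>T \<alpha> u x\<bar> \<partial>m) + (\<integral>x. \<bar>c\<bar> \<partial>m)"
      using iT ic by (intro Bochner_Integration.integral_add integrable_abs)
    also have "\<dots> \<le> (\<integral>x. \<bar>u x\<bar> \<partial>m) + (\<integral>x. \<bar>c\<bar> \<partial>m)"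
      using integral_abs_T_le[OF \<alpha> iu] by simp
    finally show "(\<integral>x. \<bar>T \<alpha> u x - c\<bar> \<partial>m) \<le> (\<integral>x. \<bar>u x\<bar> \<partial>m) + (\<integral>x. \<bar>c\<bar> \<partial>m)" .
  qed
  then have "eventually (\<lambda>\<alpha>. integrable m (\<lambda>x. T \<alpha> u x - mean_const m u) \<and>
      (\<forall>x\<in>space m. \<bar>T \<alpha> u x - mean_const m u\<bar> \<le> M + \<bar>c\<bar>) \<and>
      (\<integral>x. \<bar>T \<alpha> u x - mean_const m u\<bar> \<partial>m) \<le> (\<integral>x. \<bar>u x\<bar> \<partial>m) + (\<integral>x. \<bar>c\<bar> \<partial>m)) (at_right 0)"
    unfolding c_def by (intro eventually_at_rightI[of 0 1]) auto
  then show ?thesis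
    by (rule Lp_tendsto_zero_of_L2[OF p _ mean_ergodic_limit[OF assms]])
qed

text \<open>The constants have to converge along with the functions. On a finite space this follows
  from the inclusion of L^p in L^1; on an infinite one all of them are 0.\<close>

lemma bdd_int_approximation:
  assumes p: "1 \<le> p" and u: "u \<in> Lp m p"
  obtains v where "\<And>n. bdd_int (v n)" "\<And>n. integrable m (\<lambda>x. \<bar>u x - v n x\<bar> powr p)"
    "(\<lambda>n. \<integral>x. \<bar>u x - v n x\<bar> powr p \<partial>m) \<longlonglongrightarrow> 0" "(\<lambda>n. mean_const m (v n)) \<longlonglongrightarrow> mean_const m u"
proof -
  have [measurable]: "u \<in> borel_measurable m" and int: "integrable m (\<lambda>x. \<bar>u x\<bar> powr p)"
    using u by (auto simp: Lp_def)
  obtain A :: "nat \<Rightarrow> 'a set" where A: "range A \<subseteq> sets m" "(\<Union>i. A i) = space m"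
    "\<And>i. emeasure m (A i) \<noteq> \<infinity>" "incseq A"
    using sigma_finite_incseq by blast
  have [measurable]: "A n \<in> sets m" for n
    using A(1) by auto
  \<comment> \<open>Cutting to 0 rather than clamping makes u - v equal to 0 or u, so |u| dominates
    at once. The sets \<open>A n\<close> of finite measure make v integrable.\<close>
  define v where "v n x = (if x \<in> A n \<and> \<bar>u x\<bar> \<le> real n then u x else 0)" for n x
  have [measurable]: "v n \<in> borel_measurable m" for n
    unfolding v_def by measurable
  have v_eq: "eventually (\<lambda>n. v n x = u x) sequentially" if x: "x \<in> space m" for x
  proof -
    obtain i where i: "x \<in> A i"
      using A(2) x by auto
    obtain k where k: "\<bar>u x\<bar> \<le> real k"
      using real_arch_simple by blast
    have "v n x = u x" if "max i k \<le> n" for n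
    proof -
      have "A i \<subseteq> A n"
        using A(4) that by (auto simp: incseq_def)
      then show ?thesis
        using i k that by (auto simp: v_def)
    qed
    then show ?thesis
      unfolding eventually_sequentially by (intro exI[of _ "max i k"]) blast
  qed
  have lim: "(\<lambda>n. v n x) \<longlonglongrightarrow> u x" if "x \<in> space m" for x
    using v_eq[OF that] by (rule tendsto_eventually)
  have v_int: "bdd_int (v n)" for n
  proof -
    have "integrable m (\<lambda>x. real n * indicator (A n) x)"
      using A(3) by (intro integrable_mult_right integrable_real_indicator) (auto simp: less_top)
    then have "integrable m (v n)"
      by (rule Bochner_Integration.integrable_bound) (auto simp: v_def indicator_def)
    moreover have "bdd (v n)"
      by (rule bddI[of _ "real n"]) (auto simp: v_def)
    ultimately show ?thesis
      by (simp add: bdd_int_def)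
  qed
  have bound: "\<bar>u x - v n x\<bar> powr p \<le> \<bar>u x\<bar> powr p" for n x
    by (auto simp: v_def)
  have dom: "integrable m (\<lambda>x. \<bar>u x - v n x\<bar> powr p)" for n
    using int by (rule Bochner_Integration.integrable_bound) (use bound in auto)
  have "(\<lambda>n. \<integral>x. \<bar>u x - v n x\<bar> powr p \<partial>m) \<longlonglongrightarrow> (\<integral>x. 0 \<partial>m)"
  proof (rule integral_dominated_convergence[OF _ _ int])
    show "AE x in m. (\<lambda>n. \<bar>u x - v n x\<bar> powr p) \<longlonglongrightarrow> 0"
    proof (rule AE_I2)
      fix x assume "x \<in> space m"
      then have "eventually (\<lambda>n. \<bar>u x - v n x\<bar> powr p = 0) sequentially"
        by (rule eventually_mono[OF v_eq]) simp
      then show "(\<lambda>n. \<bar>u x - v n x\<bar> powr p) \<longlonglongrightarrow> 0"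
        by (rule tendsto_eventually)
    qed
  qed (use bound in auto)
  then have conv: "(\<lambda>n. \<integral>x. \<bar>u x - v n x\<bar> powr p \<partial>m) \<longlonglongrightarrow> 0"
    by simp
  have "(\<lambda>n. mean_const m (v n)) \<longlonglongrightarrow> mean_const m u"
  proof (cases "emeasure m (space m) < \<infinity>")
    case True
    interpret m: finite_measure m
      using True by (intro finite_measureI) auto
    have iu: "integrable m (\<lambda>x. \<bar>u x\<bar>)"
      using m.integrable_of_powr[OF p _ int] by auto
    have "(\<lambda>n. \<integral>x. v n x \<partial>m) \<longlonglongrightarrow> (\<integral>x. u x \<partial>m)"
      by (rule integral_dominated_convergence[OF _ _ iu]) (use lim in \<open>auto simp: v_def\<close>)
    then have "(\<lambda>n. 1 / measure m (space m) * (\<integral>x. v n x \<partial>m))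
        \<longlonglongrightarrow> 1 / measure m (space m) * (\<integral>x. u x \<partial>m)"
      by (rule tendsto_mult_left)
    then show ?thesis
      using True by (simp add: mean_const_def)
  qed (simp add: mean_const_def)
  then show thesis
    using v_int dom conv that by blast
qed

theorem invariant_constant_imp_Lp_ergodic:
  assumes p: "1 < p" and ic: "invariant_constant m p U"
    and dich: "emeasure m (space m) = \<infinity> \<or>
      emeasure m (space m) < \<infinity> \<and> (\<forall>\<beta>>0. AE x in m. T \<beta> (\<lambda>_. 1) x = 1)"
  shows "Lp_ergodic m p U"
  unfolding Lp_ergodic_def
proof (intro ballI)
  fix u assume u: "u \<in> Lp m p"
  have p1: "1 \<le> p" "0 \<le> p"
    using p by auto
  have [measurable]: "u \<in> borel_measurable m" and int: "integrable m (\<lambda>x. \<bar>u x\<bar> powr p)"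
    using u by (auto simp: Lp_def)
  obtain v where v: "\<And>n. bdd_int (v n)" "\<And>n. integrable m (\<lambda>x. \<bar>u x - v n x\<bar> powr p)"
    "(\<lambda>n. \<integral>x. \<bar>u x - v n x\<bar> powr p \<partial>m) \<longlonglongrightarrow> 0" "(\<lambda>n. mean_const m (v n)) \<longlonglongrightarrow> mean_const m u"
    using bdd_int_approximation[OF p1(1) u] by blast
  have v_bdd: "bdd (v n)" and [measurable]: "v n \<in> borel_measurable m" for n
    using v(1)[of n] by (auto simp: bdd_int_def bdd_measurable)
  define c where "c = mean_const m u"
  define d where "d n = mean_const m (v n)" for n
  \<comment> \<open>Three summands need \<open>abs_add_powr_le\<close> twice; the summand split off
    first only gets the factor \<open>2 powr p \<le> k\<close>.\<close>
  define k where "k = 2 powr p * 2 powr p"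
  have k: "0 < k" "2 powr p \<le> k"
    using p by (auto simp: k_def ge_one_powr_ge_zero)
  have dc: "(\<lambda>n. \<integral>x. \<bar>d n - c\<bar> powr p \<partial>m) \<longlonglongrightarrow> 0"
  proof (cases "emeasure m (space m) < \<infinity>")
    case True
    have "(\<lambda>n. \<bar>d n - c\<bar>) \<longlonglongrightarrow> 0"
      using v(4) by (simp add: d_def c_def tendsto_rabs_zero_iff LIM_zero_iff)
    then have "(\<lambda>n. \<bar>d n - c\<bar> powr p) \<longlonglongrightarrow> 0"
      by (rule tendsto_zero_powrI[OF _ tendsto_const]) (use p in auto)
    then have "(\<lambda>n. \<bar>d n - c\<bar> powr p * measure m (space m)) \<longlonglongrightarrow> 0"
      by (rule tendsto_mult_left_zero)
    then show ?thesis
      by (simp add: mult.commute)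
  next
    case False
    then show ?thesis
      using p by (simp add: d_def c_def mean_const_def)
  qed
  \<comment> \<open>Here \<open>T \<alpha> u - c\<close> is split into
    \<open>T \<alpha> (u - v n)\<close>, \<open>d n - c\<close> and
    \<open>T \<alpha> (v n) - d n\<close>. Contractivity makes the first two bounds independent of
    \<alpha>, so n can be fixed before \<alpha> tends to 0.\<close>
  have le: "(\<integral>x. \<bar>T \<alpha> u x - c\<bar> powr p \<partial>m)
      \<le> k * ((\<integral>x. \<bar>u x - v n x\<bar> powr p \<partial>m) + (\<integral>x. \<bar>d n - c\<bar> powr p \<partial>m)
        + (\<integral>x. \<bar>T \<alpha> (v n) x - d n\<bar> powr p \<partial>m))" if \<alpha>: "0 < \<alpha>" for \<alpha> n
  proof -
    define w where "w = (\<lambda>x. u x - v n x)"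
    have w: "w \<in> borel_measurable m" "integrable m (\<lambda>x. \<bar>w x\<bar> powr p)"
      unfolding w_def using v(2) by auto
    have [measurable]: "T \<alpha> u \<in> borel_measurable m" "T \<alpha> w \<in> borel_measurable m" "T \<alpha> (v n) \<in> borel_measurable m"
      using \<alpha> w by (auto intro: T_measurable)
    have iw: "integrable m (\<lambda>x. \<bar>T \<alpha> w x\<bar> powr p)"
      using p1(1) \<alpha> w by (rule integrable_T_powr)
    have id: "integrable m (\<lambda>x. \<bar>d n - c\<bar> powr p)"
      unfolding d_def c_def using p1 mean_const_integrable_powr by (intro integrable_powr_diff) auto
    have "v n \<in> Lp m p"
      using p1(1) v(1) by (rule bdd_int_Lp)
    then have iv: "integrable m (\<lambda>x. \<bar>T \<alpha> (v n) x - d n\<bar> powr p)"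
      unfolding d_def using p1 \<alpha> mean_const_integrable_powr
      by (intro integrable_powr_diff integrable_T_powr) (auto simp: Lp_def)
    have "(\<integral>x. \<bar>T \<alpha> u x - c\<bar> powr p \<partial>m) \<le>
        (\<integral>x. k * (\<bar>T \<alpha> w x\<bar> powr p + \<bar>d n - c\<bar> powr p + \<bar>T \<alpha> (v n) x - d n\<bar> powr p) \<partial>m)"
    proof (rule integral_mono_AE)
      show "integrable m (\<lambda>x. \<bar>T \<alpha> u x - c\<bar> powr p)"
        unfolding c_def using p1 \<alpha> int mean_const_integrable_powr
        by (intro integrable_powr_diff integrable_T_powr) auto
      show "AE x in m. \<bar>T \<alpha> u x - c\<bar> powr p
          \<le> k * (\<bar>T \<alpha> w x\<bar> powr p + \<bar>d n - c\<bar> powr p + \<bar>T \<alpha> (v n) x - d n\<bar> powr p)"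
        using AE_integrable_U[OF p1(1) \<alpha> u] AE_space
      proof eventually_elim
        case (elim x)
        have Tw: "T \<alpha> w x = T \<alpha> u x - T \<alpha> (v n) x"
          using elim(1) integrable_U[OF \<alpha> elim(2) v_bdd]
          by (simp add: w_def resolvent_op_def right_diff_distrib)
        define P Q R where "P = \<bar>T \<alpha> w x\<bar> powr p" and "Q = \<bar>d n - c\<bar> powr p"
          and "R = \<bar>T \<alpha> (v n) x - d n\<bar> powr p"
        have "\<bar>T \<alpha> u x - c\<bar> powr p = \<bar>T \<alpha> w x + ((d n - c) + (T \<alpha> (v n) x - d n))\<bar> powr p"
          by (simp add: Tw)
        also have "\<dots> \<le> 2 powr p * (P + \<bar>(d n - c) + (T \<alpha> (v n) x - d n)\<bar> powr p)"
          unfolding P_def using p1(2) by (rule abs_add_powr_le)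
        also have "\<dots> \<le> 2 powr p * (P + 2 powr p * (Q + R))"
          unfolding Q_def R_def using p1(2) by (intro mult_left_mono add_left_mono abs_add_powr_le) auto
        also have "\<dots> = 2 powr p * P + k * (Q + R)"
          by (simp add: k_def algebra_simps)
        also have "\<dots> \<le> k * P + k * (Q + R)"
          using k by (intro add_right_mono mult_right_mono) (auto simp: P_def)
        also have "\<dots> = k * (P + Q + R)"
          by (simp add: algebra_simps)
        finally show ?case
          by (simp add: P_def Q_def R_def)
      qed
    qed (use iw id iv in auto)
    also have "\<dots> = k * ((\<integral>x. \<bar>T \<alpha> w x\<bar> powr p \<partial>m) + (\<integral>x. \<bar>d n - c\<bar> powr p \<partial>m)
        + (\<integral>x. \<bar>T \<alpha> (v n) x - d n\<bar> powr p \<partial>m))"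
      using iw id iv by simp
    also have "\<dots> \<le> k * ((\<integral>x. \<bar>w x\<bar> powr p \<partial>m) + (\<integral>x. \<bar>d n - c\<bar> powr p \<partial>m)
        + (\<integral>x. \<bar>T \<alpha> (v n) x - d n\<bar> powr p \<partial>m))"
      using k integral_T_powr_le[OF p1(1) \<alpha> w] by (intro mult_left_mono add_right_mono) auto
    finally show ?thesis
      by (simp add: w_def)
  qed
  have "((\<lambda>\<alpha>. \<integral>x. \<bar>T \<alpha> u x - c\<bar> powr p \<partial>m) \<longlongrightarrow> 0) (at_right 0)"
  proof (rule order_tendstoI)
    fix e :: real assume e: "0 < e"
    have "(\<lambda>n. (\<integral>x. \<bar>u x - v n x\<bar> powr p \<partial>m) + (\<integral>x. \<bar>d n - c\<bar> powr p \<partial>m)) \<longlonglongrightarrow> 0 + 0"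
      using v(3) dc by (rule tendsto_add)
    then have "eventually (\<lambda>n. (\<integral>x. \<bar>u x - v n x\<bar> powr p \<partial>m) + (\<integral>x. \<bar>d n - c\<bar> powr p \<partial>m) < e / (2 * k)) sequentially"
      using e k by (intro order_tendstoD) auto
    then obtain n where n: "(\<integral>x. \<bar>u x - v n x\<bar> powr p \<partial>m) + (\<integral>x. \<bar>d n - c\<bar> powr p \<partial>m) < e / (2 * k)"
      using eventually_happens by fastforce
    have "eventually (\<lambda>\<alpha>. (\<integral>x. \<bar>T \<alpha> (v n) x - d n\<bar> powr p \<partial>m) < e / (2 * k)) (at_right 0)"
      using mean_ergodic_limit_Lp[OF p ic v(1)[of n] dich] e k
      unfolding d_def by (intro order_tendstoD) auto
    moreover have "eventually (\<lambda>\<alpha>. (0::real) < \<alpha>) (at_right 0)"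
      by (intro eventually_at_rightI[of 0 1]) auto
    ultimately show "eventually (\<lambda>\<alpha>. (\<integral>x. \<bar>T \<alpha> u x - c\<bar> powr p \<partial>m) < e) (at_right 0)"
    proof eventually_elim
      case (elim \<alpha>)
      have "(\<integral>x. \<bar>T \<alpha> u x - c\<bar> powr p \<partial>m)
          \<le> k * ((\<integral>x. \<bar>u x - v n x\<bar> powr p \<partial>m) + (\<integral>x. \<bar>d n - c\<bar> powr p \<partial>m)
            + (\<integral>x. \<bar>T \<alpha> (v n) x - d n\<bar> powr p \<partial>m))"
        using elim(2) by (rule le)
      also have "\<dots> < k * (e / (2 * k) + e / (2 * k))"
        using n elim(1) k(1) by (intro mult_strict_left_mono add_strict_mono)
      also have "\<dots> = e"
        using k(1) by simp
      finally show ?case .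
    qed
  qed (auto intro!: always_eventually intro: less_le_trans)
  then show "((\<lambda>\<alpha>. Lp_norm m p (\<lambda>x. T \<alpha> u x - mean_const m u)) \<longlongrightarrow> 0) (at_right 0)"
    using p by (subst Lp_norm_tendsto_zero_iff) (auto simp: c_def)
qed

end

theorem proposition3p5:
  fixes m :: "'a measure" and U :: "real \<Rightarrow> 'a \<Rightarrow> 'a measure" and p :: real
  assumes "lusin_measurable_space m"
    and "sub_markovian_resolvent m U"
    and "sigma_finite_measure m"
    and "sub_invariant m U"
    and "nonvanishing m U"
    and "1 < p"
  shows "(m_irreducible m U \<and> m_recurrent m U \<longrightarrow> Lp_ergodic m p U) \<and>
    (Lp_ergodic m p U \<longrightarrow> invariant_constant m p U) \<and>
    (emeasure m (space m) = \<infinity> \<longrightarrow> (invariant_constant m p U \<longleftrightarrow> Lp_ergodic m p U)) \<and>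
    (emeasure m (space m) < \<infinity> \<longrightarrow>
       (m_irreducible m U \<and> m_recurrent m U \<longleftrightarrow> Lp_ergodic m p U)) \<and>
    (emeasure m (space m) < \<infinity> \<and> m_recurrent m U \<longrightarrow>
       (m_irreducible m U \<and> m_recurrent m U \<longleftrightarrow> invariant_constant m p U) \<and>
       (invariant_constant m p U \<longleftrightarrow> Lp_ergodic m p U))"
proof -
  interpret sigma_finite_measure m
    by fact
  interpret sub_invariant_resolvent m U
    by unfold_locales fact+
  have p: "1 \<le> p"
    using assms(6) by simp
  have irr: "m_irreducible m U \<Longrightarrow> invariant_constant m p U"
    using irreducible_imp_invariant_constant[OF p] .
  have erg: "Lp_ergodic m p U \<Longrightarrow> invariant_constant m p U"
    using Lp_ergodic_imp_invariant_constant[OF p] .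
  have inf: "emeasure m (space m) = \<infinity> \<Longrightarrow> invariant_constant m p U \<Longrightarrow> Lp_ergodic m p U"
    using invariant_constant_imp_Lp_ergodic[OF assms(6)] by blast
  \<comment> \<open>Conservativeness, which the convergence theorem asks for on a finite space,
    comes from recurrence together with \<open>nonvanishing\<close>.\<close>
  have fin: "emeasure m (space m) < \<infinity> \<Longrightarrow> m_recurrent m U \<Longrightarrow> invariant_constant m p U \<Longrightarrow> Lp_ergodic m p U"
    using invariant_constant_imp_Lp_ergodic[OF assms(6)] recurrent_imp_conservative[OF _ _ assms(5) p]
    by blast
  have fin_erg: "emeasure m (space m) < \<infinity> \<Longrightarrow> Lp_ergodic m p U \<Longrightarrow> m_irreducible m U \<and> m_recurrent m U"
    using Lp_ergodic_imp_irreducible[OF p] Lp_ergodic_imp_recurrent[OF p] by blast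
  \<comment> \<open>The implication from (i) to (iii) passes through (ii), by \<open>irr\<close>,
    and then uses \<open>inf\<close> or \<open>fin\<close> according to this alternative.\<close>
  have "emeasure m (space m) = \<infinity> \<or> emeasure m (space m) < \<infinity>"
    by (metis infinity_ennreal_def less_top)
  then show ?thesis
    using irr erg inf fin fin_erg by blast
qed

end
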